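(* Let $p>2$, let $(\Omega_1,\Omega_2)$ be a good pair of domains in $\mathbb{C}$, let $(M,J)$ be a smooth almost complex manifold, and let $i\colon M\to\mathbb{R}^N$ be a (fixed) smooth Whitney embedding. Let $f_1\in\mathcal{O}_J(\Omega_1,M)$ and let $\mathcal{W}_2\subset\mathcal{O}_J(\Omega_2,M)$ be a family of maps that is precompact in $W^{1,p}(\Omega_2,M)$. Then for every $\epsilon>0$ there is $\delta>0$ such that for every $f_2\in\mathcal{W}_2$ satisfying $\|i\circ f_1-i\circ f_2\|_{W^{1,p}(\Omega_1\cap\Omega_2)}<\delta$ there exists a map $\widehat{f}\in\mathcal{O}_J(\Omega_1\cup\Omega_2,M)$ such that $$\mathrm{dist}_{\zeta\in\Omega_1}\bigl(\widehat{f}(\zeta),f_1(\zeta)\bigr)<\epsilon\quad\text{and}\quad\mathrm{dist}_{\zeta\in\Omega_2}\bigl(\widehat{f}(\zeta),f_2(\zeta)\bigr)<\epsilon.$$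
   Context: Good pair: let $\Omega_1,\Omega_2\subset\mathbb{C}$ be bounded simply connected domains with $\mathcal{C}^1$-boundary. The pair $(\Omega_1,\Omega_2)$ is called a good pair if $\Omega_1\cap\Omega_2$ is simply connected with $\mathcal{C}^1$-boundary and $\overline{\Omega_1\setminus\Omega_2}\cap\overline{\Omega_2\setminus\Omega_1}=\emptyset$. Manifold-valued Sobolev maps: $(M,J)$ is a smooth manifold with a smooth almost complex structure $J$ ($J^2=-\mathrm{id}$ on $TM$). By the Whitney embedding theorem there is a smooth embedding $i\colon M\to\mathbb{R}^N$, which is fixed and used to endow $M$ with the induced Riemannian metric. For $\Omega\subset\mathbb{C}$ and $p>2$, $$W^{1,p}(\Omega,M)=\{f\colon\Omega\to M;\ i\circ f\in W^{1,p}(\Omega,\mathbb{R}^N)\},$$ with the topology given by the distance $\|f-g\|_{W^{1,p}(\Omega,M)}:=\|i\circ f-i\circ g\|_{W^{1,p}(\Omega)}$. For maps $f,g\colon\Omega\to M$, $\mathrm{dist}_{\zeta\in\Omega}(f(\zeta),g(\zeta))$ denotes the uniform distance $\sup_{\zeta\in\Omega}\mathrm{dist}(f(\zeta),g(\zeta))$ with respect to this Riemannian metric. $J$-holomorphic maps: $f\in W^{1,p}(\Omega,M)$ is $J$-holomorphic if $df\circ J_{st}=J(f)\circ df$ (a.e. on $\Omega$), where $J_{st}$ is multiplication by the imaginary unit on $\mathbb{C}\cong\mathbb{R}^2$. $\mathcal{O}_J(\Omega,M)\subset W^{1,p}(\Omega,M)$ is the subset of $J$-holomorphic maps. Precompact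 means having compact closure. *)

theory Defs
  imports "HOL-Analysis.Analysis"
begin

section \<open>Smooth functions and planar domains\<close>

text \<open>Only used for open \<open>S\<close>, where the full derivative \<open>at x\<close> is the derivative relative to \<open>S\<close>.\<close>

fun Ck_on :: "nat \<Rightarrow> 'a::euclidean_space set \<Rightarrow> ('a \<Rightarrow> 'b::euclidean_space) \<Rightarrow> bool" where
  "Ck_on 0 S f \<longleftrightarrow> continuous_on S f"
| "Ck_on (Suc k) S f \<longleftrightarrow>
     (\<forall>x\<in>S. f differentiable (at x)) \<and> (\<forall>v. Ck_on k S (\<lambda>x. frechet_derivative f (at x) v))"

definition smooth_on :: "'a::euclidean_space set \<Rightarrow> ('a \<Rightarrow> 'b::euclidean_space) \<Rightarrow> bool" where
  "smooth_on S f \<longleftrightarrow> (\<forall>k. Ck_on k S f)"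

text \<open>Near each boundary point the set is, after a rotation, the strict epigraph of a \<open>C\<^sup>1\<close> function
  (so it lies locally on one side of its boundary).\<close>

definition C1_boundary :: "complex set \<Rightarrow> bool" where
  "C1_boundary \<Omega> \<longleftrightarrow>
     (\<forall>z0\<in>frontier \<Omega>. \<exists>a r h. norm a = 1 \<and> r > 0 \<and> (h :: real \<Rightarrow> real) C1_differentiable_on UNIV \<and>
        (\<forall>z\<in>ball z0 r. z \<in> \<Omega> \<longleftrightarrow> Im (a * (z - z0)) > h (Re (a * (z - z0)))))"

definition good_pair :: "complex set \<Rightarrow> complex set \<Rightarrow> bool" where
  "good_pair \<Omega>1 \<Omega>2 \<longleftrightarrow>
     (\<forall>\<Omega>\<in>{\<Omega>1, \<Omega>2}. open \<Omega> \<and> \<Omega> \<noteq> {} \<and> bounded \<Omega> \<and> simply_connected \<Omega> \<and> C1_boundary \<Omega>) \<and>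
     simply_connected (\<Omega>1 \<inter> \<Omega>2) \<and> C1_boundary (\<Omega>1 \<inter> \<Omega>2) \<and>
     closure (\<Omega>1 - \<Omega>2) \<inter> closure (\<Omega>2 - \<Omega>1) = {}"


section \<open>Sobolev functions with values in a Euclidean space\<close>

definition Lp_on :: "real \<Rightarrow> 'a::euclidean_space set \<Rightarrow> ('a \<Rightarrow> 'b::euclidean_space) set" where
  "Lp_on p \<Omega> = {u \<in> borel_measurable (lebesgue_on \<Omega>).
     integrable (lebesgue_on \<Omega>) (\<lambda>x. norm (u x) powr p)}"

definition locally_integrable_on :: "('a::euclidean_space \<Rightarrow> 'b::euclidean_space) \<Rightarrow> 'a set \<Rightarrow> bool"
    (infix "locally'_integrable'_on" 50) where
  "u locally_integrable_on \<Omega> \<longleftrightarrow> (\<forall>K. compact K \<and> K \<subseteq> \<Omega> \<longrightarrow> integrable (lebesgue_on K) u)"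

definition test_functions :: "'a::euclidean_space set \<Rightarrow> ('a \<Rightarrow> real) set" where
  "test_functions \<Omega> = {\<phi>. smooth_on UNIV \<phi> \<and> compact (closure {x. \<phi> x \<noteq> 0}) \<and>
     closure {x. \<phi> x \<noteq> 0} \<subseteq> \<Omega>}"

definition is_weak_partial ::
    "'a::euclidean_space set \<Rightarrow> ('a \<Rightarrow> 'b::euclidean_space) \<Rightarrow> 'a \<Rightarrow> ('a \<Rightarrow> 'b) \<Rightarrow> bool" where
  "is_weak_partial \<Omega> u b w \<longleftrightarrow> u locally_integrable_on \<Omega> \<and> w locally_integrable_on \<Omega> \<and>
     (\<forall>\<phi>\<in>test_functions \<Omega>.
        integral\<^sup>L (lebesgue_on \<Omega>) (\<lambda>x. frechet_derivative \<phi> (at x) b *\<^sub>R u x) =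
        - integral\<^sup>L (lebesgue_on \<Omega>) (\<lambda>x. \<phi> x *\<^sub>R w x))"

definition W1p :: "real \<Rightarrow> 'a::euclidean_space set \<Rightarrow> ('a \<Rightarrow> 'b::euclidean_space) set" where
  "W1p p \<Omega> = {u \<in> Lp_on p \<Omega>. \<forall>b\<in>Basis. \<exists>w\<in>Lp_on p \<Omega>. is_weak_partial \<Omega> u b w}"

text \<open>Weak partial derivatives are unique almost everywhere on open sets, so the choice below is
  immaterial.\<close>

definition weak_partial ::
    "'a::euclidean_space set \<Rightarrow> ('a \<Rightarrow> 'b::euclidean_space) \<Rightarrow> 'a \<Rightarrow> ('a \<Rightarrow> 'b)" where
  "weak_partial \<Omega> u b = (SOME w. is_weak_partial \<Omega> u b w)"

definition weak_derivative ::
    "'a::euclidean_space set \<Rightarrow> ('a \<Rightarrow> 'b::euclidean_space) \<Rightarrow> 'a \<Rightarrow> 'a \<Rightarrow> 'b" where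
  "weak_derivative \<Omega> u x v = (\<Sum>b\<in>Basis. (v \<bullet> b) *\<^sub>R weak_partial \<Omega> u b x)"

text \<open>The value \<open>0\<close> off \<open>W\<^sup>1\<^sup>,\<^sup>p\<close> is a dummy.\<close>

definition W1p_norm :: "real \<Rightarrow> 'a::euclidean_space set \<Rightarrow> ('a \<Rightarrow> 'b::euclidean_space) \<Rightarrow> real" where
  "W1p_norm p \<Omega> u =
     (if u \<in> W1p p \<Omega>
      then (integral\<^sup>L (lebesgue_on \<Omega>) (\<lambda>x. norm (u x) powr p) +
            (\<Sum>b\<in>Basis. integral\<^sup>L (lebesgue_on \<Omega>) (\<lambda>x. norm (weak_partial \<Omega> u b x) powr p))) powr (1 / p)
      else 0)"


section \<open>Smooth manifolds, tangent spaces, almost complex structures\<close>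

type_synonym ('m, 'e) chart = "'m set \<times> ('m \<Rightarrow> 'e)"

abbreviation chart_image :: "('m, 'e) chart \<Rightarrow> 'e set" where
  "chart_image c \<equiv> snd c ` fst c"

definition chart_inv :: "('m, 'e) chart \<Rightarrow> 'e \<Rightarrow> 'm" where
  "chart_inv c = inv_into (fst c) (snd c)"

definition is_chart :: "'m topology \<Rightarrow> ('m, 'e::euclidean_space) chart \<Rightarrow> bool" where
  "is_chart X c \<longleftrightarrow> openin X (fst c) \<and> open (chart_image c) \<and>
     homeomorphic_map (subtopology X (fst c)) (top_of_set (chart_image c)) (snd c)"

definition smooth_manifold :: "'m topology \<Rightarrow> ('m, 'e::euclidean_space) chart set \<Rightarrow> bool" where
  "smooth_manifold X A \<longleftrightarrow> Hausdorff_space X \<and> second_countable X \<and>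
     (\<forall>c\<in>A. is_chart X c) \<and> topspace X = (\<Union>c\<in>A. fst c) \<and>
     (\<forall>c\<in>A. \<forall>c'\<in>A. smooth_on (snd c ` (fst c \<inter> fst c')) (snd c' \<circ> chart_inv c))"

definition charts_at :: "('m, 'e) chart set \<Rightarrow> 'm \<Rightarrow> ('m, 'e) chart set" where
  "charts_at A q = {c \<in> A. q \<in> fst c}"

text \<open>A tangent vector at \<open>q\<close> is the family of its coordinate expressions in all charts around \<open>q\<close>
  (transforming by the Jacobians of the coordinate changes), extended by \<open>0\<close> to other arguments.
  Vector space operations are componentwise.\<close>

definition tangent_space ::
    "('m, 'e::euclidean_space) chart set \<Rightarrow> 'm \<Rightarrow> (('m, 'e) chart \<Rightarrow> 'e) set" where
  "tangent_space A q = {v. (\<forall>c. c \<notin> charts_at A q \<longrightarrow> v c = 0) \<and>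
     (\<forall>c\<in>charts_at A q. \<forall>c'\<in>charts_at A q.
        v c' = frechet_derivative (snd c' \<circ> chart_inv c) (at (snd c q)) (v c))}"

text \<open>The tangent vector at \<open>q\<close> with coordinate expression \<open>e\<close> in the chart \<open>c\<close>.\<close>

definition coord_vector ::
    "('m, 'e::euclidean_space) chart set \<Rightarrow> ('m, 'e) chart \<Rightarrow> 'm \<Rightarrow> 'e \<Rightarrow> (('m, 'e) chart \<Rightarrow> 'e)" where
  "coord_vector A c q e = (\<lambda>c'. if c' \<in> charts_at A q
     then frechet_derivative (snd c' \<circ> chart_inv c) (at (snd c q)) e else 0)"

definition almost_complex_structure :: "'m topology \<Rightarrow> ('m, 'e::euclidean_space) chart set \<Rightarrow>
    ('m \<Rightarrow> (('m, 'e) chart \<Rightarrow> 'e) \<Rightarrow> (('m, 'e) chart \<Rightarrow> 'e)) \<Rightarrow> bool" where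
  "almost_complex_structure X A J \<longleftrightarrow>
     (\<forall>q\<in>topspace X. \<forall>v\<in>tangent_space A q.
        J q v \<in> tangent_space A q \<and>
        (\<forall>w\<in>tangent_space A q. \<forall>s t.
           J q (\<lambda>c. s *\<^sub>R v c + t *\<^sub>R w c) = (\<lambda>c. s *\<^sub>R J q v c + t *\<^sub>R J q w c)) \<and>
        J q (J q v) = (\<lambda>c. - v c)) \<and>
     (\<forall>c\<in>A. \<forall>e. smooth_on (chart_image c)
        (\<lambda>x. J (chart_inv c x) (coord_vector A c (chart_inv c x) e) c))"

definition almost_complex_manifold :: "'m topology \<Rightarrow> ('m, 'e::euclidean_space) chart set \<Rightarrow>
    ('m \<Rightarrow> (('m, 'e) chart \<Rightarrow> 'e) \<Rightarrow> (('m, 'e) chart \<Rightarrow> 'e)) \<Rightarrow> bool" where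
  "almost_complex_manifold X A J \<longleftrightarrow> smooth_manifold X A \<and> almost_complex_structure X A J"

text \<open>The differential of a smooth Euclidean-valued map. On \<open>tangent_space A q\<close> it does not depend
  on the chosen chart.\<close>

definition differential_at ::
    "('m, 'e::euclidean_space) chart set \<Rightarrow> ('m \<Rightarrow> 'b::euclidean_space) \<Rightarrow> 'm \<Rightarrow>
     (('m, 'e) chart \<Rightarrow> 'e) \<Rightarrow> 'b" where
  "differential_at A g q v = (let c = (SOME c. c \<in> charts_at A q) in
     frechet_derivative (g \<circ> chart_inv c) (at (snd c q)) (v c))"

definition smooth_embedding ::
    "'m topology \<Rightarrow> ('m, 'e::euclidean_space) chart set \<Rightarrow> ('m \<Rightarrow> 'b::euclidean_space) \<Rightarrow> bool" where
  "smooth_embedding X A i \<longleftrightarrow> embedding_map X euclidean i \<and>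
     (\<forall>c\<in>A. smooth_on (chart_image c) (i \<circ> chart_inv c)) \<and>
     (\<forall>q\<in>topspace X. inj_on (differential_at A i q) (tangent_space A q))"

text \<open>Distance of the Riemannian metric induced by \<open>i\<close>: the length of a path in \<open>M\<close> is the Euclidean
  length of its image under \<open>i\<close>. The distance between different components is \<open>\<infinity>\<close>.\<close>

definition induced_length :: "('m \<Rightarrow> 'b::euclidean_space) \<Rightarrow> (real \<Rightarrow> 'm) \<Rightarrow> ennreal" where
  "induced_length i \<gamma> =
     (\<integral>\<^sup>+ t\<in>{0..1}. ennreal (norm (vector_derivative (i \<circ> \<gamma>) (at t))) \<partial>lborel)"

definition induced_dist ::
    "'m topology \<Rightarrow> ('m \<Rightarrow> 'b::euclidean_space) \<Rightarrow> 'm \<Rightarrow> 'm \<Rightarrow> ennreal" where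
  "induced_dist X i q q' = (INF \<gamma>\<in>{\<gamma>. pathin X \<gamma> \<and> (i \<circ> \<gamma>) piecewise_C1_differentiable_on {0..1} \<and>
     \<gamma> 0 = q \<and> \<gamma> 1 = q'}. induced_length i \<gamma>)"

definition uniform_dist ::
    "'m topology \<Rightarrow> ('m \<Rightarrow> 'b::euclidean_space) \<Rightarrow> 'z set \<Rightarrow> ('z \<Rightarrow> 'm) \<Rightarrow> ('z \<Rightarrow> 'm) \<Rightarrow> ennreal" where
  "uniform_dist X i \<Omega> f g = (SUP \<zeta>\<in>\<Omega>. induced_dist X i (f \<zeta>) (g \<zeta>))"


section \<open>Manifold-valued Sobolev maps and \<open>J\<close>-holomorphic maps\<close>

text \<open>For \<open>p > 2\<close> every class in \<open>W\<^sup>1\<^sup>,\<^sup>p\<close> on a planar domain has a unique continuous representative,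
  and elements are identified with it. Being extensional, maps on \<open>\<Omega>\<close> are equal as soon as they agree
  on \<open>\<Omega>\<close>.\<close>

definition W1p_maps :: "real \<Rightarrow> complex set \<Rightarrow> 'm topology \<Rightarrow> ('m \<Rightarrow> 'b::euclidean_space) \<Rightarrow>
    (complex \<Rightarrow> 'm) set" where
  "W1p_maps p \<Omega> X i =
     {f \<in> extensional \<Omega>. continuous_map (top_of_set \<Omega>) X f \<and> i \<circ> f \<in> W1p p \<Omega>}"

definition W1p_dist :: "real \<Rightarrow> complex set \<Rightarrow> ('m \<Rightarrow> 'b::euclidean_space) \<Rightarrow>
    (complex \<Rightarrow> 'm) \<Rightarrow> (complex \<Rightarrow> 'm) \<Rightarrow> real" where
  "W1p_dist p \<Omega> i f g = W1p_norm p \<Omega> (\<lambda>\<zeta>. i (f \<zeta>) - i (g \<zeta>))"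

definition W1p_topology :: "real \<Rightarrow> complex set \<Rightarrow> 'm topology \<Rightarrow> ('m \<Rightarrow> 'b::euclidean_space) \<Rightarrow>
    (complex \<Rightarrow> 'm) topology" where
  "W1p_topology p \<Omega> X i = Metric_space.mtopology (W1p_maps p \<Omega> X i) (W1p_dist p \<Omega> i)"

definition precompact_in :: "'a topology \<Rightarrow> 'a set \<Rightarrow> bool" where
  "precompact_in T W \<longleftrightarrow> W \<subseteq> topspace T \<and> compactin T (T closure_of W)"

text \<open>The differential \<open>df\<close> at \<open>\<zeta>\<close> is the lift of the weak derivative of \<open>i \<circ> f\<close> through the injective
  differential of \<open>i\<close>; in particular it is unique and real linear. The standard structure is
  multiplication by \<open>\<i>\<close>.\<close>

definition J_holomorphic_maps :: "real \<Rightarrow> complex set \<Rightarrow> 'm topology \<Rightarrow>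
    ('m, 'e::euclidean_space) chart set \<Rightarrow>
    ('m \<Rightarrow> (('m, 'e) chart \<Rightarrow> 'e) \<Rightarrow> (('m, 'e) chart \<Rightarrow> 'e)) \<Rightarrow>
    ('m \<Rightarrow> 'b::euclidean_space) \<Rightarrow> (complex \<Rightarrow> 'm) set" where
  "J_holomorphic_maps p \<Omega> X A J i = {f \<in> W1p_maps p \<Omega> X i.
     AE \<zeta> in lebesgue_on \<Omega>. \<exists>df.
       (\<forall>v. df v \<in> tangent_space A (f \<zeta>) \<and>
            differential_at A i (f \<zeta>) (df v) = weak_derivative \<Omega> (i \<circ> f) \<zeta> v) \<and>
       (\<forall>v. df (\<i> * v) = J (f \<zeta>) (df v))}"

end

(* If no delta worked, there would be maps f_k in W_2 with norm of i f_1 - i f_k on Omega_1 \<inter> Omega_2 tending to 0.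
   By precompactness a subsequence converges in W^{1,p}(Omega_2, M) to some g, which is J-holomorphic because
   the equation passes to limits almost everywhere, and which agrees with f_1 on Omega_1 \<inter> Omega_2. So f_1 and g
   glue to a J-holomorphic map on the union, which is uniformly close to f_k on Omega_2 for large k. Only the
   last point needs p > 2 and the C^1 boundary: as i(M) need not be closed, uniform closeness of the i f_k is not
   enough near the boundary, where the Riemannian distance is instead bounded by lengths of curves into a compact
   part of Omega_2, estimated as in Morrey's inequality. *)

theory Submission
  imports Defs
begin

section \<open>Smooth functions and test functions\<close>

text \<open>The glued map coincides with \<open>f1\<close> on \<open>\<Omega>1\<close>, so the first
  distance is 0 and only the second needs an estimate. There the images need not lie in a common
  compact part of the manifold, so lengths must be produced inside the manifold itself. They come
  from Euclidean increments of i o f over a subdivision of a segment, fine enough that consecutive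
  points are joined within a chart. The mesh may depend on the map and the segments; the bound on
  the sum of increments may not. That bound is the integral of the weak gradient, but a weak
  derivative says nothing about a single segment, so everything is averaged: over starting points in
  a small disc and over directions in a disc inside an interior cone. Segments of length about R
  cost a constant times R^(1-2/p), which is small for small R because p > 2. Here R is fixed before
  the index k of the sequence; convergence then only has to make the maps close at the inner end
  points, where the limit map takes values in a compact set and Euclidean closeness
  suffices.\<close>

lemma frechet_derivative_cong_open:
  assumes "open S" "x \<in> S" "\<And>y. y \<in> S \<Longrightarrow> f y = g y"
  shows "f differentiable (at x) \<longleftrightarrow> g differentiable (at x)"
    and "frechet_derivative f (at x) = frechet_derivative g (at x)"
proof -
  \<comment> \<open>Having the same derivatives suffices: differentiability and the choice in
    \<open>frechet_derivative\<close> depend on nothing else, so no derivative has to exist.\<close>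
  have "(f has_derivative D) (at x) \<longleftrightarrow> (g has_derivative D) (at x)" for D
    using assms has_derivative_transform_within_open[of f D x UNIV S g]
      has_derivative_transform_within_open[of g D x UNIV S f] by auto
  then show "f differentiable (at x) \<longleftrightarrow> g differentiable (at x)"
    "frechet_derivative f (at x) = frechet_derivative g (at x)"
    by (simp_all add: differentiable_def frechet_derivative_def)
qed

lemma Ck_on_cong_imp:
  "open S \<Longrightarrow> (\<And>x. x \<in> S \<Longrightarrow> f x = g x) \<Longrightarrow> Ck_on k S f \<Longrightarrow> Ck_on k S g"
proof (induction k arbitrary: f g)
  case 0 then show ?case using continuous_on_cong by force
next
  case (Suc k)
  have *: "f differentiable (at x) \<longleftrightarrow> g differentiable (at x)"
    "frechet_derivative f (at x) = frechet_derivative g (at x)" if "x \<in> S" for x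
    using frechet_derivative_cong_open[OF Suc.prems(1) that, of f g] Suc.prems(2) by auto
  have "Ck_on k S (\<lambda>x. frechet_derivative g (at x) v)" for v
    using Suc.IH[OF Suc.prems(1), of "\<lambda>x. frechet_derivative f (at x) v" "\<lambda>x. frechet_derivative g (at x) v"]
      Suc.prems(3) * by auto
  then show ?case using Suc.prems(3) * by auto
qed

lemma Ck_on_SucD: "Ck_on (Suc k) S f \<Longrightarrow> Ck_on k S f"
proof (induction k arbitrary: f)
  case 0 then show ?case
    by (auto intro!: continuous_at_imp_continuous_on differentiable_imp_continuous_within)
qed auto

text \<open>\<open>Ck_on\<close> refers to the chosen \<open>frechet_derivative\<close>; uniqueness
  of derivatives lets an explicit formula \<open>D\<close> replace it in the inductions
  below.\<close>

lemma Ck_on_SucI: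
  assumes "open S" "\<And>x. x \<in> S \<Longrightarrow> (f has_derivative D x) (at x)" "\<And>v. Ck_on k S (\<lambda>x. D x v)"
  shows "Ck_on (Suc k) S f"
proof -
  have "frechet_derivative f (at x) = D x" if "x \<in> S" for x
    using frechet_derivative_at[OF assms(2)[OF that]] by simp
  then have "Ck_on k S (\<lambda>x. frechet_derivative f (at x) v)" for v
    by (intro Ck_on_cong_imp[OF assms(1) _ assms(3)[of v]]) auto
  moreover have "f differentiable (at x)" if "x \<in> S" for x
    using assms(2)[OF that] by (auto simp: differentiable_def)
  ultimately show ?thesis by simp
qed

lemma Ck_on_derivative:
  "Ck_on (Suc k) S f \<Longrightarrow> x \<in> S \<Longrightarrow> (f has_derivative frechet_derivative f (at x)) (at x)"
  using frechet_derivative_works by auto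

lemma Ck_on_const [simp]: "Ck_on k S (\<lambda>x. c)"
  by (induction k arbitrary: c) auto

lemma Ck_on_add:
  assumes "open S" "Ck_on k S f" "Ck_on k S g"
  shows "Ck_on k S (\<lambda>x. f x + g x)"
  using assms(2,3)
proof (induction k arbitrary: f g)
  case 0 then show ?case by (auto intro: continuous_intros)
next
  case (Suc k)
  show ?case
  proof (rule Ck_on_SucI[OF assms(1)])
    show "((\<lambda>x. f x + g x) has_derivative
        (\<lambda>v. frechet_derivative f (at x) v + frechet_derivative g (at x) v)) (at x)" if "x \<in> S" for x
      using Ck_on_derivative[OF Suc.prems(1) that] Ck_on_derivative[OF Suc.prems(2) that]
      by (rule has_derivative_add)
    show "Ck_on k S (\<lambda>x. frechet_derivative f (at x) v + frechet_derivative g (at x) v)" for v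
      using Suc by auto
  qed
qed

lemma Ck_on_mult:
  fixes f g :: "'a::euclidean_space \<Rightarrow> real"
  assumes "open S" "Ck_on k S f" "Ck_on k S g"
  shows "Ck_on k S (\<lambda>x. f x * g x)"
  using assms(2,3)
proof (induction k arbitrary: f g)
  case 0 then show ?case by (auto intro: continuous_intros)
next
  case (Suc k)
  show ?case
  proof (rule Ck_on_SucI[OF assms(1)])
    show "((\<lambda>x. f x * g x) has_derivative
        (\<lambda>v. f x * frechet_derivative g (at x) v + frechet_derivative f (at x) v * g x)) (at x)" if "x \<in> S" for x
      using Ck_on_derivative[OF Suc.prems(1) that] Ck_on_derivative[OF Suc.prems(2) that]
      by (rule has_derivative_mult)
    show "Ck_on k S (\<lambda>x. f x * frechet_derivative g (at x) v + frechet_derivative f (at x) v * g x)" for v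
      using Suc.IH Suc.prems Ck_on_SucD[OF Suc.prems(1)] Ck_on_SucD[OF Suc.prems(2)]
      by (intro Ck_on_add assms(1)) auto
  qed
qed

lemma Ck_on_inverse:
  fixes f :: "'a::euclidean_space \<Rightarrow> real"
  assumes "open S" "Ck_on k S f" "\<And>x. x \<in> S \<Longrightarrow> f x \<noteq> 0"
  shows "Ck_on k S (\<lambda>x. inverse (f x))"
  using assms(2,3)
proof (induction k)
  case 0 then show ?case by (auto intro: continuous_intros)
next
  case (Suc k)
  \<comment> \<open>The derivative of 1/f is a product of 1/f, f' and 1/f, so order k of the inverse
    itself, given by the induction hypothesis, yields order k + 1.\<close>
  have inv: "Ck_on k S (\<lambda>x. inverse (f x))"
    using Suc Ck_on_SucD[OF Suc.prems(1)] by blast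
  show ?case
  proof (rule Ck_on_SucI[OF assms(1)])
    show "((\<lambda>x. inverse (f x)) has_derivative
        (\<lambda>v. (-1) * (inverse (f x) * frechet_derivative f (at x) v * inverse (f x)))) (at x)" if "x \<in> S" for x
      using Deriv.has_derivative_inverse[OF Suc.prems(2)[OF that] Ck_on_derivative[OF Suc.prems(1) that]]
      by simp
    show "Ck_on k S (\<lambda>x. (-1) * (inverse (f x) * frechet_derivative f (at x) v * inverse (f x)))" for v
      using Suc.prems(1) by (intro Ck_on_mult Ck_on_const inv assms(1)) auto
  qed
qed

text \<open>Composition with affine functionals suffices for products of one-variable bumps, and it
  stays an easy induction: a directional derivative is a constant multiple of a function of the same
  form.\<close>

lemma Ck_on_compose_affine:
  fixes f :: "real \<Rightarrow> real" and l :: "'a::euclidean_space \<Rightarrow> real"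
  assumes "Ck_on k UNIV f" "bounded_linear l"
  shows "Ck_on k UNIV (\<lambda>x. f (l x + c))"
  using assms(1)
proof (induction k arbitrary: f)
  case 0
  then show ?case
    using continuous_on_compose2[of UNIV f UNIV "\<lambda>x. l x + c"] linear_continuous_on[OF assms(2), of UNIV]
    by (simp add: continuous_on_add)
next
  case (Suc k)
  show ?case
  proof (rule Ck_on_SucI)
    show "((\<lambda>x. f (l x + c)) has_derivative (\<lambda>v. l v * frechet_derivative f (at (l x + c)) 1)) (at x)" for x
    proof -
      have d: "(f has_derivative frechet_derivative f (at (l x + c))) (at (l x + c))"
        using Ck_on_derivative[OF Suc.prems] by auto
      have "((\<lambda>x. l x + c) has_derivative l) (at x)"
        using bounded_linear_imp_has_derivative[OF assms(2)] by (auto intro!: derivative_eq_intros)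
      from has_derivative_compose[OF this d]
      have "((\<lambda>x. f (l x + c)) has_derivative (\<lambda>v. frechet_derivative f (at (l x + c)) (l v))) (at x)" .
      moreover have "frechet_derivative f (at (l x + c)) (l v) = l v * frechet_derivative f (at (l x + c)) 1" for v
        using linear_cmul[OF has_derivative_linear[OF d], of "l v" 1] by simp
      ultimately show ?thesis by simp
    qed
    show "Ck_on k UNIV (\<lambda>x. l v * frechet_derivative f (at (l x + c)) 1)" for v
      using Suc by (intro Ck_on_mult) auto
  qed auto
qed

lemma smooth_on_const: "smooth_on S (\<lambda>x. c)"
  by (simp add: smooth_on_def)

lemma smooth_on_add: "open S \<Longrightarrow> smooth_on S f \<Longrightarrow> smooth_on S g \<Longrightarrow> smooth_on S (\<lambda>x. f x + g x)"
  by (simp add: smooth_on_def Ck_on_add)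

lemma smooth_on_mult:
  fixes f g :: "'a::euclidean_space \<Rightarrow> real"
  shows "open S \<Longrightarrow> smooth_on S f \<Longrightarrow> smooth_on S g \<Longrightarrow> smooth_on S (\<lambda>x. f x * g x)"
  by (simp add: smooth_on_def Ck_on_mult)

lemma smooth_on_imp_continuous_on: "smooth_on S f \<Longrightarrow> continuous_on S f"
  unfolding smooth_on_def by (metis Ck_on.simps(1))

lemma smooth_on_frechet_derivative:
  "smooth_on S f \<Longrightarrow> x \<in> S \<Longrightarrow> (f has_derivative frechet_derivative f (at x)) (at x)"
  unfolding smooth_on_def using Ck_on_derivative by blast

lemma smooth_on_continuous_derivative:
  "smooth_on S f \<Longrightarrow> continuous_on S (\<lambda>x. frechet_derivative f (at x) v)"
  unfolding smooth_on_def by (metis Ck_on.simps)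

text \<open>The functions exp(-1/t) / t^n, extended by 0 to t \<le> 0. The index closes the family
  under differentiation up to linear combinations, so smoothness follows by induction from a single
  derivative formula.\<close>

definition flat_exp :: "nat \<Rightarrow> real \<Rightarrow> real" where
  "flat_exp n t = (if t > 0 then exp (- inverse t) * inverse t ^ n else 0)"

lemma flat_exp_tendsto: "((\<lambda>t. flat_exp n t) \<longlongrightarrow> 0) (at_right 0)"
proof -
  have "((\<lambda>x. x ^ n / exp x) \<longlongrightarrow> (0::real)) at_top"
    by (rule tendsto_power_div_exp_0)
  then have "((\<lambda>t. inverse t ^ n / exp (inverse t)) \<longlongrightarrow> (0::real)) (at_right 0)"
    by (rule filterlim_compose) (rule filterlim_inverse_at_top_right)
  then show ?thesis
    by (rule Lim_transform_eventually)
      (rule eventually_mono[OF eventually_at_right_less], simp add: flat_exp_def exp_minus field_simps)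
qed

lemma flat_exp_derivative:
  "(flat_exp n has_real_derivative flat_exp (n + 2) t - real n * flat_exp (n + 1) t) (at t)"
proof -
  consider "t > 0" | "t < 0" | "t = 0" by linarith
  then show ?thesis
  proof cases
    case 1
    have "((\<lambda>t. exp (- inverse t) * inverse t ^ n) has_real_derivative
        flat_exp (n + 2) t - real n * flat_exp (n + 1) t) (at t)"
    proof (rule DERIV_cong)
      show "((\<lambda>t. exp (- inverse t) * inverse t ^ n) has_real_derivative
          exp (- inverse t) * (inverse t * inverse t) * inverse t ^ n +
          exp (- inverse t) * (real n * (inverse t ^ (n - 1) * (- (inverse t * inverse t))))) (at t)"
        using 1 by (auto intro!: derivative_eq_intros simp: power2_eq_square mult_ac)
    \<comment> \<open>For n = 0 the truncated exponent \<open>n - 1\<close> is harmless, since its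
      term carries the factor \<open>real n\<close>.\<close>
    qed (use 1 in \<open>cases n; simp add: flat_exp_def algebra_simps\<close>)
    then show ?thesis
      by (rule DERIV_cong_ev[THEN iffD1, rotated -1])
        (use 1 in \<open>auto simp: flat_exp_def eventually_nhds intro!: exI[of _ "{0<..}"]\<close>)
  next
    case 2
    have "((\<lambda>t. 0) has_real_derivative flat_exp (n + 2) t - real n * flat_exp (n + 1) t) (at t)"
      using 2 by (auto simp: flat_exp_def)
    then show ?thesis
      by (rule DERIV_cong_ev[THEN iffD1, rotated -1])
        (use 2 in \<open>auto simp: flat_exp_def eventually_nhds intro!: exI[of _ "{..<0}"]\<close>)
  next
    case 3
    \<comment> \<open>For h > 0 the difference quotient at 0 is \<open>flat_exp (Suc n) h\<close>,
      and for h < 0 it is 0.\<close>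
    have "((\<lambda>h. flat_exp n h / h) \<longlongrightarrow> 0) (at_right 0)"
      by (rule Lim_transform_eventually[OF flat_exp_tendsto[of "Suc n"]])
        (rule eventually_mono[OF eventually_at_right_less], simp add: flat_exp_def field_simps)
    moreover have "((\<lambda>h. flat_exp n h / h) \<longlongrightarrow> 0) (at_left 0)"
      by (rule Lim_transform_eventually[OF tendsto_const])
        (simp add: eventually_at_left_field flat_exp_def, rule exI[of _ "-1"], simp)
    ultimately have "((\<lambda>h. flat_exp n h / h) \<longlongrightarrow> 0) (at 0)"
      by (simp add: filterlim_split_at)
    then show ?thesis using 3 by (simp add: DERIV_def flat_exp_def)
  qed
qed

lemma Ck_on_flat_exp: "Ck_on k UNIV (flat_exp n)"
proof (induction k arbitrary: n)
  case 0
  have "isCont (flat_exp n) t" for t by (rule DERIV_isCont) (rule flat_exp_derivative)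
  then show ?case by (simp add: continuous_at_imp_continuous_on)
next
  case (Suc k)
  show ?case
  proof (rule Ck_on_SucI)
    show "(flat_exp n has_derivative (\<lambda>v. v * (flat_exp (n + 2) x + (- real n) * flat_exp (n + 1) x))) (at x)" for x
      by (rule has_derivative_eq_rhs[OF flat_exp_derivative[of n x, unfolded has_field_derivative_def]])
        (auto simp: fun_eq_iff algebra_simps)
    show "Ck_on k UNIV (\<lambda>x. v * (flat_exp (n + 2) x + (- real n) * flat_exp (n + 1) x))" for v
      by (intro Ck_on_mult Ck_on_add Ck_on_const Suc open_UNIV)
  qed auto
qed

definition smooth_step :: "real \<Rightarrow> real" where
  "smooth_step t = flat_exp 0 t * inverse (flat_exp 0 t + flat_exp 0 (1 - t))"

lemma smooth_step_eq_0: "t \<le> 0 \<Longrightarrow> smooth_step t = 0"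
  and smooth_step_eq_1: "t \<ge> 1 \<Longrightarrow> smooth_step t = 1"
  and smooth_step_nonneg: "0 \<le> smooth_step t"
  and smooth_step_le_1: "smooth_step t \<le> 1"
proof -
  have e: "flat_exp 0 s \<ge> 0" "s > 0 \<Longrightarrow> flat_exp 0 s > 0" "s \<le> 0 \<Longrightarrow> flat_exp 0 s = 0" for s
    by (simp_all add: flat_exp_def)
  show "t \<le> 0 \<Longrightarrow> smooth_step t = 0"
    by (simp add: smooth_step_def e)
  show "t \<ge> 1 \<Longrightarrow> smooth_step t = 1"
    using e(2)[of t] e(3)[of "1 - t"] by (simp add: smooth_step_def)
  \<comment> \<open>At least one of t and 1 - t is positive.\<close>
  have pos: "flat_exp 0 t + flat_exp 0 (1 - t) > 0"
    using e(1,2)[of t] e(1,2)[of "1 - t"] by linarith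
  show "0 \<le> smooth_step t" "smooth_step t \<le> 1"
    using pos e(1)[of t] e(1)[of "1 - t"]
    by (simp_all add: smooth_step_def inverse_eq_divide divide_le_eq del: add_divide_distrib)
qed

lemma smooth_step_smooth: "Ck_on k UNIV smooth_step"
proof -
  have "Ck_on k UNIV (\<lambda>t. flat_exp 0 ((- t) + 1))"
    by (rule Ck_on_compose_affine[OF Ck_on_flat_exp]) (rule bounded_linear_minus[OF bounded_linear_ident])
  moreover have "flat_exp 0 t + flat_exp 0 (1 - t) > 0" for t
    by (auto simp: flat_exp_def add_pos_nonneg)
  then have "flat_exp 0 t + flat_exp 0 (1 - t) \<noteq> 0" for t
    by (metis less_irrefl)
  ultimately show ?thesis
    unfolding smooth_step_def
    by (intro Ck_on_mult Ck_on_inverse Ck_on_add Ck_on_flat_exp open_UNIV) auto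
qed

text \<open>The parameter n is a steepness: for n > 0 the value is 1 at points of the box at
  distance at least 1/n from the four sides, and 0 outside the box.\<close>

definition box_bump :: "complex \<Rightarrow> complex \<Rightarrow> real \<Rightarrow> complex \<Rightarrow> real" where
  "box_bump a b n z = smooth_step (n * (Re z - Re a)) * smooth_step (n * (Re b - Re z)) *
     (smooth_step (n * (Im z - Im a)) * smooth_step (n * (Im b - Im z)))"

lemma box_bump_smooth: "smooth_on UNIV (box_bump a b n)"
proof -
  have "Ck_on k UNIV (\<lambda>z. smooth_step (n * Re z + c))" "Ck_on k UNIV (\<lambda>z. smooth_step (- n * Re z + c))"
    "Ck_on k UNIV (\<lambda>z. smooth_step (n * Im z + c))" "Ck_on k UNIV (\<lambda>z. smooth_step (- n * Im z + c))" for k c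
    by (intro Ck_on_compose_affine[OF smooth_step_smooth] bounded_linear_mult_right[THEN bounded_linear_compose]
      bounded_linear_Re bounded_linear_Im)+
  from this(1)[of _ "- n * Re a"] this(2)[of _ "n * Re b"] this(3)[of _ "- n * Im a"] this(4)[of _ "n * Im b"]
  show ?thesis
    unfolding smooth_on_def box_bump_def by (intro allI Ck_on_mult) (simp_all add: algebra_simps)
qed

lemma box_bump_bounds: "0 \<le> box_bump a b n z" "box_bump a b n z \<le> 1"
  unfolding box_bump_def
  by (auto intro!: mult_nonneg_nonneg mult_le_one smooth_step_nonneg smooth_step_le_1)

lemma box_bump_outside: "n \<ge> 0 \<Longrightarrow> z \<notin> box a b \<Longrightarrow> box_bump a b n z = 0"
  unfolding box_bump_def in_box_complex_iff
  by (auto simp: not_less mult_nonneg_nonpos smooth_step_eq_0)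

lemma box_bump_inside:
  "n * (Re z - Re a) \<ge> 1 \<Longrightarrow> n * (Re b - Re z) \<ge> 1 \<Longrightarrow> n * (Im z - Im a) \<ge> 1 \<Longrightarrow> n * (Im b - Im z) \<ge> 1
   \<Longrightarrow> box_bump a b n z = 1"
  unfolding box_bump_def by (simp add: smooth_step_eq_1)

lemma box_bump_test:
  assumes "cbox a b \<subseteq> S" "n \<ge> 0"
  shows "box_bump a b n \<in> test_functions S"
proof -
  have "{z. box_bump a b n z \<noteq> 0} \<subseteq> cbox a b"
    using box_bump_outside[OF assms(2)] box_subset_cbox by blast
  then have "closure {z. box_bump a b n z \<noteq> 0} \<subseteq> cbox a b"
    by (rule closure_minimal) (rule closed_cbox)
  moreover have "compact (closure {z. box_bump a b n z \<noteq> 0})"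
    using calculation compact_Int_closed[of "cbox a b" "closure {z. box_bump a b n z \<noteq> 0}"]
    by (simp add: inf_absorb2)
  ultimately show ?thesis
    using assms(1) box_bump_smooth unfolding test_functions_def by blast
qed

lemma box_bump_tendsto: "(\<lambda>n. box_bump a b (real n) z) \<longlonglongrightarrow> indicator (box a b) z"
proof (cases "z \<in> box a b")
  case True
  then have pos: "Re z - Re a > 0" "Re b - Re z > 0" "Im z - Im a > 0" "Im b - Im z > 0"
    by (auto simp: in_box_complex_iff)
  have ev: "\<forall>\<^sub>F n in sequentially. real n * d \<ge> 1" if "d > 0" for d
  proof -
    have "\<forall>\<^sub>F n in sequentially. 1 / d \<le> real n"
      using filterlim_real_sequentially by (simp only: filterlim_at_top)
    then show ?thesis by (rule eventually_mono) (use that in \<open>simp add: field_simps\<close>)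
  qed
  have "\<forall>\<^sub>F n in sequentially. box_bump a b (real n) z = 1"
    using ev[OF pos(1)] ev[OF pos(2)] ev[OF pos(3)] ev[OF pos(4)]
    by eventually_elim (rule box_bump_inside)
  then show ?thesis using True by (simp add: tendsto_eventually)
qed (simp add: box_bump_outside)

lemma test_function_plateau:
  fixes z :: complex
  assumes "open S" "z \<in> S"
  obtains \<psi> W where "\<psi> \<in> test_functions S" "open W" "z \<in> W" "\<And>x. x \<in> W \<Longrightarrow> \<psi> x = 1"
proof -
  obtain a b where ab: "z \<in> box a b" "cbox a b \<subseteq> S"
    by (rule open_contains_cbox[OF assms])
  \<comment> \<open>\<open>d\<close> is the distance to the nearest side; points of the ball of
    radius d/2 keep distance d/2 from all sides, and there steepness 2/d gives the value 1.\<close>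
  define d where "d = Min {Re z - Re a, Re b - Re z, Im z - Im a, Im b - Im z}"
  have d: "d > 0" "d \<le> Re z - Re a" "d \<le> Re b - Re z" "d \<le> Im z - Im a" "d \<le> Im b - Im z"
    using ab(1) by (simp_all add: d_def in_box_complex_iff)
  show ?thesis
  proof
    show "box_bump a b (2 / d) \<in> test_functions S"
      using ab(2) d(1) by (intro box_bump_test) auto
    show "box_bump a b (2 / d) x = 1" if "x \<in> ball z (d / 2)" for x
    proof (rule box_bump_inside)
      have "\<bar>Re x - Re z\<bar> < d / 2" "\<bar>Im x - Im z\<bar> < d / 2"
        using that abs_Re_le_cmod[of "x - z"] abs_Im_le_cmod[of "x - z"]
        by (auto simp: dist_norm norm_minus_commute)
      then have "Re x - Re a \<ge> d / 2" "Re b - Re x \<ge> d / 2" "Im x - Im a \<ge> d / 2" "Im b - Im x \<ge> d / 2"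
        using d by linarith+
      then show "2 / d * (Re x - Re a) \<ge> 1" "2 / d * (Re b - Re x) \<ge> 1"
          "2 / d * (Im x - Im a) \<ge> 1" "2 / d * (Im b - Im x) \<ge> 1"
        using d(1) by (simp_all add: le_divide_eq)
    qed
  qed (use d(1) in auto)
qed

section \<open>Operations on test functions and splitting over two open sets\<close>

lemma test_functionsD:
  assumes "\<phi> \<in> test_functions S"
  shows "smooth_on UNIV \<phi>" "compact (closure {x. \<phi> x \<noteq> 0})" "closure {x. \<phi> x \<noteq> 0} \<subseteq> S"
  using assms by (auto simp: test_functions_def)

lemma test_functionsI:
  assumes "smooth_on UNIV \<phi>" "compact K" "K \<subseteq> S" "\<And>x. x \<notin> K \<Longrightarrow> \<phi> x = 0"
  shows "\<phi> \<in> test_functions S"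
proof -
  have "closure {x. \<phi> x \<noteq> 0} \<subseteq> K"
    using assms by (intro closure_minimal) (auto simp: compact_imp_closed)
  then show ?thesis
    using assms compact_Int_closed[of K "closure {x. \<phi> x \<noteq> 0}"] unfolding test_functions_def
    by (simp add: inf_absorb2)
qed

lemma test_functions_mono: "S \<subseteq> T \<Longrightarrow> test_functions S \<subseteq> test_functions T"
  by (auto simp: test_functions_def)

lemma test_function_mult:
  assumes "smooth_on UNIV \<phi>" "\<psi> \<in> test_functions S"
  shows "(\<lambda>x. \<phi> x * \<psi> x) \<in> test_functions S"
  using test_functionsD[OF assms(2)] assms(1)
  by (intro test_functionsI[where K="closure {x. \<psi> x \<noteq> 0}"] smooth_on_mult)
    (use closure_subset[of "{x. \<psi> x \<noteq> 0}"] in auto)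

lemma test_function_add:
  assumes "\<phi> \<in> test_functions S" "\<psi> \<in> test_functions S"
  shows "(\<lambda>x. \<phi> x + \<psi> x) \<in> test_functions S"
  using test_functionsD[OF assms(1)] test_functionsD[OF assms(2)]
proof (intro test_functionsI[where K="closure {x. \<phi> x \<noteq> 0} \<union> closure {x. \<psi> x \<noteq> 0}"] smooth_on_add compact_Un)
  fix x assume "x \<notin> closure {x. \<phi> x \<noteq> 0} \<union> closure {x. \<psi> x \<noteq> 0}"
  then have "\<phi> x = 0" "\<psi> x = 0"
    using closure_subset[of "{x. \<phi> x \<noteq> 0}"] closure_subset[of "{x. \<psi> x \<noteq> 0}"] by blast+
  then show "\<phi> x + \<psi> x = 0" by simp
qed auto

lemma test_function_zero: "(\<lambda>x. 0) \<in> test_functions S"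
  by (rule test_functionsI[where K="{}"]) (auto simp: smooth_on_const)

text \<open>Multiplying successively by \<open>\<psi>\<close> and \<open>1 - \<psi>\<close> for plateau functions \<open>\<psi>\<close> avoids dividing by a sum of
  bump functions.\<close>

lemma test_function_split_list:
  assumes "set \<psi>s \<subseteq> test_functions U \<union> test_functions V" "smooth_on UNIV \<phi>"
  shows "\<exists>\<phi>1\<in>test_functions U. \<exists>\<phi>2\<in>test_functions V.
    \<forall>x. \<phi> x = \<phi>1 x + \<phi>2 x + \<phi> x * (\<Prod>\<psi>\<leftarrow>\<psi>s. 1 - \<psi> x)"
  using assms
proof (induction \<psi>s arbitrary: \<phi>)
  case Nil
  then show ?case using test_function_zero by force
next
  case (Cons \<psi> \<psi>s)
  have sm: "smooth_on UNIV \<psi>" using Cons.prems(1) test_functionsD(1) by auto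
  \<comment> \<open>The part \<open>\<phi> * \<psi>\<close> goes to the set on which
    \<open>\<psi>\<close> is supported; the induction hypothesis splits what remains,
    \<open>\<phi> * (1 - \<psi>)\<close>.\<close>
  have "smooth_on UNIV (\<lambda>x. \<phi> x * (1 + (-1) * \<psi> x))"
    by (intro smooth_on_mult smooth_on_add smooth_on_const sm Cons.prems open_UNIV)
  from Cons.IH[OF _ this] Cons.prems(1) obtain \<phi>1 \<phi>2 where \<phi>:
    "\<phi>1 \<in> test_functions U" "\<phi>2 \<in> test_functions V"
    "\<And>x. \<phi> x * (1 - \<psi> x) = \<phi>1 x + \<phi>2 x + \<phi> x * (1 - \<psi> x) * (\<Prod>\<psi>\<leftarrow>\<psi>s. 1 - \<psi> x)"
    by auto
  have eq: "\<phi> x = \<phi> x * \<psi> x + (\<phi>1 x + \<phi>2 x + \<phi> x * (1 - \<psi> x) * (\<Prod>\<psi>\<leftarrow>\<psi>s. 1 - \<psi> x))" for x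
    using \<phi>(3)[of x] by (simp add: algebra_simps)
  from Cons.prems(1) consider "\<psi> \<in> test_functions U" | "\<psi> \<in> test_functions V" by auto
  then show ?case
  proof cases
    case 1
    have "(\<lambda>x. \<phi> x * \<psi> x + \<phi>1 x) \<in> test_functions U"
      by (intro test_function_add test_function_mult Cons.prems(2) 1 \<phi>(1))
    moreover have "\<phi> x = \<phi> x * \<psi> x + \<phi>1 x + \<phi>2 x + \<phi> x * (\<Prod>\<psi>\<leftarrow>\<psi> # \<psi>s. 1 - \<psi> x)" for x
      using eq[of x] by simp
    ultimately show ?thesis using \<phi>(2) by (intro bexI[of _ "\<lambda>x. \<phi> x * \<psi> x + \<phi>1 x"] bexI[of _ \<phi>2]) auto
  next
    case 2
    have "(\<lambda>x. \<phi> x * \<psi> x + \<phi>2 x) \<in> test_functions V"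
      by (intro test_function_add test_function_mult Cons.prems(2) 2 \<phi>(2))
    moreover have "\<phi> x = \<phi>1 x + (\<phi> x * \<psi> x + \<phi>2 x) + \<phi> x * (\<Prod>\<psi>\<leftarrow>\<psi> # \<psi>s. 1 - \<psi> x)" for x
      using eq[of x] by simp
    ultimately show ?thesis using \<phi>(1) by (intro bexI[of _ \<phi>1] bexI[of _ "\<lambda>x. \<phi> x * \<psi> x + \<phi>2 x"]) auto
  qed
qed

text \<open>Finitely many plateaus cover the compact support, so wherever \<open>\<phi>\<close> is
  nonzero some factor \<open>1 - \<psi>\<close> vanishes and the remainder of
  \<open>test_function_split_list\<close> disappears. This splitting is what makes weak derivatives
  on two open sets glue.\<close>

lemma test_function_partition:
  fixes \<phi> :: "complex \<Rightarrow> real"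
  assumes "\<phi> \<in> test_functions (U \<union> V)" "open U" "open V"
  obtains \<phi>1 \<phi>2 where "\<phi>1 \<in> test_functions U" "\<phi>2 \<in> test_functions V" "\<And>x. \<phi> x = \<phi>1 x + \<phi>2 x"
proof -
  let ?K = "closure {x. \<phi> x \<noteq> 0}"
  have "\<exists>\<psi> W. \<psi> \<in> test_functions U \<union> test_functions V \<and> open W \<and> z \<in> W \<and> (\<forall>x\<in>W. \<psi> x = 1)"
    if z: "z \<in> ?K" for z
  proof -
    consider "z \<in> U" | "z \<in> V" using test_functionsD(3)[OF assms(1)] z by blast
    then show ?thesis
    proof cases
      case 1
      then obtain \<psi> W where "\<psi> \<in> test_functions U" "open W" "z \<in> W" "\<And>x. x \<in> W \<Longrightarrow> \<psi> x = 1"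
        using test_function_plateau[OF assms(2)] by blast
      then show ?thesis by (intro exI[of _ \<psi>] exI[of _ W]) simp
    next
      case 2
      then obtain \<psi> W where "\<psi> \<in> test_functions V" "open W" "z \<in> W" "\<And>x. x \<in> W \<Longrightarrow> \<psi> x = 1"
        using test_function_plateau[OF assms(3)] by blast
      then show ?thesis by (intro exI[of _ \<psi>] exI[of _ W]) simp
    qed
  qed
  then have "\<forall>z\<in>?K. \<exists>\<psi> W. \<psi> \<in> test_functions U \<union> test_functions V \<and> open W \<and> z \<in> W \<and> (\<forall>x\<in>W. \<psi> x = 1)"
    by (rule ballI)
  from bchoice[OF this] obtain \<psi> where "\<forall>z\<in>?K. \<exists>W. \<psi> z \<in> test_functions U \<union> test_functions V \<and> open W \<and> z \<in> W \<and> (\<forall>x\<in>W. \<psi> z x = 1)"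
    by (rule exE)
  from bchoice[OF this] obtain W where "\<forall>z\<in>?K. \<psi> z \<in> test_functions U \<union> test_functions V \<and> open (W z) \<and> z \<in> W z \<and> (\<forall>x\<in>W z. \<psi> z x = 1)"
    by (rule exE)
  then have \<psi>: "z \<in> ?K \<Longrightarrow> \<psi> z \<in> test_functions U \<union> test_functions V"
    "z \<in> ?K \<Longrightarrow> open (W z)" "z \<in> ?K \<Longrightarrow> z \<in> W z" "z \<in> ?K \<Longrightarrow> x \<in> W z \<Longrightarrow> \<psi> z x = 1" for z x
    by simp_all
  obtain D where D: "D \<subseteq> ?K" "finite D" "?K \<subseteq> \<Union> (W ` D)"
  proof (rule compactE_image[OF test_functionsD(2)[OF assms(1)], of ?K W])
    show "?K \<subseteq> \<Union> (W ` ?K)" using \<psi>(3) by auto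
  qed (use \<psi>(2) in auto)
  obtain zs where zs: "set zs = D" using finite_list[OF D(2)] by blast
  obtain \<phi>1 \<phi>2 where \<phi>: "\<phi>1 \<in> test_functions U" "\<phi>2 \<in> test_functions V"
    "\<And>x. \<phi> x = \<phi>1 x + \<phi>2 x + \<phi> x * (\<Prod>\<psi>\<leftarrow>map \<psi> zs. 1 - \<psi> x)"
  proof -
    have "set (map \<psi> zs) \<subseteq> test_functions U \<union> test_functions V"
      using zs D(1) \<psi>(1) by auto
    from test_function_split_list[OF this test_functionsD(1)[OF assms(1)]]
    obtain \<phi>1 \<phi>2 where "\<phi>1 \<in> test_functions U" "\<phi>2 \<in> test_functions V"
      and eq: "\<forall>x. \<phi> x = \<phi>1 x + \<phi>2 x + \<phi> x * (\<Prod>\<psi>\<leftarrow>map \<psi> zs. 1 - \<psi> x)" by (elim bexE)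
    from this(1,2) eq[THEN spec] show ?thesis by (rule that)
  qed
  have zero: "\<phi> x * (\<Prod>\<psi>\<leftarrow>map \<psi> zs. 1 - \<psi> x) = 0" for x
  proof (cases "\<phi> x = 0")
    case False
    then have "x \<in> ?K" using closure_subset[of "{x. \<phi> x \<noteq> 0}"] by blast
    then obtain z where z: "z \<in> D" "x \<in> W z" using D(3) by blast
    then have "\<psi> z x = 1" using D(1) by (intro \<psi>(4)) blast+
    with z(1) zs have "0 \<in> set (map (\<lambda>\<psi>. 1 - \<psi> x) (map \<psi> zs))" by force
    then have "(\<Prod>\<psi>\<leftarrow>map \<psi> zs. 1 - \<psi> x) = 0" by (simp only: prod_list_zero_iff)
    then show ?thesis by (simp only: mult_zero_right)
  qed simp
  have "\<phi> x = \<phi>1 x + \<phi>2 x" for x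
    by (subst \<phi>(3)) (simp only: zero add_0_right)
  with \<phi>(1,2) show ?thesis by (rule that)
qed

section \<open>Weak partial derivatives\<close>

lemma integrable_lebesgue_on_iff:
  fixes f :: "'a::euclidean_space \<Rightarrow> 'b::euclidean_space"
  assumes "S \<in> sets lebesgue"
  shows "integrable (lebesgue_on S) f \<longleftrightarrow> integrable lebesgue (\<lambda>x. indicator S x *\<^sub>R f x)"
  using integrable_restrict_space[of S lebesgue f] assms by simp

lemma integral_lebesgue_on_eq:
  fixes f :: "'a::euclidean_space \<Rightarrow> 'b::euclidean_space"
  assumes "S \<in> sets lebesgue" "\<And>x. x \<notin> S \<Longrightarrow> f x = 0"
  shows "integral\<^sup>L (lebesgue_on S) f = integral\<^sup>L lebesgue f"
proof -
  have "(\<lambda>x. indicator S x *\<^sub>R f x) = f"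
    using assms(2) by (auto simp: fun_eq_iff indicator_def)
  then show ?thesis using integral_restrict_space[of S lebesgue f] assms(1) by simp
qed

lemma locally_integrable_onD:
  "u locally_integrable_on S \<Longrightarrow> compact K \<Longrightarrow> K \<subseteq> S \<Longrightarrow> integrable lebesgue (\<lambda>x. indicator K x *\<^sub>R u x)"
  unfolding locally_integrable_on_def
  by (metis integrable_lebesgue_on_iff compact_imp_closed closed_def lebesgue_closedin sets_completionI_sets
      borel_compact sets_lborel)

lemma locally_integrable_onI:
  "(\<And>K. compact K \<Longrightarrow> K \<subseteq> S \<Longrightarrow> integrable lebesgue (\<lambda>x. indicator K x *\<^sub>R u x)) \<Longrightarrow> u locally_integrable_on S"
  unfolding locally_integrable_on_def
  by (metis integrable_lebesgue_on_iff sets_completionI_sets borel_compact sets_lborel)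

lemma integrable_compact_support_mult:
  fixes u :: "'a::euclidean_space \<Rightarrow> 'b::euclidean_space" and \<psi> :: "'a \<Rightarrow> real"
  assumes u: "u locally_integrable_on S" and K: "compact K" "K \<subseteq> S"
    and \<psi>: "continuous_on UNIV \<psi>" "\<And>x. x \<notin> K \<Longrightarrow> \<psi> x = 0"
  shows "integrable lebesgue (\<lambda>x. \<psi> x *\<^sub>R u x)"
proof -
  have "bounded (\<psi> ` K)"
    using K(1) \<psi>(1) by (metis compact_continuous_image compact_imp_bounded continuous_on_subset subset_UNIV)
  then obtain B where B: "\<And>x. x \<in> K \<Longrightarrow> \<bar>\<psi> x\<bar> \<le> B"
    unfolding bounded_iff by (metis image_eqI real_norm_def)
  have eq: "\<psi> x *\<^sub>R u x = \<psi> x *\<^sub>R (indicator K x *\<^sub>R u x)" for x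
    using \<psi>(2)[of x] by (cases "x \<in> K") auto
  have int: "integrable lebesgue (\<lambda>x. indicator K x *\<^sub>R u x)"
    by (rule locally_integrable_onD[OF u K])
  have \<psi>m: "\<psi> \<in> borel_measurable lebesgue"
    using borel_measurable_continuous_onI[OF \<psi>(1)] by (simp add: measurable_completion)
  have "integrable lebesgue (\<lambda>x. \<psi> x *\<^sub>R (indicator K x *\<^sub>R u x))"
  proof (rule Bochner_Integration.integrable_bound)
    show "integrable lebesgue (\<lambda>x. B *\<^sub>R (indicator K x *\<^sub>R u x))"
      by (rule integrable_scaleR_right) (rule int)
    show "(\<lambda>x. \<psi> x *\<^sub>R (indicator K x *\<^sub>R u x)) \<in> borel_measurable lebesgue"
      by (rule borel_measurable_scaleR[OF \<psi>m borel_measurable_integrable[OF int]])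
    have "norm (\<psi> x *\<^sub>R indicator K x *\<^sub>R u x) \<le> norm (B *\<^sub>R indicator K x *\<^sub>R u x)" for x
    proof (cases "x \<in> K")
      case True
      then show ?thesis using B[OF True] by (auto intro!: mult_right_mono)
    qed simp
    then show "AE x in lebesgue. norm (\<psi> x *\<^sub>R indicator K x *\<^sub>R u x) \<le> norm (B *\<^sub>R indicator K x *\<^sub>R u x)"
      by simp
  qed
  then show ?thesis by (simp only: eq[symmetric])
qed

lemma test_function_derivative_support:
  assumes "\<phi> \<in> test_functions S" "x \<notin> closure {x. \<phi> x \<noteq> 0}"
  shows "\<phi> x = 0" "frechet_derivative \<phi> (at x) b = 0"
proof -
  show "\<phi> x = 0" using assms(2) closure_subset[of "{x. \<phi> x \<noteq> 0}"] by blast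
  have "frechet_derivative \<phi> (at x) = frechet_derivative (\<lambda>x. 0) (at x)"
  proof (rule frechet_derivative_cong_open(2))
    show "open (- closure {x. \<phi> x \<noteq> 0})" by (simp add: open_Compl)
    show "\<phi> y = 0" if "y \<in> - closure {x. \<phi> x \<noteq> 0}" for y
      using that closure_subset[of "{x. \<phi> x \<noteq> 0}"] by blast
  qed (use assms(2) in simp)
  then show "frechet_derivative \<phi> (at x) b = 0" by simp
qed

lemma test_function_continuous:
  assumes "\<phi> \<in> test_functions S"
  shows "continuous_on UNIV \<phi>" "continuous_on UNIV (\<lambda>x. frechet_derivative \<phi> (at x) b)"
  by (rule smooth_on_imp_continuous_on[OF test_functionsD(1)[OF assms]],
      rule smooth_on_continuous_derivative[OF test_functionsD(1)[OF assms]])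

lemma test_function_integrable:
  assumes "\<phi> \<in> test_functions S" "u locally_integrable_on S"
  shows "integrable lebesgue (\<lambda>x. \<phi> x *\<^sub>R u x)"
    "integrable lebesgue (\<lambda>x. frechet_derivative \<phi> (at x) b *\<^sub>R u x)"
  by (rule integrable_compact_support_mult[OF assms(2) test_functionsD(2,3)[OF assms(1)]],
      rule test_function_continuous[OF assms(1)], erule test_function_derivative_support[OF assms(1)])+

text \<open>Test functions and their derivatives vanish off \<open>S\<close>, so the integrals may
  be taken over the whole space. The domain then enters only through local integrability and the
  admissible test functions, and different domains can be compared without a change of
  measure.\<close>

lemma is_weak_partial_iff:
  assumes "open S"
  shows "is_weak_partial S u b w \<longleftrightarrow> u locally_integrable_on S \<and> w locally_integrable_on S \<and>
    (\<forall>\<phi>\<in>test_functions S. integral\<^sup>L lebesgue (\<lambda>x. frechet_derivative \<phi> (at x) b *\<^sub>R u x) =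
        - integral\<^sup>L lebesgue (\<lambda>x. \<phi> x *\<^sub>R w x))"
proof -
  have S: "S \<in> sets lebesgue" using assms by simp
  have "integral\<^sup>L (lebesgue_on S) (\<lambda>x. frechet_derivative \<phi> (at x) b *\<^sub>R u x) =
      integral\<^sup>L lebesgue (\<lambda>x. frechet_derivative \<phi> (at x) b *\<^sub>R u x)"
    "integral\<^sup>L (lebesgue_on S) (\<lambda>x. \<phi> x *\<^sub>R w x) = integral\<^sup>L lebesgue (\<lambda>x. \<phi> x *\<^sub>R w x)"
    if "\<phi> \<in> test_functions S" for \<phi>
    using test_functionsD(3)[OF that] test_function_derivative_support[OF that]
    by (intro integral_lebesgue_on_eq[OF S]; metis scaleR_zero_left subsetD)+
  then show ?thesis unfolding is_weak_partial_def by auto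
qed

lemma is_weak_partial_restrict:
  assumes "is_weak_partial S u b w" "T \<subseteq> S" "open S" "open T"
  shows "is_weak_partial T u b w"
  using assms test_functions_mono[OF assms(2)]
  unfolding is_weak_partial_iff[OF assms(3)] is_weak_partial_iff[OF assms(4)] locally_integrable_on_def
  by blast

lemma locally_integrable_on_linear:
  assumes "u locally_integrable_on S" "v locally_integrable_on S"
  shows "(\<lambda>x. s *\<^sub>R u x + t *\<^sub>R v x) locally_integrable_on S"
  using assms unfolding locally_integrable_on_def by auto

lemma is_weak_partial_linear:
  assumes "open S" "is_weak_partial S u b w" "is_weak_partial S u' b w'"
  shows "is_weak_partial S (\<lambda>x. s *\<^sub>R u x + t *\<^sub>R u' x) b (\<lambda>x. s *\<^sub>R w x + t *\<^sub>R w' x)"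
proof -
  note A = assms(2,3)[unfolded is_weak_partial_iff[OF assms(1)]]
  have "integral\<^sup>L lebesgue (\<lambda>x. frechet_derivative \<phi> (at x) b *\<^sub>R (s *\<^sub>R u x + t *\<^sub>R u' x)) =
     - integral\<^sup>L lebesgue (\<lambda>x. \<phi> x *\<^sub>R (s *\<^sub>R w x + t *\<^sub>R w' x))" if \<phi>: "\<phi> \<in> test_functions S" for \<phi>
  proof -
    note int = test_function_integrable[OF \<phi>]
    have "integral\<^sup>L lebesgue (\<lambda>x. frechet_derivative \<phi> (at x) b *\<^sub>R (s *\<^sub>R u x + t *\<^sub>R u' x)) =
      integral\<^sup>L lebesgue (\<lambda>x. s *\<^sub>R (frechet_derivative \<phi> (at x) b *\<^sub>R u x) + t *\<^sub>R (frechet_derivative \<phi> (at x) b *\<^sub>R u' x))"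
      by (simp add: algebra_simps)
    also have "\<dots> = s *\<^sub>R integral\<^sup>L lebesgue (\<lambda>x. frechet_derivative \<phi> (at x) b *\<^sub>R u x) +
       t *\<^sub>R integral\<^sup>L lebesgue (\<lambda>x. frechet_derivative \<phi> (at x) b *\<^sub>R u' x)"
      using A by (subst Bochner_Integration.integral_add) (auto simp del: scaleR_scaleR intro!: integrable_scaleR_right int)
    also have "\<dots> = - (s *\<^sub>R integral\<^sup>L lebesgue (\<lambda>x. \<phi> x *\<^sub>R w x) + t *\<^sub>R integral\<^sup>L lebesgue (\<lambda>x. \<phi> x *\<^sub>R w' x))"
      using A \<phi> by simp
    also have "s *\<^sub>R integral\<^sup>L lebesgue (\<lambda>x. \<phi> x *\<^sub>R w x) + t *\<^sub>R integral\<^sup>L lebesgue (\<lambda>x. \<phi> x *\<^sub>R w' x) =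
      integral\<^sup>L lebesgue (\<lambda>x. s *\<^sub>R (\<phi> x *\<^sub>R w x) + t *\<^sub>R (\<phi> x *\<^sub>R w' x))"
      using A by (subst Bochner_Integration.integral_add) (auto simp del: scaleR_scaleR intro!: integrable_scaleR_right int)
    finally show ?thesis by (simp add: algebra_simps)
  qed
  then show ?thesis
    using A by (simp add: is_weak_partial_iff[OF assms(1)] locally_integrable_on_linear)
qed

lemma AE_lebesgue_on_iff:
  "S \<in> sets lebesgue \<Longrightarrow> (AE x in lebesgue_on S. P x) \<longleftrightarrow> (AE x in lebesgue. x \<in> S \<longrightarrow> P x)"
  by (simp add: AE_restrict_space_iff)

lemma integral_test_cong_AE:
  assumes "AE x in lebesgue_on S. u x = u' x" "open S" "\<And>x. x \<notin> S \<Longrightarrow> \<psi> x = (0::real)"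
    "integrable lebesgue (\<lambda>x. \<psi> x *\<^sub>R u x)" "integrable lebesgue (\<lambda>x. \<psi> x *\<^sub>R u' x)"
  shows "integral\<^sup>L lebesgue (\<lambda>x. \<psi> x *\<^sub>R u x) = integral\<^sup>L lebesgue (\<lambda>x. \<psi> x *\<^sub>R u' x)"
proof (rule integral_cong_AE)
  have "AE x in lebesgue. x \<in> S \<longrightarrow> u x = u' x" using assms(1,2) by (simp add: AE_lebesgue_on_iff)
  then show "AE x in lebesgue. \<psi> x *\<^sub>R u x = \<psi> x *\<^sub>R u' x"
    by (rule AE_mp) (use assms(3) in auto)
qed (use assms(4,5) in auto)

text \<open>Both sides of the defining identity are integrals, which ignore null sets. It serves to
  pass to Borel versions of weak derivatives and to merge derivatives on overlapping
  domains.\<close>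

lemma is_weak_partial_cong_AE:
  assumes S: "open S" and wp: "is_weak_partial S u b w" and "AE x in lebesgue_on S. w x = w' x"
    "AE x in lebesgue_on S. u x = u' x" "u' locally_integrable_on S" "w' locally_integrable_on S"
  shows "is_weak_partial S u' b w'"
proof -
  note A = wp[unfolded is_weak_partial_iff[OF S]]
  have "integral\<^sup>L lebesgue (\<lambda>x. frechet_derivative \<phi> (at x) b *\<^sub>R u' x) =
     - integral\<^sup>L lebesgue (\<lambda>x. \<phi> x *\<^sub>R w' x)" if \<phi>: "\<phi> \<in> test_functions S" for \<phi>
  proof -
    have z: "x \<notin> S \<Longrightarrow> \<phi> x = 0" "x \<notin> S \<Longrightarrow> frechet_derivative \<phi> (at x) b = 0" for x
      using test_functionsD(3)[OF \<phi>] test_function_derivative_support[OF \<phi>, of x] by auto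
    have "integral\<^sup>L lebesgue (\<lambda>x. frechet_derivative \<phi> (at x) b *\<^sub>R u x) =
        integral\<^sup>L lebesgue (\<lambda>x. frechet_derivative \<phi> (at x) b *\<^sub>R u' x)"
      by (rule integral_test_cong_AE[OF assms(4) S]) (use z A assms(5) test_function_integrable[OF \<phi>] in auto)
    moreover have "integral\<^sup>L lebesgue (\<lambda>x. \<phi> x *\<^sub>R w x) = integral\<^sup>L lebesgue (\<lambda>x. \<phi> x *\<^sub>R w' x)"
      by (rule integral_test_cong_AE[OF assms(3) S]) (use z A assms(6) test_function_integrable[OF \<phi>] in auto)
    ultimately show ?thesis using A \<phi> by simp
  qed
  then show ?thesis using assms(5,6) by (simp add: is_weak_partial_iff[OF S])
qed

text \<open>A test function on the union splits into one on each set, and the two identities are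
  added. Both sets must share one function \<open>w\<close>, so separately chosen derivatives have
  to be merged beforehand.\<close>

lemma is_weak_partial_glue:
  fixes u w :: "complex \<Rightarrow> 'b::euclidean_space"
  assumes "open S" "open T" "is_weak_partial S u b w" "is_weak_partial T u b w"
    "u locally_integrable_on S \<union> T" "w locally_integrable_on S \<union> T"
  shows "is_weak_partial (S \<union> T) u b w"
proof -
  have O: "open (S \<union> T)" using assms by auto
  have "integral\<^sup>L lebesgue (\<lambda>x. frechet_derivative \<phi> (at x) b *\<^sub>R u x) =
     - integral\<^sup>L lebesgue (\<lambda>x. \<phi> x *\<^sub>R w x)" if \<phi>: "\<phi> \<in> test_functions (S \<union> T)" for \<phi>
  proof -
    obtain \<phi>1 \<phi>2 where p: "\<phi>1 \<in> test_functions S" "\<phi>2 \<in> test_functions T" "\<And>x. \<phi> x = \<phi>1 x + \<phi>2 x"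
      using test_function_partition[OF \<phi> assms(1,2)] by blast
    have d: "frechet_derivative \<phi> (at x) b = frechet_derivative \<phi>1 (at x) b + frechet_derivative \<phi>2 (at x) b" for x
    proof -
      have "(\<phi> has_derivative (\<lambda>v. frechet_derivative \<phi>1 (at x) v + frechet_derivative \<phi>2 (at x) v)) (at x)"
        unfolding p(3)[abs_def]
        by (intro has_derivative_add smooth_on_frechet_derivative[OF test_functionsD(1)[OF p(1)]]
          smooth_on_frechet_derivative[OF test_functionsD(1)[OF p(2)]] UNIV_I)
      from frechet_derivative_at[OF this] show ?thesis by metis
    qed
    note A = assms(3)[unfolded is_weak_partial_iff[OF assms(1)]] assms(4)[unfolded is_weak_partial_iff[OF assms(2)]]
    note int1 = test_function_integrable[OF p(1)] and int2 = test_function_integrable[OF p(2)]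
    have "integral\<^sup>L lebesgue (\<lambda>x. frechet_derivative \<phi> (at x) b *\<^sub>R u x) =
      integral\<^sup>L lebesgue (\<lambda>x. frechet_derivative \<phi>1 (at x) b *\<^sub>R u x) +
      integral\<^sup>L lebesgue (\<lambda>x. frechet_derivative \<phi>2 (at x) b *\<^sub>R u x)"
      unfolding d scaleR_add_left using A int1 int2 by (intro Bochner_Integration.integral_add) auto
    also have "\<dots> = - integral\<^sup>L lebesgue (\<lambda>x. \<phi>1 x *\<^sub>R w x) - integral\<^sup>L lebesgue (\<lambda>x. \<phi>2 x *\<^sub>R w x)"
      using A p by simp
    also have "\<dots> = - (integral\<^sup>L lebesgue (\<lambda>x. \<phi>1 x *\<^sub>R w x + \<phi>2 x *\<^sub>R w x))"
      using A int1 int2 by (subst Bochner_Integration.integral_add) auto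
    also have "(\<lambda>x. \<phi>1 x *\<^sub>R w x + \<phi>2 x *\<^sub>R w x) = (\<lambda>x. \<phi> x *\<^sub>R w x)"
      by (simp only: p(3) scaleR_add_left)
    finally show ?thesis .
  qed
  then show ?thesis using assms(5,6) by (simp add: is_weak_partial_iff[OF O])
qed

section \<open>The fundamental lemma of the calculus of variations\<close>

text \<open>Integrable functions whose integral over every box vanishes are zero, because the measures with
  densities \<open>w\<^sup>+\<close> and \<open>w\<^sup>-\<close> agree on a generator.\<close>

lemma AE_zero_if_box_integrals_zero:
  fixes v :: "'a::euclidean_space \<Rightarrow> real"
  assumes int: "integrable lebesgue v"
    and box: "\<And>l u. integral\<^sup>L lebesgue (\<lambda>x. indicator (box l u) x * v x) = 0"
  shows "AE x in lebesgue. v x = 0"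
proof -
  \<comment> \<open>The densities below are formed over \<open>lborel\<close>, hence the passage to
    a Borel representative.\<close>
  obtain v' where v'[measurable]: "v' \<in> borel_measurable lborel" and ae: "AE x in lborel. v x = v' x"
    using completion_ex_borel_measurable_real[OF borel_measurable_integrable[OF int]] by blast
  have ae': "AE x in lebesgue. v x = v' x" using ae by (rule AE_completion)
  have m': "v' \<in> borel_measurable lebesgue" using v' by (rule measurable_completion)
  have "integrable lebesgue v'"
    using integrable_cong_AE[OF borel_measurable_integrable[OF int] m' ae'] int by simp
  then have int': "integrable lborel v'" using integrable_completion[OF v'] by simp
  \<comment> \<open>\<open>ennreal\<close> sends negative numbers to 0, so the two densities are the
    positive and the negative part of v'.\<close>
  define M where "M = density lborel (\<lambda>x. ennreal (v' x))"
  define N where "N = density lborel (\<lambda>x. ennreal (- v' x))"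
  have eq: "emeasure M (box l u) = emeasure N (box l u)" and fin: "emeasure M (box l u) \<noteq> \<infinity>" for l u :: 'a
  proof -
    have i: "integrable lborel (\<lambda>x. indicator (box l u) x * v' x)"
      using integrable_mult_indicator[OF _ int', of "box l u"] by simp
    have z: "integral\<^sup>L lborel (\<lambda>x. indicator (box l u) x * v' x) = 0"
    proof -
      have "integral\<^sup>L lborel (\<lambda>x. indicator (box l u) x * v' x) = integral\<^sup>L lebesgue (\<lambda>x. indicator (box l u) x * v' x)"
        by (rule integral_completion[symmetric]) simp
      also have "\<dots> = integral\<^sup>L lebesgue (\<lambda>x. indicator (box l u) x * v x)"
      proof (rule integral_cong_AE)
        show "AE x in lebesgue. indicator (box l u) x * v' x = indicator (box l u) x * v x"
          using ae' by (rule AE_mp) simp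
        show "(\<lambda>x. indicator (box l u) x * v x) \<in> borel_measurable lebesgue"
          using borel_measurable_integrable[OF int] by (intro borel_measurable_times borel_measurable_indicator) auto
        show "(\<lambda>x. indicator (box l u) x * v' x) \<in> borel_measurable lebesgue"
          by (rule measurable_completion) simp
      qed
      finally show ?thesis using box by simp
    qed
    have eM: "emeasure M (box l u) = (\<integral>\<^sup>+x. ennreal (indicator (box l u) x * v' x) \<partial>lborel)"
      unfolding M_def by (subst emeasure_density) (auto intro!: nn_integral_cong simp: indicator_def)
    have eN: "emeasure N (box l u) = (\<integral>\<^sup>+x. ennreal (- (indicator (box l u) x * v' x)) \<partial>lborel)"
      unfolding N_def by (subst emeasure_density) (auto intro!: nn_integral_cong simp: indicator_def)
    have f: "(\<integral>\<^sup>+x. ennreal (indicator (box l u) x * v' x) \<partial>lborel) \<noteq> \<infinity>"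
      "(\<integral>\<^sup>+x. ennreal (- (indicator (box l u) x * v' x)) \<partial>lborel) \<noteq> \<infinity>"
      using i by (auto simp: real_integrable_def)
    then show "emeasure M (box l u) \<noteq> \<infinity>" by (simp add: eM)
    have "enn2real (emeasure M (box l u)) = enn2real (emeasure N (box l u))"
      using real_lebesgue_integral_def[OF i] z by (simp add: eM eN)
    then show "emeasure M (box l u) = emeasure N (box l u)"
      using f by (metis eM eN ennreal_enn2real infinity_ennreal_def less_top)
  qed
  have "M = N"
  proof (rule measure_eqI_generator_eq[where E="range (\<lambda>(a, b). box a b)" and \<Omega>=UNIV
        and A="\<lambda>n. box (- (real n *\<^sub>R One)) (real n *\<^sub>R One)"])
    show "Int_stable (range (\<lambda>(a, b). box a b :: 'a set))"
      by (auto simp: Int_stable_def box_Int_box)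
    show "sets M = sigma_sets UNIV (range (\<lambda>(a, b). box a b))" "sets N = sigma_sets UNIV (range (\<lambda>(a, b). box a b))"
      by (simp_all add: M_def N_def borel_eq_box)
    show "(\<Union>n. box (- (real n *\<^sub>R One)) (real n *\<^sub>R One)) = (UNIV :: 'a set)"
      by (rule UN_box_eq_UNIV)
  qed (use eq fin in auto)
  then have "AE x in lborel. ennreal (v' x) = ennreal (- v' x)"
    unfolding M_def N_def by (subst sigma_finite_measure.density_unique_iff[OF lborel.sigma_finite_measure_axioms, symmetric]) auto
  \<comment> \<open>A real number whose positive and negative parts coincide is 0.\<close>
  then have "AE x in lborel. v' x = 0"
    by (rule AE_mp) (auto intro!: AE_I2 simp: ennreal_eq_0_iff[symmetric],
        metis ennreal_neg ennreal_eq_0_iff le_cases neg_le_0_iff_le order_antisym)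
  with ae have "AE x in lborel. v x = 0" by eventually_elim simp
  then show ?thesis by (rule AE_completion)
qed

text \<open>Steep bumps converge to the indicator of a box, so the integrals over boxes inside
  \<open>S\<close> vanish; the box criterion then applies on each such box, and countably many of
  them cover \<open>S\<close>.\<close>

lemma fundamental_lemma_real:
  fixes w :: "complex \<Rightarrow> real"
  assumes S: "open S" and w: "w locally_integrable_on S"
    and 0: "\<And>\<phi>. \<phi> \<in> test_functions S \<Longrightarrow> integral\<^sup>L lebesgue (\<lambda>x. \<phi> x * w x) = 0"
  shows "AE x in lebesgue_on S. w x = 0"
proof -
  have box0: "integral\<^sup>L lebesgue (\<lambda>x. indicator (box a b) x * w x) = 0" if ab: "cbox a b \<subseteq> S" for a b
  proof -
    have int: "integrable lebesgue (\<lambda>x. indicator (cbox a b) x * w x)"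
      using locally_integrable_onD[OF w compact_cbox ab] by simp
    \<comment> \<open>Inserting the indicator of the closed box changes nothing and provides an
      integrable majorant.\<close>
    have bb: "box_bump a b (real n) x * w x = box_bump a b (real n) x * (indicator (cbox a b) x * w x)" for n x
      using box_bump_outside[of "real n" x a b] box_subset_cbox[of a b] by (auto simp: indicator_def)
    have bm: "box_bump a b (real n) \<in> borel_measurable lebesgue" for n
      using smooth_on_imp_continuous_on[OF box_bump_smooth]
      by (intro measurable_completion) (simp add: borel_measurable_continuous_onI)
    have "(\<lambda>n. integral\<^sup>L lebesgue (\<lambda>x. box_bump a b (real n) x * w x)) \<longlonglongrightarrow>
        integral\<^sup>L lebesgue (\<lambda>x. indicator (box a b) x * (indicator (cbox a b) x * w x))"
      unfolding bb
    proof (rule integral_dominated_convergence[where w="\<lambda>x. \<bar>indicator (cbox a b) x * w x\<bar>"])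
      show "integrable lebesgue (\<lambda>x. \<bar>indicator (cbox a b) x * w x\<bar>)" using int by (rule integrable_abs)
      show "(\<lambda>x. indicator (box a b) x * (indicator (cbox a b) x * w x)) \<in> borel_measurable lebesgue"
        by (rule borel_measurable_times[OF borel_measurable_indicator borel_measurable_integrable[OF int]]) simp
      show "(\<lambda>x. box_bump a b (real n) x * (indicator (cbox a b) x * w x)) \<in> borel_measurable lebesgue" for n
        by (intro borel_measurable_times bm borel_measurable_integrable[OF int])
      show "AE x in lebesgue. (\<lambda>n. box_bump a b (real n) x * (indicator (cbox a b) x * w x)) \<longlonglongrightarrow>
          indicator (box a b) x * (indicator (cbox a b) x * w x)"
        by (intro AE_I2 tendsto_mult box_bump_tendsto tendsto_const)
      show "AE x in lebesgue. norm (box_bump a b (real n) x * (indicator (cbox a b) x * w x)) \<le> \<bar>indicator (cbox a b) x * w x\<bar>" for n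
        by (intro AE_I2) (auto simp: abs_mult box_bump_bounds intro!: mult_left_le_one_le)
    qed
    moreover have "integral\<^sup>L lebesgue (\<lambda>x. box_bump a b (real n) x * w x) = 0" for n
      by (rule 0) (rule box_bump_test[OF ab], simp)
    moreover have "(\<lambda>x. indicator (box a b) x * (indicator (cbox a b) x * w x)) = (\<lambda>x. indicator (box a b) x * w x)"
      using box_subset_cbox[of a b] by (auto simp: fun_eq_iff indicator_def)
    ultimately show ?thesis by (simp add: LIMSEQ_const_iff)
  qed
  \<comment> \<open>As \<open>w\<close> is only locally integrable, the box criterion is applied to
    its restriction to a box; other boxes meet this one in boxes again.\<close>
  have AE_box: "AE x in lebesgue. x \<in> box c d \<longrightarrow> w x = 0" if cd: "cbox c d \<subseteq> S" for c d
  proof -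
    have "AE x in lebesgue. indicator (box c d) x * w x = 0"
    proof (rule AE_zero_if_box_integrals_zero)
      have "integrable lebesgue (\<lambda>x. indicator (box c d) x *\<^sub>R (indicator (cbox c d) x *\<^sub>R w x))"
        by (rule integrable_mult_indicator[OF _ locally_integrable_onD[OF w compact_cbox cd]]) simp
      moreover have "indicator (box c d) x *\<^sub>R (indicator (cbox c d) x *\<^sub>R w x) = indicator (box c d) x * w x" for x
        using box_subset_cbox[of c d] by (auto simp: indicator_def)
      ultimately show "integrable lebesgue (\<lambda>x. indicator (box c d) x * w x)" by (simp only:)
      fix l u :: complex
      obtain a b where ab: "box l u \<inter> box c d = box a b" using box_Int_box by blast
      have "(\<lambda>x. indicator (box l u) x * (indicator (box c d) x * w x)) = (\<lambda>x. indicator (box a b) x * w x)"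
        unfolding ab[symmetric] by (auto simp: fun_eq_iff indicator_def)
      moreover have "integral\<^sup>L lebesgue (\<lambda>x. indicator (box a b) x * w x) = 0"
      proof (cases "box a b = {}")
        case False
        then have "cbox a b = closure (box a b)" by (simp add: closure_box)
        also have "\<dots> \<subseteq> cbox c d"
          unfolding ab[symmetric] using box_subset_cbox[of c d] by (intro closure_minimal) auto
        finally show ?thesis using cd by (intro box0) auto
      qed simp
      ultimately show "integral\<^sup>L lebesgue (\<lambda>x. indicator (box l u) x * (indicator (box c d) x * w x)) = 0" by simp
    qed
    then show ?thesis by (rule AE_mp) (auto simp: indicator_def)
  qed
  \<comment> \<open>A countable subcover is needed to unite the exceptional null sets.\<close>
  let ?B = "{box c d | c d. cbox c d \<subseteq> S}"
  have "\<exists>c d. z \<in> box c d \<and> cbox c d \<subseteq> S" if "z \<in> S" for z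
    by (rule open_contains_cbox[OF S that]) blast
  then have cov: "S \<subseteq> \<Union>?B" by blast
  obtain F where F: "F \<subseteq> ?B" "countable F" "\<Union>F = \<Union>?B"
  proof (rule Lindelof)
    show "open B" if "B \<in> ?B" for B using that open_box by auto
  qed
  have "AE x in lebesgue. \<forall>B\<in>F. x \<in> B \<longrightarrow> w x = 0"
    using AE_box F(1) by (subst AE_ball_countable[OF F(2)]) blast
  then have "AE x in lebesgue. x \<in> S \<longrightarrow> w x = 0"
    by (rule AE_mp) (use cov F(3) in \<open>auto intro!: AE_I2\<close>)
  then show ?thesis using S by (simp add: AE_lebesgue_on_iff)
qed

lemma fundamental_lemma:
  fixes w :: "complex \<Rightarrow> 'b::euclidean_space"
  assumes S: "open S" and w: "w locally_integrable_on S"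
    and 0: "\<And>\<phi>. \<phi> \<in> test_functions S \<Longrightarrow> integral\<^sup>L lebesgue (\<lambda>x. \<phi> x *\<^sub>R w x) = 0"
  shows "AE x in lebesgue_on S. w x = 0"
proof -
  have "AE x in lebesgue_on S. w x \<bullet> b = 0" if "b \<in> Basis" for b
  proof (rule fundamental_lemma_real[OF S])
    show "(\<lambda>x. w x \<bullet> b) locally_integrable_on S"
      using w unfolding locally_integrable_on_def by auto
    fix \<phi> assume \<phi>: "\<phi> \<in> test_functions S"
    have "integral\<^sup>L lebesgue (\<lambda>x. (\<phi> x *\<^sub>R w x) \<bullet> b) = integral\<^sup>L lebesgue (\<lambda>x. \<phi> x *\<^sub>R w x) \<bullet> b"
      by (rule integral_inner_left) (rule test_function_integrable(1)[OF \<phi> w])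
    then show "integral\<^sup>L lebesgue (\<lambda>x. \<phi> x * (w x \<bullet> b)) = 0" using 0[OF \<phi>] by simp
  qed
  then have "AE x in lebesgue_on S. \<forall>b\<in>Basis. w x \<bullet> b = 0"
    by (subst AE_ball_countable) (auto intro: countable_finite)
  then show ?thesis by (rule AE_mp) (auto intro!: AE_I2 simp: euclidean_all_zero_iff)
qed

text \<open>The fundamental lemma applies to the difference of the two candidates. This is what
  makes the choice in \<open>weak_partial\<close> harmless.\<close>

lemma weak_partial_unique:
  fixes w :: "complex \<Rightarrow> 'b::euclidean_space"
  assumes S: "open S" and "is_weak_partial S u b w" "is_weak_partial S u b w'"
  shows "AE x in lebesgue_on S. w x = w' x"
proof -
  note A = assms(2,3)[unfolded is_weak_partial_iff[OF S]]
  have "AE x in lebesgue_on S. 1 *\<^sub>R w x + (-1) *\<^sub>R w' x = 0"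
  proof (rule fundamental_lemma[OF S])
    show "(\<lambda>x. 1 *\<^sub>R w x + (-1) *\<^sub>R w' x) locally_integrable_on S"
      using A by (intro locally_integrable_on_linear) auto
    fix \<phi> assume \<phi>: "\<phi> \<in> test_functions S"
    have "integral\<^sup>L lebesgue (\<lambda>x. \<phi> x *\<^sub>R (1 *\<^sub>R w x + (-1) *\<^sub>R w' x)) =
      integral\<^sup>L lebesgue (\<lambda>x. \<phi> x *\<^sub>R w x - \<phi> x *\<^sub>R w' x)"
      by (simp add: algebra_simps)
    also have "\<dots> = integral\<^sup>L lebesgue (\<lambda>x. \<phi> x *\<^sub>R w x) - integral\<^sup>L lebesgue (\<lambda>x. \<phi> x *\<^sub>R w' x)"
      using A test_function_integrable(1)[OF \<phi>] by (intro Bochner_Integration.integral_diff) auto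
    also have "\<dots> = 0" using A \<phi> by (metis eq_iff_diff_eq_0 neg_equal_iff_equal)
    finally show "integral\<^sup>L lebesgue (\<lambda>x. \<phi> x *\<^sub>R (1 *\<^sub>R w x + (-1) *\<^sub>R w' x)) = 0" .
  qed
  then show ?thesis by (rule AE_mp) auto
qed

section \<open>Difference quotients of Sobolev functions\<close>

lemma Ck_on_translate: "Ck_on k UNIV f \<Longrightarrow> Ck_on k UNIV (\<lambda>x. f (x - a))"
proof (induction k arbitrary: f)
  case 0
  then show ?case
    by (auto intro!: continuous_on_compose2[of UNIV f UNIV "\<lambda>x. x - a"] continuous_intros)
next
  case (Suc k)
  show ?case
  proof (rule Ck_on_SucI)
    show "((\<lambda>x. f (x - a)) has_derivative frechet_derivative f (at (x - a))) (at x)" for x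
    proof -
      have "((\<lambda>x. x - a) has_derivative (\<lambda>v. v)) (at x)" by (auto intro!: derivative_eq_intros)
      from has_derivative_compose[OF this Ck_on_derivative[OF Suc.prems UNIV_I]] show ?thesis .
    qed
    show "Ck_on k UNIV (\<lambda>x. frechet_derivative f (at (x - a)) v)" for v
      using Suc.IH[of "\<lambda>x. frechet_derivative f (at x) v"] Suc.prems by simp
  qed simp
qed

text \<open>Translates of test functions on \<open>U\<close> along a segment remain admissible on
  \<open>S\<close>, so the weak identity on \<open>S\<close> can be used at every time of the
  segment.\<close>

lemma test_function_translate:
  assumes "\<phi> \<in> test_functions U" "(\<lambda>x. x + a) ` U \<subseteq> S"
  shows "(\<lambda>x. \<phi> (x - a)) \<in> test_functions S"
    and "frechet_derivative (\<lambda>x. \<phi> (x - a)) (at x) = frechet_derivative \<phi> (at (x - a))"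
proof -
  let ?K = "closure {x. \<phi> x \<noteq> 0}"
  show "(\<lambda>x. \<phi> (x - a)) \<in> test_functions S"
  proof (rule test_functionsI[where K="(\<lambda>x. x + a) ` ?K"])
    show "smooth_on UNIV (\<lambda>x. \<phi> (x - a))"
      using test_functionsD(1)[OF assms(1)] unfolding smooth_on_def by (blast intro: Ck_on_translate)
    show "compact ((\<lambda>x. x + a) ` ?K)"
      using test_functionsD(2)[OF assms(1)] by (intro compact_continuous_image continuous_intros)
    show "(\<lambda>x. x + a) ` ?K \<subseteq> S" using test_functionsD(3)[OF assms(1)] assms(2) by blast
    fix x assume "x \<notin> (\<lambda>x. x + a) ` ?K"
    then have "x - a \<notin> ?K" by (metis diff_add_cancel imageI)
    then show "\<phi> (x - a) = 0" by (rule test_function_derivative_support(1)[OF assms(1)])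
  qed
  have "((\<lambda>x. x - a) has_derivative (\<lambda>v. v)) (at x)" by (auto intro!: derivative_eq_intros)
  from has_derivative_compose[OF this smooth_on_frechet_derivative[OF test_functionsD(1)[OF assms(1)] UNIV_I]]
  show "frechet_derivative (\<lambda>x. \<phi> (x - a)) (at x) = frechet_derivative \<phi> (at (x - a))"
    by (metis frechet_derivative_at)
qed

lemma nn_integral_translate:
  fixes f :: "'a::euclidean_space \<Rightarrow> ennreal"
  assumes [measurable]: "f \<in> borel_measurable borel"
  shows "(\<integral>\<^sup>+x. f (x + a) \<partial>lborel) = (\<integral>\<^sup>+x. f x \<partial>lborel)"
proof -
  have "(\<integral>\<^sup>+x. f x \<partial>lborel) = (\<integral>\<^sup>+x. f x \<partial>distr lborel borel ((+) a))" by (simp add: lborel_distr_plus)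
  also have "\<dots> = (\<integral>\<^sup>+x. f (x + a) \<partial>lborel)" by (subst nn_integral_distr) (auto simp: add.commute)
  finally show ?thesis by simp
qed

lemma integrable_translate:
  fixes f :: "'a::euclidean_space \<Rightarrow> 'b::euclidean_space"
  assumes "integrable lborel f"
  shows "integrable lborel (\<lambda>x. f (x + a))"
proof -
  have "integrable (distr lborel borel ((+) a)) f" using assms by (simp add: lborel_distr_plus)
  then show ?thesis using assms by (subst (asm) integrable_distr_eq) (auto simp: add.commute)
qed

lemma integral_translate:
  fixes f :: "'a::euclidean_space \<Rightarrow> 'b::euclidean_space"
  assumes [measurable]: "f \<in> borel_measurable borel"
  shows "(\<integral>x. f (x + a) \<partial>lborel) = (\<integral>x. f x \<partial>lborel)"
proof -
  have "(\<integral>x. f x \<partial>lborel) = (\<integral>x. f x \<partial>distr lborel borel ((+) a))" by (simp add: lborel_distr_plus)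
  also have "\<dots> = (\<integral>x. f (x + a) \<partial>lborel)" by (subst integral_distr) (auto simp: add.commute)
  finally show ?thesis by simp
qed

text \<open>Tonelli with \<open>x\<close> innermost: translation invariance removes the shift and
  leaves the length of the interval times the L^1 norm of \<open>W\<close>. It justifies Fubini for
  integrals along segments.\<close>

lemma integrable_sheared:
  fixes W :: "complex \<Rightarrow> 'b::euclidean_space" and v :: complex
  assumes "integrable lborel W"
  shows "integrable (lborel \<Otimes>\<^sub>M lborel) (\<lambda>(t, x). indicator {r..s} t *\<^sub>R W (x + t *\<^sub>R v))"
proof (rule integrableI_bounded)
  have [measurable]: "W \<in> borel_measurable borel" using assms by simp
  show "(\<lambda>(t, x). indicator {r..s} t *\<^sub>R W (x + t *\<^sub>R v)) \<in> borel_measurable (lborel \<Otimes>\<^sub>M lborel)"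
    by measurable
  have "(\<integral>\<^sup>+z. ennreal (norm (case z of (t, x) \<Rightarrow> indicator {r..s} t *\<^sub>R W (x + t *\<^sub>R v))) \<partial>(lborel \<Otimes>\<^sub>M lborel)) =
    (\<integral>\<^sup>+t. \<integral>\<^sup>+x. indicator {r..s} t * ennreal (norm (W (x + t *\<^sub>R v))) \<partial>lborel \<partial>lborel)"
    by (subst lborel.nn_integral_fst[symmetric], measurable)
      (auto intro!: nn_integral_cong simp: indicator_def)
  also have "\<dots> = (\<integral>\<^sup>+t. indicator {r..s} t * (\<integral>\<^sup>+x. ennreal (norm (W x)) \<partial>lborel) \<partial>lborel)"
  proof (rule nn_integral_cong)
    fix t :: real
    have "(\<integral>\<^sup>+x. ennreal (norm (W (x + t *\<^sub>R v))) \<partial>lborel) = (\<integral>\<^sup>+x. ennreal (norm (W x)) \<partial>lborel)"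
      by (rule nn_integral_translate[of "\<lambda>x. ennreal (norm (W x))"]) measurable
    then show "(\<integral>\<^sup>+x. indicator {r..s} t * ennreal (norm (W (x + t *\<^sub>R v))) \<partial>lborel) =
        indicator {r..s} t * (\<integral>\<^sup>+x. ennreal (norm (W x)) \<partial>lborel)"
      by (subst nn_integral_cmult) auto
  qed
  also have "\<dots> = emeasure lborel {r..s} * (\<integral>\<^sup>+x. ennreal (norm (W x)) \<partial>lborel)"
    by (simp add: nn_integral_multc)
  also have "\<dots> < \<infinity>"
    using assms by (auto simp: integrable_iff_bounded ennreal_mult_less_top emeasure_lborel_Icc_eq)
  finally show "(\<integral>\<^sup>+z. ennreal (norm (case z of (t, x) \<Rightarrow> indicator {r..s} t *\<^sub>R W (x + t *\<^sub>R v))) \<partial>(lborel \<Otimes>\<^sub>M lborel)) < \<infinity>" .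
qed

lemma test_function_bounded:
  assumes "\<phi> \<in> test_functions S"
  obtains B where "\<And>x. \<bar>\<phi> x\<bar> \<le> B" "\<And>x. \<bar>frechet_derivative \<phi> (at x) v\<bar> \<le> B"
proof -
  let ?K = "closure {x. \<phi> x \<noteq> 0}"
  have *: "\<exists>B\<ge>0. \<forall>x. \<bar>\<psi> x\<bar> \<le> B" if "continuous_on UNIV \<psi>" "\<And>x. x \<notin> ?K \<Longrightarrow> \<psi> x = 0" for \<psi> :: "'a \<Rightarrow> real"
  proof -
    have "bounded (\<psi> ` ?K)"
      using test_functionsD(2)[OF assms] that(1)
      by (metis compact_continuous_image compact_imp_bounded continuous_on_subset subset_UNIV)
    then obtain B where B: "\<And>x. x \<in> ?K \<Longrightarrow> \<bar>\<psi> x\<bar> \<le> B"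
      unfolding bounded_iff by (metis image_eqI real_norm_def)
    then have "\<bar>\<psi> x\<bar> \<le> max B 0" for x using that(2)[of x] by (cases "x \<in> ?K") (auto simp: le_max_iff_disj)
    then show ?thesis by (intro exI[of _ "max B 0"]) auto
  qed
  obtain B1 where B1: "B1 \<ge> 0" "\<And>x. \<bar>\<phi> x\<bar> \<le> B1"
    using *[OF test_function_continuous(1)[OF assms] test_function_derivative_support(1)[OF assms]] by blast
  obtain B2 where B2: "B2 \<ge> 0" "\<And>x. \<bar>frechet_derivative \<phi> (at x) v\<bar> \<le> B2"
    using *[OF test_function_continuous(2)[OF assms] test_function_derivative_support(2)[OF assms], of v] by blast
  show ?thesis by (rule that[of "B1 + B2"]) (use B1 B2 in \<open>auto intro: order_trans add_increasing add_increasing2\<close>)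
qed

text \<open>Fubini turns the weak identity for all translates of a test function along the segment into the
  weak form of the fundamental theorem of calculus.\<close>

lemma weak_difference_identity:
  fixes u W :: "complex \<Rightarrow> 'b::euclidean_space" and v :: complex
  assumes rs: "r \<le> s" and \<phi>: "\<phi> \<in> test_functions U"
    and u: "integrable lborel u" and W: "integrable lborel W"
    and weak: "\<And>t. t \<in> {r..s} \<Longrightarrow> (\<integral>x. frechet_derivative \<phi> (at (x - t *\<^sub>R v)) v *\<^sub>R u x \<partial>lborel) =
      - (\<integral>x. \<phi> (x - t *\<^sub>R v) *\<^sub>R W x \<partial>lborel)"
  shows "(\<integral>x. \<phi> x *\<^sub>R (u (x + s *\<^sub>R v) - u (x + r *\<^sub>R v)) \<partial>lborel) =
    (\<integral>x. \<phi> x *\<^sub>R (\<integral>t. indicator {r..s} t *\<^sub>R W (x + t *\<^sub>R v) \<partial>lborel) \<partial>lborel)"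
proof -
  define D where "D x = frechet_derivative \<phi> (at x) v" for x
  obtain B where B: "\<And>x. \<bar>\<phi> x\<bar> \<le> B" "\<And>x. \<bar>D x\<bar> \<le> B"
    unfolding D_def using test_function_bounded[OF \<phi>, of v] by blast
  have B': "\<bar>D x\<bar> \<le> \<bar>B\<bar>" "\<bar>\<phi> x\<bar> \<le> \<bar>B\<bar>" for x using B(1,2)[of x] by linarith+
  have cont: "continuous_on UNIV \<phi>" "continuous_on UNIV D"
    unfolding D_def by (rule test_function_continuous[OF \<phi>])+
  have [measurable]: "\<phi> \<in> borel_measurable borel" "D \<in> borel_measurable borel"
    "u \<in> borel_measurable borel" "W \<in> borel_measurable borel"
    using cont u W by (auto intro: borel_measurable_continuous_onI)
  have int_ru: "integrable lborel (\<lambda>x. \<psi> x *\<^sub>R f x)" if "integrable lborel f" "\<psi> \<in> borel_measurable borel" "\<And>x. \<bar>\<psi> x\<bar> \<le> B"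
    for f :: "complex \<Rightarrow> 'b" and \<psi> :: "complex \<Rightarrow> real"
  proof (rule Bochner_Integration.integrable_bound)
    show "integrable lborel (\<lambda>x. B *\<^sub>R f x)" using that(1) by simp
    show "(\<lambda>x. \<psi> x *\<^sub>R f x) \<in> borel_measurable lborel" using that(1,2) by measurable
    show "AE x in lborel. norm (\<psi> x *\<^sub>R f x) \<le> norm (B *\<^sub>R f x)"
      using that(3) by (intro AE_I2) (auto intro!: mult_right_mono intro: order_trans[OF _ abs_ge_self])
  qed
  \<comment> \<open>The classical fundamental theorem is applied along the segment to the smooth
    function \<open>\<phi>\<close>, not to \<open>u\<close>.\<close>
  have ftc: "(\<integral>t. indicator {r..s} t *\<^sub>R D (x - t *\<^sub>R v) \<partial>lborel) = \<phi> (x - r *\<^sub>R v) - \<phi> (x - s *\<^sub>R v)" for x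
  proof -
    have "(\<integral>t. indicator {r..s} t *\<^sub>R D (x - t *\<^sub>R v) \<partial>lborel) = (- \<phi> (x - s *\<^sub>R v)) - (- \<phi> (x - r *\<^sub>R v))"
    proof (rule integral_FTC_Icc[OF rs])
      fix t
      have 1: "((\<lambda>t. x - t *\<^sub>R v) has_derivative (\<lambda>h. - (h *\<^sub>R v))) (at t within {r..s})"
        by (auto intro!: derivative_eq_intros)
      have 2: "(\<phi> has_derivative frechet_derivative \<phi> (at (x - t *\<^sub>R v))) (at (x - t *\<^sub>R v))"
        by (rule smooth_on_frechet_derivative[OF test_functionsD(1)[OF \<phi>] UNIV_I])
      have l: "frechet_derivative \<phi> (at (x - t *\<^sub>R v)) (- (h *\<^sub>R v)) = - (h * D (x - t *\<^sub>R v))" for h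
        using linear_cmul[OF has_derivative_linear[OF 2], of "-h" v] by (simp add: D_def)
      have "((\<lambda>t. \<phi> (x - t *\<^sub>R v)) has_derivative (\<lambda>h. - (h * D (x - t *\<^sub>R v)))) (at t within {r..s})"
        using has_derivative_compose[OF 1 2] by (simp only: l)
      from has_derivative_minus[OF this]
      show "((\<lambda>t. - \<phi> (x - t *\<^sub>R v)) has_vector_derivative D (x - t *\<^sub>R v)) (at t within {r..s})"
        by (simp add: has_vector_derivative_def)
    next
      show "continuous_on {r..s} (\<lambda>t. D (x - t *\<^sub>R v))"
        by (rule continuous_on_compose2[OF cont(2)]) (auto intro!: continuous_intros)
    qed
    then show ?thesis by simp
  qed
  have F1: "integrable (lborel \<Otimes>\<^sub>M lborel) (\<lambda>(t, x). (indicator {r..s} t * D (x - t *\<^sub>R v)) *\<^sub>R u x)"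
    and F2: "integrable (lborel \<Otimes>\<^sub>M lborel) (\<lambda>(t, x). \<phi> x *\<^sub>R indicator {r..s} t *\<^sub>R W (x + t *\<^sub>R v))"
  proof -
    \<comment> \<open>The case without shear is obtained with direction 0.\<close>
    have "integrable (lborel \<Otimes>\<^sub>M lborel) (\<lambda>(t, x). indicator {r..s} t *\<^sub>R u (x + t *\<^sub>R 0))"
      by (rule integrable_sheared[OF u])
    then have i: "integrable (lborel \<Otimes>\<^sub>M lborel) (\<lambda>(t, x). indicator {r..s} t *\<^sub>R u x)" by simp
    show "integrable (lborel \<Otimes>\<^sub>M lborel) (\<lambda>(t, x). (indicator {r..s} t * D (x - t *\<^sub>R v)) *\<^sub>R u x)"
      by (rule Bochner_Integration.integrable_bound[OF integrable_scaleR_right[OF i, of B]])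
        (measurable, use B' in \<open>auto intro!: AE_I2 mult_right_mono simp: indicator_def\<close>)
    show "integrable (lborel \<Otimes>\<^sub>M lborel) (\<lambda>(t, x). \<phi> x *\<^sub>R indicator {r..s} t *\<^sub>R W (x + t *\<^sub>R v))"
      by (rule Bochner_Integration.integrable_bound[OF integrable_scaleR_right[OF integrable_sheared[OF W, of r s v], of B]])
        (measurable, use B' in \<open>auto intro!: AE_I2 mult_right_mono simp: indicator_def\<close>)
  qed
  \<comment> \<open>A change of variables moves the increment from \<open>u\<close> to
    \<open>\<phi>\<close>, where \<open>ftc\<close> is available.\<close>
  have tr: "(\<integral>x. \<phi> x *\<^sub>R u (x + t *\<^sub>R v) \<partial>lborel) = (\<integral>x. \<phi> (x - t *\<^sub>R v) *\<^sub>R u x \<partial>lborel)" for t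
    using integral_translate[of "\<lambda>x. \<phi> (x - t *\<^sub>R v) *\<^sub>R u x" "t *\<^sub>R v"] by simp
  have "(\<integral>x. \<phi> x *\<^sub>R (u (x + s *\<^sub>R v) - u (x + r *\<^sub>R v)) \<partial>lborel) =
      (\<integral>x. \<phi> x *\<^sub>R u (x + s *\<^sub>R v) \<partial>lborel) - (\<integral>x. \<phi> x *\<^sub>R u (x + r *\<^sub>R v) \<partial>lborel)"
    unfolding scaleR_diff_right
    by (intro Bochner_Integration.integral_diff int_ru integrable_translate u B) measurable
  also have "\<dots> = - (\<integral>x. (\<phi> (x - r *\<^sub>R v) - \<phi> (x - s *\<^sub>R v)) *\<^sub>R u x \<partial>lborel)"
    unfolding tr scaleR_diff_left
    by (subst Bochner_Integration.integral_diff) (auto intro!: int_ru u B)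
  also have "(\<integral>x. (\<phi> (x - r *\<^sub>R v) - \<phi> (x - s *\<^sub>R v)) *\<^sub>R u x \<partial>lborel) =
      (\<integral>x. (\<integral>t. (indicator {r..s} t * D (x - t *\<^sub>R v)) *\<^sub>R u x \<partial>lborel) \<partial>lborel)"
  proof (rule Bochner_Integration.integral_cong[OF refl])
    fix x
    have "continuous_on {r..s} (\<lambda>t. D (x - t *\<^sub>R v))"
      by (rule continuous_on_compose2[OF cont(2)]) (auto intro!: continuous_intros)
    then have "integrable lborel (\<lambda>t. indicator {r..s} t *\<^sub>R D (x - t *\<^sub>R v))"
      by (intro borel_integrable_compact) auto
    then have "(\<integral>t. (indicator {r..s} t *\<^sub>R D (x - t *\<^sub>R v)) *\<^sub>R u x \<partial>lborel) = (\<phi> (x - r *\<^sub>R v) - \<phi> (x - s *\<^sub>R v)) *\<^sub>R u x"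
      by (subst integral_scaleR_left) (simp_all add: ftc[unfolded real_scaleR_def])
    then show "(\<phi> (x - r *\<^sub>R v) - \<phi> (x - s *\<^sub>R v)) *\<^sub>R u x = (\<integral>t. (indicator {r..s} t * D (x - t *\<^sub>R v)) *\<^sub>R u x \<partial>lborel)"
      by simp
  qed
  also have "\<dots> = (\<integral>t. (\<integral>x. (indicator {r..s} t * D (x - t *\<^sub>R v)) *\<^sub>R u x \<partial>lborel) \<partial>lborel)"
    by (rule lborel_pair.Fubini_integral[OF F1])
  also have "\<dots> = (\<integral>t. - (\<integral>x. \<phi> x *\<^sub>R indicator {r..s} t *\<^sub>R W (x + t *\<^sub>R v) \<partial>lborel) \<partial>lborel)"
  proof (rule Bochner_Integration.integral_cong[OF refl])
    fix t :: real
    show "(\<integral>x. (indicator {r..s} t * D (x - t *\<^sub>R v)) *\<^sub>R u x \<partial>lborel) =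
      - (\<integral>x. \<phi> x *\<^sub>R indicator {r..s} t *\<^sub>R W (x + t *\<^sub>R v) \<partial>lborel)"
    proof (cases "t \<in> {r..s}")
      case True
      have "(\<integral>x. \<phi> x *\<^sub>R W (x + t *\<^sub>R v) \<partial>lborel) = (\<integral>x. \<phi> (x - t *\<^sub>R v) *\<^sub>R W x \<partial>lborel)"
        using integral_translate[of "\<lambda>x. \<phi> (x - t *\<^sub>R v) *\<^sub>R W x" "t *\<^sub>R v"] by simp
      then show ?thesis using weak[OF True] True by (simp add: D_def)
    qed simp
  qed
  also have "\<dots> = - (\<integral>t. (\<integral>x. \<phi> x *\<^sub>R indicator {r..s} t *\<^sub>R W (x + t *\<^sub>R v) \<partial>lborel) \<partial>lborel)"
    by simp
  also have "(\<integral>t. (\<integral>x. \<phi> x *\<^sub>R indicator {r..s} t *\<^sub>R W (x + t *\<^sub>R v) \<partial>lborel) \<partial>lborel) =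
      (\<integral>x. (\<integral>t. \<phi> x *\<^sub>R indicator {r..s} t *\<^sub>R W (x + t *\<^sub>R v) \<partial>lborel) \<partial>lborel)"
    by (rule lborel_pair.Fubini_integral[OF F2, symmetric])
  finally show ?thesis by (simp del: scaleR_scaleR)
qed

lemma is_weak_partial_direction:
  assumes S: "open S" and "is_weak_partial S u 1 w1" "is_weak_partial S u \<i> w2" and \<phi>: "\<phi> \<in> test_functions S"
  shows "(\<integral>x. frechet_derivative \<phi> (at x) v *\<^sub>R u x \<partial>lebesgue) =
    - (\<integral>x. \<phi> x *\<^sub>R (Re v *\<^sub>R w1 x + Im v *\<^sub>R w2 x) \<partial>lebesgue)"
proof -
  note A = assms(2,3)[unfolded is_weak_partial_iff[OF S]] and int = test_function_integrable[OF \<phi>]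
  have d: "frechet_derivative \<phi> (at x) v = Re v * frechet_derivative \<phi> (at x) 1 + Im v * frechet_derivative \<phi> (at x) \<i>" for x
  proof -
    have l: "linear (frechet_derivative \<phi> (at x))"
      by (rule has_derivative_linear[OF smooth_on_frechet_derivative[OF test_functionsD(1)[OF \<phi>] UNIV_I]])
    have "v = Re v *\<^sub>R 1 + Im v *\<^sub>R \<i>" by (simp add: complex_eq_iff)
    then have "frechet_derivative \<phi> (at x) v = frechet_derivative \<phi> (at x) (Re v *\<^sub>R 1 + Im v *\<^sub>R \<i>)"
      by (rule arg_cong)
    then show ?thesis by (simp only: linear_add[OF l] linear_cmul[OF l] real_scaleR_def)
  qed
  have "(\<integral>x. frechet_derivative \<phi> (at x) v *\<^sub>R u x \<partial>lebesgue) =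
    (\<integral>x. Re v *\<^sub>R (frechet_derivative \<phi> (at x) 1 *\<^sub>R u x) + Im v *\<^sub>R (frechet_derivative \<phi> (at x) \<i> *\<^sub>R u x) \<partial>lebesgue)"
    by (simp add: d scaleR_add_left)
  also have "\<dots> = Re v *\<^sub>R (\<integral>x. frechet_derivative \<phi> (at x) 1 *\<^sub>R u x \<partial>lebesgue) +
      Im v *\<^sub>R (\<integral>x. frechet_derivative \<phi> (at x) \<i> *\<^sub>R u x \<partial>lebesgue)"
    using A by (subst Bochner_Integration.integral_add) (auto simp del: scaleR_scaleR intro!: integrable_scaleR_right int)
  also have "\<dots> = - (Re v *\<^sub>R (\<integral>x. \<phi> x *\<^sub>R w1 x \<partial>lebesgue) + Im v *\<^sub>R (\<integral>x. \<phi> x *\<^sub>R w2 x \<partial>lebesgue))"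
    using A \<phi> by simp
  also have "Re v *\<^sub>R (\<integral>x. \<phi> x *\<^sub>R w1 x \<partial>lebesgue) + Im v *\<^sub>R (\<integral>x. \<phi> x *\<^sub>R w2 x \<partial>lebesgue) =
      (\<integral>x. Re v *\<^sub>R (\<phi> x *\<^sub>R w1 x) + Im v *\<^sub>R (\<phi> x *\<^sub>R w2 x) \<partial>lebesgue)"
    using A by (subst Bochner_Integration.integral_add) (auto simp del: scaleR_scaleR intro!: integrable_scaleR_right int)
  finally show ?thesis by (simp add: algebra_simps)
qed

text \<open>Testing with all \<open>\<phi>\<close> on \<open>U\<close> identifies the increment of
  \<open>u\<close> with the integral of its directional derivative for almost every starting point.
  The result is therefore an estimate in the mean over \<open>U\<close>; no single segment is
  controlled.\<close>

lemma difference_bound: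
  fixes u w1 w2 :: "complex \<Rightarrow> 'b::euclidean_space" and v :: complex
  assumes S: "open S" and wp: "is_weak_partial S u 1 w1" "is_weak_partial S u \<i> w2"
    and [measurable]: "w1 \<in> borel_measurable borel" "w2 \<in> borel_measurable borel"
    and u: "continuous_on S u" and U: "open U" and K: "compact K" "K \<subseteq> S" and rs: "r \<le> s"
    and in_K: "\<And>x t. x \<in> U \<Longrightarrow> t \<in> {r..s} \<Longrightarrow> x + t *\<^sub>R v \<in> K"
  shows "(\<integral>\<^sup>+x\<in>U. ennreal (norm (u (x + s *\<^sub>R v) - u (x + r *\<^sub>R v))) \<partial>lborel) \<le>
    (\<integral>\<^sup>+x\<in>U. (\<integral>\<^sup>+t\<in>{r..s}. ennreal (norm v * (norm (w1 (x + t *\<^sub>R v)) + norm (w2 (x + t *\<^sub>R v)))) \<partial>lborel) \<partial>lborel)"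
proof -
  \<comment> \<open>Cutting off by the compact set \<open>K\<close> makes \<open>u\<close> and its
    derivative integrable on the plane; segments starting in \<open>U\<close> stay in
    \<open>K\<close> and are not affected.\<close>
  define u0 where "u0 x = indicator K x *\<^sub>R u x" for x
  define W where "W x = Re v *\<^sub>R w1 x + Im v *\<^sub>R w2 x" for x
  define W0 where "W0 x = indicator K x *\<^sub>R W x" for x
  define T where "T x = (\<integral>t. indicator {r..s} t *\<^sub>R W0 (x + t *\<^sub>R v) \<partial>lborel)" for x
  note A = wp[unfolded is_weak_partial_iff[OF S]]
  have Kb[measurable]: "K \<in> sets borel" using K(1) by (simp add: borel_compact)
  have Ub[measurable]: "U \<in> sets borel" using U by simp
  have u0b[measurable]: "u0 \<in> borel_measurable borel"
    unfolding u0_def using Kb continuous_on_subset[OF u K(2)] by (rule borel_measurable_continuous_on_indicator)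
  have W0b[measurable]: "W0 \<in> borel_measurable borel" unfolding W0_def W_def by measurable
  have "integrable lebesgue u0"
    unfolding u0_def using A K by (intro locally_integrable_onD) auto
  then have u0i: "integrable lborel u0" using integrable_completion[of u0 lborel] u0b by simp
  have "integrable lebesgue W0"
    unfolding W0_def W_def using A K by (intro locally_integrable_onD[of _ S] locally_integrable_on_linear) auto
  then have W0i: "integrable lborel W0" using integrable_completion[of W0 lborel] W0b by simp
  have Ti: "integrable lborel T"
    unfolding T_def by (rule lborel_pair.integrable_snd[OF integrable_sheared[OF W0i]])
  have weak: "(\<integral>x. \<phi> x *\<^sub>R (u0 (x + s *\<^sub>R v) - u0 (x + r *\<^sub>R v)) \<partial>lborel) = (\<integral>x. \<phi> x *\<^sub>R T x \<partial>lborel)"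
    if \<phi>: "\<phi> \<in> test_functions U" for \<phi>
    unfolding T_def
  proof (rule weak_difference_identity[OF rs \<phi> u0i W0i])
    fix t assume t: "t \<in> {r..s}"
    define \<phi>' where "\<phi>' x = \<phi> (x - t *\<^sub>R v)" for x
    have im: "(\<lambda>x. x + t *\<^sub>R v) ` U \<subseteq> S" using in_K[OF _ t] K(2) by auto
    have \<phi>': "\<phi>' \<in> test_functions S"
      "frechet_derivative \<phi>' (at x) = frechet_derivative \<phi> (at (x - t *\<^sub>R v))" for x
      unfolding \<phi>'_def by (rule test_function_translate[OF \<phi> im])+
    \<comment> \<open>The translated test function is supported in \<open>K\<close>, so the cut-offs
      can be inserted and removed under the integral.\<close>
    have out: "\<phi> (x - t *\<^sub>R v) = 0" "frechet_derivative \<phi> (at (x - t *\<^sub>R v)) v = 0" if "x \<notin> K" for x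
    proof -
      have "x - t *\<^sub>R v \<notin> closure {x. \<phi> x \<noteq> 0}"
        using that in_K[of "x - t *\<^sub>R v" t] t test_functionsD(3)[OF \<phi>] by auto
      then show "\<phi> (x - t *\<^sub>R v) = 0" "frechet_derivative \<phi> (at (x - t *\<^sub>R v)) v = 0"
        by (rule test_function_derivative_support[OF \<phi>])+
    qed
    have [measurable]: "\<phi> \<in> borel_measurable borel" "(\<lambda>x. frechet_derivative \<phi> (at x) v) \<in> borel_measurable borel"
      using test_function_continuous[OF \<phi>] by (auto intro: borel_measurable_continuous_onI)
    have m2: "(\<lambda>x. frechet_derivative \<phi> (at (x - t *\<^sub>R v)) v) \<in> borel_measurable borel"
      using measurable_compose[of "\<lambda>x. x - t *\<^sub>R v" borel borel "\<lambda>x. frechet_derivative \<phi> (at x) v"] by simp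
    have "(\<integral>x. frechet_derivative \<phi> (at (x - t *\<^sub>R v)) v *\<^sub>R u0 x \<partial>lborel) =
       (\<integral>x. frechet_derivative \<phi> (at (x - t *\<^sub>R v)) v *\<^sub>R u0 x \<partial>lebesgue)"
      using m2 by (intro integral_completion[symmetric]) simp
    also have "\<dots> = (\<integral>x. frechet_derivative \<phi>' (at x) v *\<^sub>R u x \<partial>lebesgue)"
      unfolding \<phi>'(2) u0_def using out(2) by (intro Bochner_Integration.integral_cong refl) (metis indicator_simps(1) indicator_simps(2) scaleR_one scaleR_zero_left scaleR_zero_right)
    also have "\<dots> = - (\<integral>x. \<phi>' x *\<^sub>R W x \<partial>lebesgue)"
      unfolding W_def by (rule is_weak_partial_direction[OF S wp \<phi>'(1)])
    also have "(\<integral>x. \<phi>' x *\<^sub>R W x \<partial>lebesgue) = (\<integral>x. \<phi> (x - t *\<^sub>R v) *\<^sub>R W0 x \<partial>lebesgue)"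
      unfolding \<phi>'_def W0_def using out(1) by (intro Bochner_Integration.integral_cong refl) (metis indicator_simps(1) indicator_simps(2) scaleR_one scaleR_zero_left scaleR_zero_right)
    also have "\<dots> = (\<integral>x. \<phi> (x - t *\<^sub>R v) *\<^sub>R W0 x \<partial>lborel)"
      by (intro integral_completion) simp
    finally show "(\<integral>x. frechet_derivative \<phi> (at (x - t *\<^sub>R v)) v *\<^sub>R u0 x \<partial>lborel) =
      - (\<integral>x. \<phi> (x - t *\<^sub>R v) *\<^sub>R W0 x \<partial>lborel)" .
  qed
  define H where "H x = u0 (x + s *\<^sub>R v) - u0 (x + r *\<^sub>R v) - T x" for x
  have Hi: "integrable lborel H"
    unfolding H_def by (intro Bochner_Integration.integrable_diff integrable_translate u0i Ti)
  have Hb[measurable]: "H \<in> borel_measurable borel" "T \<in> borel_measurable borel" using Hi Ti by auto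
  have "AE x in lebesgue_on U. H x = 0"
  proof (rule fundamental_lemma[OF U])
    show "H locally_integrable_on U"
    proof (rule locally_integrable_onI)
      fix L :: "complex set" assume "compact L"
      then have "L \<in> sets lebesgue" by (auto dest: borel_compact)
      moreover have "integrable lebesgue H" using Hi integrable_completion[of H lborel] by simp
      ultimately show "integrable lebesgue (\<lambda>x. indicator L x *\<^sub>R H x)" by (rule integrable_mult_indicator)
    qed
    fix \<phi> assume \<phi>: "\<phi> \<in> test_functions U"
    obtain B where B: "\<And>x. \<bar>\<phi> x\<bar> \<le> B" using test_function_bounded[OF \<phi>] by blast
    have \<phi>m[measurable]: "\<phi> \<in> borel_measurable borel"
      using test_function_continuous[OF \<phi>] by (auto intro: borel_measurable_continuous_onI)
    have int: "integrable lborel (\<lambda>x. \<phi> x *\<^sub>R f x)" if f: "integrable lborel f" for f :: "complex \<Rightarrow> 'b"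
    proof (rule Bochner_Integration.integrable_bound)
      show "integrable lborel (\<lambda>x. B *\<^sub>R f x)" using f by simp
      show "(\<lambda>x. \<phi> x *\<^sub>R f x) \<in> borel_measurable lborel" using f by measurable
      show "AE x in lborel. norm (\<phi> x *\<^sub>R f x) \<le> norm (B *\<^sub>R f x)"
        using B by (intro AE_I2) (auto intro!: mult_right_mono intro: order_trans[OF _ abs_ge_self])
    qed
    have "(\<integral>x. \<phi> x *\<^sub>R H x \<partial>lebesgue) = (\<integral>x. \<phi> x *\<^sub>R H x \<partial>lborel)" by (intro integral_completion) simp
    also have "\<dots> = (\<integral>x. \<phi> x *\<^sub>R (u0 (x + s *\<^sub>R v) - u0 (x + r *\<^sub>R v)) \<partial>lborel) - (\<integral>x. \<phi> x *\<^sub>R T x \<partial>lborel)"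
      unfolding H_def scaleR_diff_right[of _ _ "T _"]
      by (intro Bochner_Integration.integral_diff int Bochner_Integration.integrable_diff integrable_translate u0i Ti)
    finally show "(\<integral>x. \<phi> x *\<^sub>R H x \<partial>lebesgue) = 0" using weak[OF \<phi>] by simp
  qed
  then have ae: "AE x in lborel. x \<in> U \<longrightarrow> H x = 0"
    using U by (simp add: AE_lebesgue_on_iff AE_completion_iff)
  have "(\<integral>\<^sup>+x\<in>U. ennreal (norm (u (x + s *\<^sub>R v) - u (x + r *\<^sub>R v))) \<partial>lborel) = (\<integral>\<^sup>+x\<in>U. ennreal (norm (T x)) \<partial>lborel)"
  proof (rule nn_integral_cong_AE)
    show "AE x in lborel. ennreal (norm (u (x + s *\<^sub>R v) - u (x + r *\<^sub>R v))) * indicator U x = ennreal (norm (T x)) * indicator U x"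
      using ae
    proof (rule AE_mp, intro AE_I2 impI)
      fix x assume H: "x \<in> U \<longrightarrow> H x = 0"
      show "ennreal (norm (u (x + s *\<^sub>R v) - u (x + r *\<^sub>R v))) * indicator U x = ennreal (norm (T x)) * indicator U x"
      proof (cases "x \<in> U")
        case True
        then have "u0 (x + s *\<^sub>R v) = u (x + s *\<^sub>R v)" "u0 (x + r *\<^sub>R v) = u (x + r *\<^sub>R v)"
          using in_K[OF True, of s] in_K[OF True, of r] rs by (auto simp: u0_def)
        then show ?thesis using H True by (simp add: H_def)
      qed simp
    qed
  qed
  also have "\<dots> \<le> (\<integral>\<^sup>+x\<in>U. (\<integral>\<^sup>+t\<in>{r..s}. ennreal (norm v * (norm (w1 (x + t *\<^sub>R v)) + norm (w2 (x + t *\<^sub>R v)))) \<partial>lborel) \<partial>lborel)"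
  proof (intro nn_integral_mono mult_right_mono)
    fix x :: complex
    have "ennreal (norm (T x)) \<le> (\<integral>\<^sup>+t. ennreal (norm (indicator {r..s} t *\<^sub>R W0 (x + t *\<^sub>R v))) \<partial>lborel)"
      unfolding T_def
    \<comment> \<open>Without integrability the Bochner integral has the default value 0 and the
      bound is trivial.\<close>
    proof (cases "integrable lborel (\<lambda>t. indicator {r..s} t *\<^sub>R W0 (x + t *\<^sub>R v))")
      case True
      then show "ennreal (norm (\<integral>t. indicator {r..s} t *\<^sub>R W0 (x + t *\<^sub>R v) \<partial>lborel)) \<le>
          (\<integral>\<^sup>+t. ennreal (norm (indicator {r..s} t *\<^sub>R W0 (x + t *\<^sub>R v))) \<partial>lborel)"
        by (rule integral_norm_bound_ennreal)
    qed (simp add: not_integrable_integral_eq)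
    also have "\<dots> \<le> (\<integral>\<^sup>+t\<in>{r..s}. ennreal (norm v * (norm (w1 (x + t *\<^sub>R v)) + norm (w2 (x + t *\<^sub>R v)))) \<partial>lborel)"
    proof (rule nn_integral_mono)
      fix t :: real
      have "norm (W0 (x + t *\<^sub>R v)) \<le> norm (W (x + t *\<^sub>R v))" by (simp add: W0_def indicator_def)
      also have "\<dots> \<le> \<bar>Re v\<bar> * norm (w1 (x + t *\<^sub>R v)) + \<bar>Im v\<bar> * norm (w2 (x + t *\<^sub>R v))"
        unfolding W_def by (rule order_trans[OF norm_triangle_ineq]) simp
      also have "\<dots> \<le> norm v * (norm (w1 (x + t *\<^sub>R v)) + norm (w2 (x + t *\<^sub>R v)))"
        unfolding distrib_left by (intro add_mono mult_right_mono abs_Re_le_cmod abs_Im_le_cmod) auto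
      finally show "ennreal (norm (indicator {r..s} t *\<^sub>R W0 (x + t *\<^sub>R v))) \<le>
          ennreal (norm v * (norm (w1 (x + t *\<^sub>R v)) + norm (w2 (x + t *\<^sub>R v)))) * indicator {r..s} t"
        by (auto simp: indicator_def intro: ennreal_leI)
    qed
    finally show "ennreal (norm (T x)) \<le> (\<integral>\<^sup>+t\<in>{r..s}. ennreal (norm v * (norm (w1 (x + t *\<^sub>R v)) + norm (w2 (x + t *\<^sub>R v)))) \<partial>lborel)" .
  qed simp
  finally show ?thesis .
qed

lemma nn_integral_subdivision:
  fixes h :: "real \<Rightarrow> ennreal" and a :: "nat \<Rightarrow> real"
  assumes [measurable]: "h \<in> borel_measurable borel" and a: "\<And>j. a j \<le> a (Suc j)"
  shows "(\<Sum>j<n. \<integral>\<^sup>+t\<in>{a j..a (Suc j)}. h t \<partial>lborel) = (\<integral>\<^sup>+t\<in>{a 0..a n}. h t \<partial>lborel)"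
proof -
  \<comment> \<open>Half-open intervals partition the whole interval exactly; the omitted end points
    are null sets.\<close>
  have half: "(\<integral>\<^sup>+t\<in>{r..s}. h t \<partial>lborel) = (\<integral>\<^sup>+t\<in>{r..<s}. h t \<partial>lborel)" for r s :: real
  proof (rule nn_integral_cong_AE)
    show "AE t in lborel. h t * indicator {r..s} t = h t * indicator {r..<s} t"
      using AE_lborel_singleton[of s] by eventually_elim (auto simp: indicator_def)
  qed
  have "(\<Sum>j<n. indicator {a j..<a (Suc j)} t :: ennreal) = indicator {a 0..<a n} t" for t
  proof (induction n)
    case (Suc n)
    have "a 0 \<le> a n" using lift_Suc_mono_le[of a 0 n] a by simp
    then show ?case using Suc a[of n] by (auto simp: indicator_def)
  qed simp
  then have "(\<integral>\<^sup>+t\<in>{a 0..<a n}. h t \<partial>lborel) = (\<integral>\<^sup>+t. (\<Sum>j<n. h t * indicator {a j..<a (Suc j)} t) \<partial>lborel)"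
    by (simp add: sum_distrib_left[symmetric])
  also have "\<dots> = (\<Sum>j<n. \<integral>\<^sup>+t\<in>{a j..<a (Suc j)}. h t \<partial>lborel)"
    by (rule nn_integral_sum) measurable
  finally show ?thesis by (simp add: half)
qed

text \<open>The bounds for the single steps add up to the integral over the whole segment, which
  does not depend on \<open>n\<close>. The mesh can therefore be chosen later, according to the
  modulus of continuity of a map.\<close>

lemma subdivision_bound:
  fixes u w1 w2 :: "complex \<Rightarrow> 'b::euclidean_space" and v :: complex
  assumes S: "open S" and wp: "is_weak_partial S u 1 w1" "is_weak_partial S u \<i> w2"
    and wm[measurable]: "w1 \<in> borel_measurable borel" "w2 \<in> borel_measurable borel"
    and u: "continuous_on S u" and U: "open U" and K: "compact K" "K \<subseteq> S"
    and in_K: "\<And>x t. x \<in> U \<Longrightarrow> t \<in> {0..1} \<Longrightarrow> x + t *\<^sub>R v \<in> K" and n: "n > 0"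
  shows "(\<integral>\<^sup>+x\<in>U. ennreal (\<Sum>j<n. norm (u (x + (Suc j / n) *\<^sub>R v) - u (x + (j / n) *\<^sub>R v))) \<partial>lborel) \<le>
    (\<integral>\<^sup>+x\<in>U. (\<integral>\<^sup>+t\<in>{0..1}. ennreal (norm v * (norm (w1 (x + t *\<^sub>R v)) + norm (w2 (x + t *\<^sub>R v)))) \<partial>lborel) \<partial>lborel)"
proof -
  define u0 where "u0 x = indicator K x *\<^sub>R u x" for x
  define g where "g x t = ennreal (norm v * (norm (w1 (x + t *\<^sub>R v)) + norm (w2 (x + t *\<^sub>R v))))" for x t
  have Kb[measurable]: "K \<in> sets borel" using K(1) by (simp add: borel_compact)
  have Ub[measurable]: "U \<in> sets borel" using U by simp
  have u0b[measurable]: "u0 \<in> borel_measurable borel"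
    unfolding u0_def using Kb continuous_on_subset[OF u K(2)] by (rule borel_measurable_continuous_on_indicator)
  have u_eq: "u (x + t *\<^sub>R v) = u0 (x + t *\<^sub>R v)" if "x \<in> U" "t \<in> {0..1}" for x t
    using in_K[OF that] by (simp add: u0_def)
  have j01: "real j / n \<in> {0..1}" if "j \<le> n" for j using that n by (auto simp: divide_le_eq)
  have "(\<integral>\<^sup>+x\<in>U. ennreal (\<Sum>j<n. norm (u (x + (Suc j / n) *\<^sub>R v) - u (x + (j / n) *\<^sub>R v))) \<partial>lborel) =
     (\<integral>\<^sup>+x. (\<Sum>j<n. ennreal (norm (u0 (x + (Suc j / n) *\<^sub>R v) - u0 (x + (j / n) *\<^sub>R v))) * indicator U x) \<partial>lborel)"
  proof (rule nn_integral_cong)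
    fix x
    show "ennreal (\<Sum>j<n. norm (u (x + (Suc j / n) *\<^sub>R v) - u (x + (j / n) *\<^sub>R v))) * indicator U x =
      (\<Sum>j<n. ennreal (norm (u0 (x + (Suc j / n) *\<^sub>R v) - u0 (x + (j / n) *\<^sub>R v))) * indicator U x)"
    proof (cases "x \<in> U")
      case True
      have "ennreal (\<Sum>j<n. norm (u (x + (Suc j / n) *\<^sub>R v) - u (x + (j / n) *\<^sub>R v))) =
         ennreal (\<Sum>j<n. norm (u0 (x + (Suc j / n) *\<^sub>R v) - u0 (x + (j / n) *\<^sub>R v)))"
        using u_eq[OF True j01] by (intro arg_cong[where f=ennreal] sum.cong refl) (simp add: Suc_le_eq del: of_nat_Suc)
      then show ?thesis using True by (simp add: sum_ennreal[symmetric] del: sum_ennreal)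
    qed simp
  qed
  also have "\<dots> = (\<Sum>j<n. \<integral>\<^sup>+x\<in>U. ennreal (norm (u0 (x + (Suc j / n) *\<^sub>R v) - u0 (x + (j / n) *\<^sub>R v))) \<partial>lborel)"
    by (rule nn_integral_sum) measurable
  also have "\<dots> \<le> (\<Sum>j<n. \<integral>\<^sup>+x\<in>U. (\<integral>\<^sup>+t\<in>{j / n..Suc j / n}. g x t \<partial>lborel) \<partial>lborel)"
  proof (rule sum_mono)
    fix j assume "j \<in> {..<n}"
    then have j: "j < n" by simp
    have "(\<integral>\<^sup>+x\<in>U. ennreal (norm (u0 (x + (Suc j / n) *\<^sub>R v) - u0 (x + (j / n) *\<^sub>R v))) \<partial>lborel) =
      (\<integral>\<^sup>+x\<in>U. ennreal (norm (u (x + (Suc j / n) *\<^sub>R v) - u (x + (j / n) *\<^sub>R v))) \<partial>lborel)"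
      using u_eq j01[of "Suc j"] j01[of j] j
      by (intro nn_integral_cong) (simp add: indicator_def Suc_le_eq del: of_nat_Suc)
    also have "\<dots> \<le> (\<integral>\<^sup>+x\<in>U. (\<integral>\<^sup>+t\<in>{j / n..Suc j / n}. g x t \<partial>lborel) \<partial>lborel)"
      unfolding g_def
    proof (rule difference_bound[OF S wp wm u U K])
      show "real j / n \<le> Suc j / n" by (simp add: divide_right_mono)
      fix x t assume "x \<in> U" "t \<in> {real j / n..Suc j / n}"
      moreover have "0 \<le> real j / n" "Suc j / n \<le> 1" using j01[of "Suc j"] j01[of j] j by (simp_all del: of_nat_Suc)
      ultimately show "x + t *\<^sub>R v \<in> K"
        by (intro in_K) (simp_all only: atLeastAtMost_iff, linarith)
    qed
    finally show "(\<integral>\<^sup>+x\<in>U. ennreal (norm (u0 (x + (Suc j / n) *\<^sub>R v) - u0 (x + (j / n) *\<^sub>R v))) \<partial>lborel) \<le>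
      (\<integral>\<^sup>+x\<in>U. (\<integral>\<^sup>+t\<in>{j / n..Suc j / n}. g x t \<partial>lborel) \<partial>lborel)" .
  qed
  also have "\<dots> = (\<integral>\<^sup>+x. (\<Sum>j<n. (\<integral>\<^sup>+t\<in>{j / n..Suc j / n}. g x t \<partial>lborel) * indicator U x) \<partial>lborel)"
    unfolding g_def by (rule nn_integral_sum[symmetric]) measurable
  also have "\<dots> = (\<integral>\<^sup>+x\<in>U. (\<integral>\<^sup>+t\<in>{0..1}. g x t \<partial>lborel) \<partial>lborel)"
  proof (rule nn_integral_cong)
    fix x
    have "(\<Sum>j<n. (\<integral>\<^sup>+t\<in>{j / n..Suc j / n}. g x t \<partial>lborel)) = (\<integral>\<^sup>+t\<in>{0 / n..n / n}. g x t \<partial>lborel)"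
      using nn_integral_subdivision[of "g x" "\<lambda>j. real j / n" n] unfolding g_def
      by (simp add: divide_right_mono)
    then show "(\<Sum>j<n. (\<integral>\<^sup>+t\<in>{j / n..Suc j / n}. g x t \<partial>lborel) * indicator U x) =
        (\<integral>\<^sup>+t\<in>{0..1}. g x t \<partial>lborel) * indicator U x"
      using n by (simp add: sum_distrib_right[symmetric])
  qed
  finally show ?thesis by (simp only: g_def)
qed

section \<open>Averages over directions\<close>

lemma nn_integral_dilate:
  fixes f :: "complex \<Rightarrow> ennreal"
  assumes [measurable]: "f \<in> borel_measurable borel" and t: "t > 0"
  shows "(\<integral>\<^sup>+v. f (x + t *\<^sub>R v) \<partial>lborel) = ennreal (t powr (-2)) * (\<integral>\<^sup>+y. f y \<partial>lborel)"
proof -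
  have "(\<integral>\<^sup>+y. f y \<partial>lborel) = (\<integral>\<^sup>+y. f y \<partial>density (distr lborel borel (\<lambda>v. x + t *\<^sub>R v)) (\<lambda>_. \<bar>t\<bar> ^ DIM(complex)))"
    using lborel_affine[of t x] t by simp
  also have "\<dots> = ennreal (t ^ 2) * (\<integral>\<^sup>+v. f (x + t *\<^sub>R v) \<partial>lborel)"
    using t by (subst nn_integral_density) (auto simp: nn_integral_distr nn_integral_cmult)
  finally have "ennreal (t powr (-2)) * (\<integral>\<^sup>+y. f y \<partial>lborel) =
      (ennreal (t powr (-2)) * ennreal (t ^ 2)) * (\<integral>\<^sup>+v. f (x + t *\<^sub>R v) \<partial>lborel)"
    by (simp add: mult.assoc)
  also have "ennreal (t powr (-2)) * ennreal (t ^ 2) = 1"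
    using t by (simp add: ennreal_mult[symmetric] powr_minus powr_numeral)
  finally show ?thesis by simp
qed

text \<open>A crude form of Young's inequality: where g exceeds l, the factor (g/l)^(p-1) is at
  least 1.\<close>

lemma le_add_powr:
  fixes g l p :: real
  assumes "g \<ge> 0" "l > 0" "p > 1"
  shows "g \<le> l + l powr (1 - p) * g powr p"
proof (cases "g \<le> l")
  case False
  then have "g > 0" using assms by auto
  have "1 \<le> (g / l) powr (p - 1)" using False assms by (intro ge_one_powr_ge_zero) auto
  then have "g \<le> g * (g / l) powr (p - 1)" using \<open>g > 0\<close> by simp
  also have "\<dots> = l powr (1 - p) * g powr p"
    using \<open>g > 0\<close> assms by (simp add: powr_divide powr_diff field_simps)
  finally show ?thesis using assms by (simp add: add_increasing)
qed (use assms in \<open>simp add: add_increasing2\<close>)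

text \<open>Young's inequality \<open>g \<le> l + l\<^bsup>1-p\<^esup> g\<^sup>p\<close> with \<open>l = lam t\<^bsup>-2/p\<^esup>\<close> balances the two terms after the
  substitution \<open>y = x + tv\<close>, whose Jacobian is \<open>t\<^sup>2\<close>.\<close>

lemma cone_average:
  fixes g :: "complex \<Rightarrow> real"
  assumes gm[measurable]: "g \<in> borel_measurable borel" and g: "\<And>y. g y \<ge> 0"
    and p: "p > 2" and lam: "lam > 0" and Vb[measurable]: "V \<in> sets borel"
  shows "(\<integral>\<^sup>+v\<in>V. (\<integral>\<^sup>+t\<in>{0..1}. ennreal (g (x + t *\<^sub>R v)) \<partial>lborel) \<partial>lborel) \<le>
    ennreal (p / (p - 2)) * (ennreal lam * emeasure lborel V + ennreal (lam powr (1 - p)) * (\<integral>\<^sup>+y. ennreal (g y powr p) \<partial>lborel))"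
    (is "?L \<le> _ * ?C")
proof -
  have "?L = (\<integral>\<^sup>+v. (\<integral>\<^sup>+t. ennreal (g (x + t *\<^sub>R v)) * indicator {0..1} t * indicator V v \<partial>lborel) \<partial>lborel)"
    by (intro nn_integral_cong nn_integral_multc[symmetric]) measurable
  also have "\<dots> = (\<integral>\<^sup>+t. (\<integral>\<^sup>+v. ennreal (g (x + t *\<^sub>R v)) * indicator {0..1} t * indicator V v \<partial>lborel) \<partial>lborel)"
    by (rule lborel_pair.Fubini') measurable
  also have "\<dots> \<le> (\<integral>\<^sup>+t. ennreal (indicator {0..1} t * t powr (-2/p)) * ?C \<partial>lborel)"
  proof (rule nn_integral_mono_AE)
    show "AE t in lborel. (\<integral>\<^sup>+v. ennreal (g (x + t *\<^sub>R v)) * indicator {0..1} t * indicator V v \<partial>lborel) \<le>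
        ennreal (indicator {0..1} t * t powr (-2/p)) * ?C"
      \<comment> \<open>At t = 0 the dilation degenerates.\<close>
      using AE_lborel_singleton[of 0]
    proof eventually_elim
      fix t :: real assume t0: "t \<noteq> 0"
      show "(\<integral>\<^sup>+v. ennreal (g (x + t *\<^sub>R v)) * indicator {0..1} t * indicator V v \<partial>lborel) \<le>
        ennreal (indicator {0..1} t * t powr (-2/p)) * ?C"
      proof (cases "t \<in> {0..1}")
        case True
        then have t: "t > 0" using t0 by auto
        define l where "l = lam * t powr (-2/p)"
        have l: "l > 0" using lam t by (simp add: l_def)
        \<comment> \<open>After the substitution both terms carry the same power of t, since
          (2/p)(p-1) - 2 = -2/p.\<close>
        have lp: "l powr (1 - p) * t powr (-2) = lam powr (1 - p) * t powr (-2/p)"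
        proof -
          have "l powr (1 - p) = lam powr (1 - p) * t powr (-2/p * (1 - p))"
            using lam t by (simp add: l_def powr_mult powr_powr)
          moreover have "t powr (-2/p * (1 - p)) * t powr (-2) = t powr (-2/p)"
            using p by (simp add: powr_add[symmetric] field_simps)
          ultimately show ?thesis by simp
        qed
        have "(\<integral>\<^sup>+v. ennreal (g (x + t *\<^sub>R v)) * indicator {0..1} t * indicator V v \<partial>lborel) \<le>
          (\<integral>\<^sup>+v. ennreal l * indicator V v + ennreal (l powr (1 - p)) * ennreal (g (x + t *\<^sub>R v) powr p) \<partial>lborel)"
        proof (rule nn_integral_mono)
          fix v
          have "ennreal (g (x + t *\<^sub>R v)) \<le> ennreal l + ennreal (l powr (1 - p)) * ennreal (g (x + t *\<^sub>R v) powr p)"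
            using le_add_powr[OF g l, of p "x + t *\<^sub>R v"] p l by (simp add: ennreal_mult[symmetric] ennreal_plus[symmetric] ennreal_leI del: ennreal_plus)
          then show "ennreal (g (x + t *\<^sub>R v)) * indicator {0..1} t * indicator V v \<le>
            ennreal l * indicator V v + ennreal (l powr (1 - p)) * ennreal (g (x + t *\<^sub>R v) powr p)"
            using True by (auto simp: indicator_def)
        qed
        also have "\<dots> = ennreal l * emeasure lborel V + ennreal (l powr (1 - p)) * (\<integral>\<^sup>+v. ennreal (g (x + t *\<^sub>R v) powr p) \<partial>lborel)"
          by (subst nn_integral_add) (auto simp: nn_integral_cmult)
        also have "(\<integral>\<^sup>+v. ennreal (g (x + t *\<^sub>R v) powr p) \<partial>lborel) = ennreal (t powr (-2)) * (\<integral>\<^sup>+y. ennreal (g y powr p) \<partial>lborel)"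
          by (rule nn_integral_dilate[OF _ t]) measurable
        also have "ennreal (l powr (1 - p)) * (ennreal (t powr (-2)) * (\<integral>\<^sup>+y. ennreal (g y powr p) \<partial>lborel)) =
          ennreal (t powr (-2/p)) * (ennreal (lam powr (1 - p)) * (\<integral>\<^sup>+y. ennreal (g y powr p) \<partial>lborel))"
          unfolding mult.assoc[symmetric] by (simp add: ennreal_mult[symmetric] lp mult.commute)
        also have "ennreal l * emeasure lborel V = ennreal (t powr (-2/p)) * (ennreal lam * emeasure lborel V)"
          unfolding l_def using lam by (simp add: ennreal_mult mult_ac)
        finally show ?thesis using True by (simp add: distrib_left)
      qed simp
    qed
  qed
  also have "\<dots> = (\<integral>\<^sup>+t. ennreal (indicator {0..1} t * t powr (-2/p)) \<partial>lborel) * ?C"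
    by (rule nn_integral_multc) measurable
  \<comment> \<open>The exponent 2/p is below 1, so the singularity at 0 is integrable, with
    integral 1/(1 - 2/p) = p/(p-2).\<close>
  also have "(\<integral>\<^sup>+t. ennreal (indicator {0..1} t * t powr (-2/p)) \<partial>lborel) = ennreal (p / (p - 2))"
  proof (rule nn_integral_has_integral_lborel)
    have "((\<lambda>t. t powr (-2/p)) has_integral (1 powr (-2/p + 1) / (-2/p + 1))) {0..1}"
      using p by (intro has_integral_powr_from_0) (auto simp: field_simps)
    moreover have "1 powr (-2/p + 1) / (-2/p + 1) = p / (p - 2)" using p by (simp add: field_simps)
    ultimately have "((\<lambda>t. t powr (-2/p)) has_integral (p / (p - 2))) {0..1}" by simp
    then have "((\<lambda>t. if t \<in> {0..1} then t powr (-2/p) else 0) has_integral (p / (p - 2))) UNIV"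
      by (simp only: has_integral_restrict_UNIV)
    moreover have "(\<lambda>t. if t \<in> {0..1} then t powr (-2/p) else 0) = (\<lambda>t. indicator {0..1} t * t powr (-2/p))"
      by (auto simp: fun_eq_iff indicator_def)
    ultimately show "((\<lambda>t. indicator {0..1} t * t powr (-2/p)) has_integral (p / (p - 2))) UNIV" by simp
  qed auto
  finally show ?thesis .
qed

text \<open>Exchanging the integrals puts the directions innermost, where
  \<open>cone_average\<close> gives a bound independent of the starting point; integrating over
  \<open>U\<close> then only contributes its measure.\<close>

lemma averaged_subdivision_bound:
  fixes u w1 w2 :: "complex \<Rightarrow> 'b::euclidean_space"
  assumes S: "open S" and wp: "is_weak_partial S u 1 w1" "is_weak_partial S u \<i> w2"
    and wm[measurable]: "w1 \<in> borel_measurable borel" "w2 \<in> borel_measurable borel"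
    and u: "continuous_on S u" and U: "open U" and K: "compact K" "K \<subseteq> S"
    and in_K: "\<And>x v t. x \<in> U \<Longrightarrow> v \<in> V \<Longrightarrow> t \<in> {0..1} \<Longrightarrow> x + t *\<^sub>R v \<in> K" and n: "n > 0"
    and Vb[measurable]: "V \<in> sets borel" and \<rho>: "\<And>v. v \<in> V \<Longrightarrow> norm v \<le> \<rho>" and p: "p > 2" and lam: "lam > 0"
  shows "(\<integral>\<^sup>+v\<in>V. (\<integral>\<^sup>+x\<in>U. ennreal (\<Sum>j<n. norm (u (x + (Suc j / n) *\<^sub>R v) - u (x + (j / n) *\<^sub>R v))) \<partial>lborel) \<partial>lborel) \<le>
    ennreal (\<rho> * (p / (p - 2))) * (ennreal lam * emeasure lborel V +
      ennreal (lam powr (1 - p)) * (\<integral>\<^sup>+y. ennreal ((norm (w1 y) + norm (w2 y)) powr p) \<partial>lborel)) * emeasure lborel U"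
    (is "?L \<le> _ * ?C * _")
proof -
  define g where "g y = norm (w1 y) + norm (w2 y)" for y
  have gm[measurable]: "g \<in> borel_measurable borel" unfolding g_def by measurable
  have [measurable]: "U \<in> sets borel" using U by simp
  show ?thesis
  \<comment> \<open>An element of \<open>V\<close> is what shows \<open>\<rho>\<close> to be
    nonnegative.\<close>
  proof (cases "V = {}")
    case False
    then obtain v where "v \<in> V" by auto
    then have \<rho>0: "\<rho> \<ge> 0" using \<rho>[of v] norm_ge_zero[of v] by linarith
    have "?L \<le> (\<integral>\<^sup>+v. (\<integral>\<^sup>+x. ennreal \<rho> * ((\<integral>\<^sup>+t\<in>{0..1}. ennreal (g (x + t *\<^sub>R v)) \<partial>lborel) * indicator V v * indicator U x) \<partial>lborel) \<partial>lborel)"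
    proof (rule nn_integral_mono)
      fix v
      show "(\<integral>\<^sup>+x\<in>U. ennreal (\<Sum>j<n. norm (u (x + (Suc j / n) *\<^sub>R v) - u (x + (j / n) *\<^sub>R v))) \<partial>lborel) * indicator V v \<le>
        (\<integral>\<^sup>+x. ennreal \<rho> * ((\<integral>\<^sup>+t\<in>{0..1}. ennreal (g (x + t *\<^sub>R v)) \<partial>lborel) * indicator V v * indicator U x) \<partial>lborel)"
      proof (cases "v \<in> V")
        case True
        have "(\<integral>\<^sup>+x\<in>U. ennreal (\<Sum>j<n. norm (u (x + (Suc j / n) *\<^sub>R v) - u (x + (j / n) *\<^sub>R v))) \<partial>lborel) \<le>
          (\<integral>\<^sup>+x\<in>U. (\<integral>\<^sup>+t\<in>{0..1}. ennreal (norm v * (norm (w1 (x + t *\<^sub>R v)) + norm (w2 (x + t *\<^sub>R v)))) \<partial>lborel) \<partial>lborel)"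
          by (rule subdivision_bound[OF S wp wm u U K in_K[OF _ True] n])
        also have "\<dots> \<le> (\<integral>\<^sup>+x. ennreal \<rho> * ((\<integral>\<^sup>+t\<in>{0..1}. ennreal (g (x + t *\<^sub>R v)) \<partial>lborel) * indicator V v * indicator U x) \<partial>lborel)"
        proof (rule nn_integral_mono)
          fix x
          have "(\<integral>\<^sup>+t\<in>{0..1}. ennreal (norm v * (norm (w1 (x + t *\<^sub>R v)) + norm (w2 (x + t *\<^sub>R v)))) \<partial>lborel) \<le>
            (\<integral>\<^sup>+t. ennreal \<rho> * (ennreal (g (x + t *\<^sub>R v)) * indicator {0..1} t) \<partial>lborel)"
            using \<rho>[OF True] \<rho>0
            by (intro nn_integral_mono) (auto simp: g_def indicator_def ennreal_mult[symmetric] simp del: ennreal_plus intro!: ennreal_leI mult_right_mono)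
          also have "\<dots> = ennreal \<rho> * (\<integral>\<^sup>+t\<in>{0..1}. ennreal (g (x + t *\<^sub>R v)) \<partial>lborel)"
            by (rule nn_integral_cmult) measurable
          finally show "(\<integral>\<^sup>+t\<in>{0..1}. ennreal (norm v * (norm (w1 (x + t *\<^sub>R v)) + norm (w2 (x + t *\<^sub>R v)))) \<partial>lborel) * indicator U x \<le>
             ennreal \<rho> * ((\<integral>\<^sup>+t\<in>{0..1}. ennreal (g (x + t *\<^sub>R v)) \<partial>lborel) * indicator V v * indicator U x)"
            using True by (auto simp: indicator_def)
        qed
        finally show ?thesis using True by simp
      qed simp
    qed
    also have "\<dots> = (\<integral>\<^sup>+x. (\<integral>\<^sup>+v. ennreal \<rho> * ((\<integral>\<^sup>+t\<in>{0..1}. ennreal (g (x + t *\<^sub>R v)) \<partial>lborel) * indicator V v * indicator U x) \<partial>lborel) \<partial>lborel)"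
      by (rule lborel_pair.Fubini') measurable
    also have "\<dots> = (\<integral>\<^sup>+x. ennreal \<rho> * (\<integral>\<^sup>+v\<in>V. (\<integral>\<^sup>+t\<in>{0..1}. ennreal (g (x + t *\<^sub>R v)) \<partial>lborel) \<partial>lborel) * indicator U x \<partial>lborel)"
    proof (rule nn_integral_cong)
      fix x
      have "(\<integral>\<^sup>+v. ennreal \<rho> * ((\<integral>\<^sup>+t\<in>{0..1}. ennreal (g (x + t *\<^sub>R v)) \<partial>lborel) * indicator V v * indicator U x) \<partial>lborel) =
        (\<integral>\<^sup>+v. ennreal \<rho> * ((\<integral>\<^sup>+t\<in>{0..1}. ennreal (g (x + t *\<^sub>R v)) \<partial>lborel) * indicator V v) * indicator U x \<partial>lborel)"
        by (simp add: mult.assoc)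
      also have "\<dots> = (\<integral>\<^sup>+v. ennreal \<rho> * ((\<integral>\<^sup>+t\<in>{0..1}. ennreal (g (x + t *\<^sub>R v)) \<partial>lborel) * indicator V v) \<partial>lborel) * indicator U x"
        by (rule nn_integral_multc) measurable
      also have "(\<integral>\<^sup>+v. ennreal \<rho> * ((\<integral>\<^sup>+t\<in>{0..1}. ennreal (g (x + t *\<^sub>R v)) \<partial>lborel) * indicator V v) \<partial>lborel) =
        ennreal \<rho> * (\<integral>\<^sup>+v\<in>V. (\<integral>\<^sup>+t\<in>{0..1}. ennreal (g (x + t *\<^sub>R v)) \<partial>lborel) \<partial>lborel)"
        by (rule nn_integral_cmult) measurable
      finally show "(\<integral>\<^sup>+v. ennreal \<rho> * ((\<integral>\<^sup>+t\<in>{0..1}. ennreal (g (x + t *\<^sub>R v)) \<partial>lborel) * indicator V v * indicator U x) \<partial>lborel) =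
        ennreal \<rho> * (\<integral>\<^sup>+v\<in>V. (\<integral>\<^sup>+t\<in>{0..1}. ennreal (g (x + t *\<^sub>R v)) \<partial>lborel) \<partial>lborel) * indicator U x" .
    qed
    also have "\<dots> \<le> (\<integral>\<^sup>+x. ennreal \<rho> * (ennreal (p / (p - 2)) * ?C) * indicator U x \<partial>lborel)"
    proof (intro nn_integral_mono mult_right_mono mult_left_mono)
      show "(\<integral>\<^sup>+v\<in>V. (\<integral>\<^sup>+t\<in>{0..1}. ennreal (g (x + t *\<^sub>R v)) \<partial>lborel) \<partial>lborel) \<le> ennreal (p / (p - 2)) * ?C" for x
        using cone_average[OF gm _ p lam Vb] unfolding g_def by simp
    qed auto
    also have "\<dots> = ennreal \<rho> * (ennreal (p / (p - 2)) * ?C) * emeasure lborel U"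
      by (rule nn_integral_cmult_indicator) simp
    also have "ennreal \<rho> * (ennreal (p / (p - 2)) * ?C) = ennreal (\<rho> * (p / (p - 2))) * ?C"
      using p \<rho>0 by (simp only: mult.assoc[symmetric] ennreal_mult[symmetric] divide_nonneg_pos)
    finally show ?thesis .
  qed simp
qed

section \<open>Sobolev norms\<close>

text \<open>Integrating this pointwise bound with \<open>a\<close>, \<open>b\<close> the two norms gives Minkowski's inequality.\<close>

lemma norm_add_powr_le:
  fixes x y :: "'a::real_normed_vector" and a b p :: real
  assumes a: "a > 0" and b: "b > 0" and p: "p \<ge> 1"
  shows "norm (x + y) powr p \<le> (a + b) powr (p - 1) * (a powr (1 - p) * norm x powr p + b powr (1 - p) * norm y powr p)"
proof -
  have *: "(X + Y) powr p \<le> (a + b) powr (p - 1) * (a powr (1 - p) * X powr p + b powr (1 - p) * Y powr p)"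
    if "X > 0" "Y > 0" for X Y :: real
  proof -
    \<comment> \<open>Convexity of the power function is used at X/a and Y/b with weights a/(a+b)
      and b/(a+b), whose mean is (X+Y)/(a+b).\<close>
    define s where "s = a / (a + b)"
    have s: "0 \<le> s" "s \<le> 1" "1 - s = b / (a + b)" using a b by (auto simp: s_def field_simps)
    have "(s * (X / a) + (1 - s) * (Y / b)) powr p \<le> s * (X / a) powr p + (1 - s) * (Y / b) powr p"
      using convex_onD[OF powr_convex[OF p], of "1 - s" "X / a" "Y / b"] s(1,2) that a b by simp
    moreover have "s * (X / a) + (1 - s) * (Y / b) = (X + Y) / (a + b)"
      unfolding s(3) using a b by (simp add: s_def add_divide_distrib)
    ultimately have "((X + Y) / (a + b)) powr p \<le> s * (X / a) powr p + (1 - s) * (Y / b) powr p" by simp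
    then have "(a + b) powr p * ((X + Y) / (a + b)) powr p \<le>
        (a + b) powr p * (s * (X / a) powr p + (1 - s) * (Y / b) powr p)"
      by (intro mult_left_mono) auto
    moreover have "(a + b) powr p * ((X + Y) / (a + b)) powr p = (X + Y) powr p"
      using that a b by (simp add: powr_divide)
    moreover have "(a + b) powr p * (s * (X / a) powr p + (1 - s) * (Y / b) powr p) =
      (a + b) powr (p - 1) * (a powr (1 - p) * X powr p + b powr (1 - p) * Y powr p)"
    proof -
      have "C * (a / (a + b) * (x / A) + b / (a + b) * (y / B)) = C / (a + b) * (a / A * x + b / B * y)" for x y A B C
        by (simp add: distrib_left)
      then show ?thesis
        unfolding s(3) using that a b by (simp add: s_def powr_divide powr_diff)
    qed
    ultimately show ?thesis by simp
  qed
  \<comment> \<open>Convexity was used for positive arguments only; a vanishing summand is treated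
    by monotonicity of powers.\<close>
  have zero: "Z powr p \<le> (a + b) powr (p - 1) * (c powr (1 - p) * Z powr p)" if c: "c > 0" "c \<le> a + b" and Z: "Z \<ge> 0" for c Z
  proof -
    have "c powr (p - 1) \<le> (a + b) powr (p - 1)" using c p by (intro powr_mono2) auto
    then have "1 \<le> (a + b) powr (p - 1) * c powr (1 - p)"
      using c mult_right_mono[of "c powr (p - 1)" "(a + b) powr (p - 1)" "c powr (1 - p)"]
      by (simp add: powr_add[symmetric])
    then show ?thesis using mult_right_mono[of 1 "(a + b) powr (p - 1) * c powr (1 - p)" "Z powr p"] by (simp add: mult_ac)
  qed
  have "norm (x + y) powr p \<le> (norm x + norm y) powr p"
    using p by (intro powr_mono2 norm_triangle_ineq) auto
  also have "\<dots> \<le> (a + b) powr (p - 1) * (a powr (1 - p) * norm x powr p + b powr (1 - p) * norm y powr p)"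
  proof (cases "x = 0 \<or> y = 0")
    case True
    then show ?thesis using zero[of b "norm y"] zero[of a "norm x"] a b by auto
  qed (use * in auto)
  finally show ?thesis .
qed

text \<open>Completeness of Lebesgue measure: where the functions differ, preimages are subsets of a
  null set and hence measurable.\<close>

lemma measurable_lebesgue_cong_AE:
  assumes f: "f \<in> borel_measurable lebesgue" and ae: "AE x in lebesgue. f x = g x"
  shows "g \<in> borel_measurable lebesgue"
proof (rule borel_measurableI)
  fix T :: "'b set" assume T: "open T"
  obtain N where N: "N \<in> null_sets lebesgue" "{x. f x \<noteq> g x} \<subseteq> N"
  proof -
    from AE_E[OF ae] obtain N where "{x \<in> space lebesgue. f x \<noteq> g x} \<subseteq> N" "emeasure lebesgue N = 0" "N \<in> sets lebesgue"
      by blast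
    then show ?thesis by (intro that[of N] null_setsI) simp_all
  qed
  have fT: "f -` T \<in> sets lebesgue" using measurable_sets[OF f, of T] T by simp
  have "g -` T \<inter> N \<in> null_sets lebesgue"
    by (rule null_sets_completion_subset[OF _ N(1)]) simp
  then have "(f -` T - N) \<union> (g -` T \<inter> N) \<in> sets lebesgue"
    using fT N(1) by (intro sets.Un sets.Diff) (auto dest: null_setsD2)
  moreover have "f x = g x" if "x \<notin> N" for x using N(2) that by blast
  then have "(f -` T - N) \<union> (g -` T \<inter> N) = g -` T" by auto
  ultimately show "g -` T \<inter> space lebesgue \<in> sets lebesgue" by simp
qed

lemma measurable_lebesgue_on_cong_AE:
  fixes f g :: "'a::euclidean_space \<Rightarrow> 'b::euclidean_space"
  assumes S: "S \<in> sets lebesgue" and f: "f \<in> borel_measurable (lebesgue_on S)" and ae: "AE x in lebesgue_on S. f x = g x"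
  shows "g \<in> borel_measurable (lebesgue_on S)"
proof -
  have "(\<lambda>x. if x \<in> S then f x else 0) \<in> borel_measurable lebesgue" using borel_measurable_if_I[OF f S] .
  moreover have "AE x in lebesgue. x \<in> S \<longrightarrow> f x = g x" using ae S by (simp add: AE_lebesgue_on_iff)
  then have "AE x in lebesgue. (if x \<in> S then f x else 0) = (if x \<in> S then g x else 0)" by (rule AE_mp) auto
  ultimately have "(\<lambda>x. if x \<in> S then g x else 0) \<in> borel_measurable lebesgue" by (rule measurable_lebesgue_cong_AE)
  then show ?thesis by (rule borel_measurable_if_D)
qed

section \<open>Lebesgue spaces on subsets\<close>

lemma Lp_onD:
  "u \<in> Lp_on p S \<Longrightarrow> u \<in> borel_measurable (lebesgue_on S)"
  "u \<in> Lp_on p S \<Longrightarrow> integrable (lebesgue_on S) (\<lambda>x. norm (u x) powr p)"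
  by (auto simp: Lp_on_def)

lemma Lp_on_cong_AE:
  fixes u v :: "'a::euclidean_space \<Rightarrow> 'b::euclidean_space"
  assumes S: "S \<in> sets lebesgue" and u: "u \<in> Lp_on p S" and ae: "AE x in lebesgue_on S. u x = v x"
  shows "v \<in> Lp_on p S"
proof -
  have v[measurable]: "v \<in> borel_measurable (lebesgue_on S)"
    by (rule measurable_lebesgue_on_cong_AE[OF S Lp_onD(1)[OF u] ae])
  have [measurable]: "u \<in> borel_measurable (lebesgue_on S)" by (rule Lp_onD(1)[OF u])
  have "AE x in lebesgue_on S. norm (u x) powr p = norm (v x) powr p" using ae by eventually_elim simp
  then have "integrable (lebesgue_on S) (\<lambda>x. norm (v x) powr p)"
    by (rule integrable_cong_AE_imp[OF Lp_onD(2)[OF u], rotated]) measurable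
  then show ?thesis using v by (simp add: Lp_on_def)
qed

lemma Lp_on_linear:
  fixes u v :: "'a::euclidean_space \<Rightarrow> 'b::euclidean_space"
  assumes p: "p \<ge> 1" and u: "u \<in> Lp_on p S" and v: "v \<in> Lp_on p S"
  shows "(\<lambda>x. s *\<^sub>R u x + t *\<^sub>R v x) \<in> Lp_on p S"
proof -
  have [measurable]: "u \<in> borel_measurable (lebesgue_on S)" "v \<in> borel_measurable (lebesgue_on S)"
    using u v by (auto dest: Lp_onD)
  have "integrable (lebesgue_on S) (\<lambda>x. norm (s *\<^sub>R u x + t *\<^sub>R v x) powr p)"
  proof (rule Bochner_Integration.integrable_bound)
    show "integrable (lebesgue_on S) (\<lambda>x. 2 powr (p - 1) * (\<bar>s\<bar> powr p * norm (u x) powr p + \<bar>t\<bar> powr p * norm (v x) powr p))"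
      using Lp_onD(2)[OF u] Lp_onD(2)[OF v] by simp
    show "AE x in lebesgue_on S. norm (norm (s *\<^sub>R u x + t *\<^sub>R v x) powr p) \<le>
      norm (2 powr (p - 1) * (\<bar>s\<bar> powr p * norm (u x) powr p + \<bar>t\<bar> powr p * norm (v x) powr p))"
    proof (rule AE_I2)
      fix x
      have "norm (s *\<^sub>R u x + t *\<^sub>R v x) powr p \<le> 2 powr (p - 1) * (\<bar>s\<bar> powr p * norm (u x) powr p + \<bar>t\<bar> powr p * norm (v x) powr p)"
        using norm_add_powr_le[of 1 1 p "s *\<^sub>R u x" "t *\<^sub>R v x"] p by (simp add: powr_mult)
      then show "norm (norm (s *\<^sub>R u x + t *\<^sub>R v x) powr p) \<le>
          norm (2 powr (p - 1) * (\<bar>s\<bar> powr p * norm (u x) powr p + \<bar>t\<bar> powr p * norm (v x) powr p))"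
        by simp
    qed
  qed measurable
  then show ?thesis by (simp add: Lp_on_def)
qed

lemma Lp_on_subset:
  fixes u :: "'a::euclidean_space \<Rightarrow> 'b::euclidean_space"
  assumes "u \<in> Lp_on p S" "T \<subseteq> S" "S \<in> sets lebesgue" "T \<in> sets lebesgue"
  shows "u \<in> Lp_on p T"
proof -
  have "integrable lebesgue (\<lambda>x. indicator T x *\<^sub>R (indicator S x *\<^sub>R norm (u x) powr p))"
    using Lp_onD(2)[OF assms(1)] assms(3)
    by (intro integrable_mult_indicator[OF assms(4)]) (simp only: integrable_lebesgue_on_iff)
  moreover have "(\<lambda>x. indicator T x *\<^sub>R (indicator S x *\<^sub>R norm (u x) powr p)) = (\<lambda>x. indicator T x *\<^sub>R norm (u x) powr p)"
    using assms(2) by (auto simp: fun_eq_iff indicator_def)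
  ultimately have "integrable (lebesgue_on T) (\<lambda>x. norm (u x) powr p)"
    using assms(4) by (simp add: integrable_lebesgue_on_iff)
  moreover have "u \<in> borel_measurable (lebesgue_on T)"
    using measurable_restrict_mono[OF Lp_onD(1)[OF assms(1)] assms(2)] .
  ultimately show ?thesis by (simp add: Lp_on_def)
qed

lemma Lp_on_Un:
  fixes u :: "'a::euclidean_space \<Rightarrow> 'b::euclidean_space"
  assumes "u \<in> Lp_on p S" "u \<in> Lp_on p T" "S \<in> sets lebesgue" "T \<in> sets lebesgue"
  shows "u \<in> Lp_on p (S \<union> T)"
proof -
  have TS: "T - S \<in> sets lebesgue" using assms by auto
  have u2: "u \<in> Lp_on p (T - S)" by (rule Lp_on_subset[OF assms(2) _ assms(4) TS]) auto
  have "integrable lebesgue (\<lambda>x. indicator S x *\<^sub>R norm (u x) powr p + indicator (T - S) x *\<^sub>R norm (u x) powr p)"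
    using Lp_onD(2)[OF assms(1)] Lp_onD(2)[OF u2] assms(3) TS
    by (intro Bochner_Integration.integrable_add) (simp_all add: integrable_lebesgue_on_iff)
  moreover have "(\<lambda>x. indicator S x *\<^sub>R norm (u x) powr p + indicator (T - S) x *\<^sub>R norm (u x) powr p) =
      (\<lambda>x. indicator (S \<union> T) x *\<^sub>R norm (u x) powr p)"
    by (auto simp: fun_eq_iff indicator_def)
  ultimately have 1: "integrable (lebesgue_on (S \<union> T)) (\<lambda>x. norm (u x) powr p)"
    using assms(3,4) by (simp add: integrable_lebesgue_on_iff)
  have "(\<lambda>x. (if x \<in> S then u x else 0) + (if x \<in> T - S then u x else 0)) \<in> borel_measurable lebesgue"
    using borel_measurable_if_I[OF Lp_onD(1)[OF assms(1)] assms(3)] borel_measurable_if_I[OF Lp_onD(1)[OF u2] TS]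
    by (rule borel_measurable_add)
  moreover have "(\<lambda>x. (if x \<in> S then u x else 0) + (if x \<in> T - S then u x else 0)) = (\<lambda>x. if x \<in> S \<union> T then u x else 0)"
    by (auto simp: fun_eq_iff)
  ultimately have "u \<in> borel_measurable (lebesgue_on (S \<union> T))"
    by (metis borel_measurable_if_D)
  with 1 show ?thesis by (simp add: Lp_on_def)
qed

text \<open>A compact set has finite measure, and the norm of u is at most 1 plus its p-th
  power.\<close>

lemma Lp_on_locally_integrable:
  fixes u :: "'a::euclidean_space \<Rightarrow> 'b::euclidean_space"
  assumes p: "p \<ge> 1" and u: "u \<in> Lp_on p S" and S: "S \<in> sets lebesgue"
  shows "u locally_integrable_on S"
  unfolding locally_integrable_on_def
proof (intro allI impI, elim conjE)
  fix K :: "'a set" assume K: "compact K" "K \<subseteq> S"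
  have Kl: "K \<in> sets lebesgue" using borel_compact[OF K(1)] by auto
  have uK: "u \<in> Lp_on p K" by (rule Lp_on_subset[OF u K(2) S Kl])
  have "emeasure lebesgue K < \<infinity>" using emeasure_compact_finite[OF K(1)] borel_compact[OF K(1)] by simp
  then have "emeasure (lebesgue_on K) (space (lebesgue_on K)) < \<infinity>"
    using Kl by (simp add: emeasure_restrict_space)
  then have fin: "finite_measure (lebesgue_on K)" by (intro finite_measureI) auto
  show "integrable (lebesgue_on K) u"
  proof (rule Bochner_Integration.integrable_bound)
    show "integrable (lebesgue_on K) (\<lambda>x. 1 + norm (u x) powr p)"
      using Lp_onD(2)[OF uK] finite_measure.integrable_const[OF fin, of "1::real"] by simp
    show "u \<in> borel_measurable (lebesgue_on K)" by (rule Lp_onD(1)[OF uK])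
    show "AE x in lebesgue_on K. norm (u x) \<le> norm (1 + norm (u x) powr p)"
    proof (rule AE_I2)
      fix x
      show "norm (u x) \<le> norm (1 + norm (u x) powr p)"
      proof (cases "norm (u x) \<le> 1")
        case False
        then have "norm (u x) powr 1 \<le> norm (u x) powr p" using p by (intro powr_mono) auto
        then show ?thesis using False by simp
      qed (simp add: add_increasing2)
    qed
  qed
qed

section \<open>Sobolev spaces and their norm\<close>

lemma W1pI:
  assumes "u \<in> Lp_on p S" "\<And>b. b \<in> Basis \<Longrightarrow> w b \<in> Lp_on p S" "\<And>b. b \<in> Basis \<Longrightarrow> is_weak_partial S u b (w b)"
  shows "u \<in> W1p p S"
  using assms by (auto simp: W1p_def)

text \<open>The choice in \<open>weak_partial\<close> asks for a weak derivative, not for one in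
  L^p; uniqueness almost everywhere transfers integrability from the witness in
  \<open>W1p\<close>.\<close>

lemma W1p_weak_partial:
  fixes u :: "complex \<Rightarrow> 'b::euclidean_space"
  assumes S: "open S" and u: "u \<in> W1p p S" and b: "b \<in> Basis"
  shows "is_weak_partial S u b (weak_partial S u b)" "weak_partial S u b \<in> Lp_on p S" "u \<in> Lp_on p S"
proof -
  show "u \<in> Lp_on p S" using u by (simp add: W1p_def)
  obtain w where w: "w \<in> Lp_on p S" "is_weak_partial S u b w" using u b by (auto simp: W1p_def)
  show 1: "is_weak_partial S u b (weak_partial S u b)"
    unfolding weak_partial_def by (rule someI[where P="is_weak_partial S u b", OF w(2)])
  show "weak_partial S u b \<in> Lp_on p S"
    using S by (intro Lp_on_cong_AE[OF _ w(1)] weak_partial_unique[OF S w(2) 1]) auto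
qed

text \<open>The derivatives of the combination and of its parts are independent choices, hence
  equality only almost everywhere.\<close>

lemma W1p_linear:
  fixes u v :: "complex \<Rightarrow> 'b::euclidean_space"
  assumes S: "open S" and p: "p \<ge> 1" and u: "u \<in> W1p p S" and v: "v \<in> W1p p S"
  shows "(\<lambda>x. s *\<^sub>R u x + t *\<^sub>R v x) \<in> W1p p S"
    and "b \<in> Basis \<Longrightarrow> AE x in lebesgue_on S. weak_partial S (\<lambda>x. s *\<^sub>R u x + t *\<^sub>R v x) b x =
      s *\<^sub>R weak_partial S u b x + t *\<^sub>R weak_partial S v b x"
proof -
  note U = W1p_weak_partial[OF S u] and V = W1p_weak_partial[OF S v]
  show 1: "(\<lambda>x. s *\<^sub>R u x + t *\<^sub>R v x) \<in> W1p p S"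
  proof (rule W1pI[where w="\<lambda>b x. s *\<^sub>R weak_partial S u b x + t *\<^sub>R weak_partial S v b x"])
    show "(\<lambda>x. s *\<^sub>R u x + t *\<^sub>R v x) \<in> Lp_on p S"
      using u v by (intro Lp_on_linear[OF p]) (simp_all add: W1p_def)
    fix b :: complex assume b: "b \<in> Basis"
    show "(\<lambda>x. s *\<^sub>R weak_partial S u b x + t *\<^sub>R weak_partial S v b x) \<in> Lp_on p S"
      by (rule Lp_on_linear[OF p U(2)[OF b] V(2)[OF b]])
    show "is_weak_partial S (\<lambda>x. s *\<^sub>R u x + t *\<^sub>R v x) b (\<lambda>x. s *\<^sub>R weak_partial S u b x + t *\<^sub>R weak_partial S v b x)"
      by (rule is_weak_partial_linear[OF S U(1)[OF b] V(1)[OF b]])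
  qed
  show "AE x in lebesgue_on S. weak_partial S (\<lambda>x. s *\<^sub>R u x + t *\<^sub>R v x) b x =
      s *\<^sub>R weak_partial S u b x + t *\<^sub>R weak_partial S v b x" if b: "b \<in> Basis"
    by (rule weak_partial_unique[OF S W1p_weak_partial(1)[OF S 1 b] is_weak_partial_linear[OF S U(1)[OF b] V(1)[OF b]]])
qed

lemma W1p_subset:
  fixes u :: "complex \<Rightarrow> 'b::euclidean_space"
  assumes "open S" "open T" "T \<subseteq> S" and u: "u \<in> W1p p S"
  shows "u \<in> W1p p T"
    and "b \<in> Basis \<Longrightarrow> AE x in lebesgue_on T. weak_partial T u b x = weak_partial S u b x"
proof -
  note U = W1p_weak_partial[OF assms(1) u]
  show 1: "u \<in> W1p p T"
  proof (rule W1pI[where w="weak_partial S u"])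
    have sets: "S \<in> sets lebesgue" "T \<in> sets lebesgue" using assms(1,2) by simp_all
    show "u \<in> Lp_on p T"
      by (rule Lp_on_subset[OF _ assms(3) sets]) (use u in \<open>simp add: W1p_def\<close>)
    fix b :: complex assume b: "b \<in> Basis"
    show "weak_partial S u b \<in> Lp_on p T" by (rule Lp_on_subset[OF U(2)[OF b] assms(3) sets])
    show "is_weak_partial T u b (weak_partial S u b)"
      by (rule is_weak_partial_restrict[OF U(1)[OF b] assms(3,1,2)])
  qed
  show "AE x in lebesgue_on T. weak_partial T u b x = weak_partial S u b x" if b: "b \<in> Basis"
    by (rule weak_partial_unique[OF assms(2) W1p_weak_partial(1)[OF assms(2) 1 b] is_weak_partial_restrict[OF U(1)[OF b] assms(3,1,2)]])
qed

text \<open>The integrand of the p-th power of the Sobolev norm. With value and derivatives in one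
  integrand, Minkowski's inequality and the extraction of almost everywhere convergent subsequences
  are each done once.\<close>

definition W1p_density :: "real \<Rightarrow> complex set \<Rightarrow> (complex \<Rightarrow> 'b::euclidean_space) \<Rightarrow> complex \<Rightarrow> real" where
  "W1p_density p S u x = norm (u x) powr p + (\<Sum>b\<in>Basis. norm (weak_partial S u b x) powr p)"

lemma W1p_density_nonneg: "W1p_density p S u x \<ge> 0"
  by (simp add: W1p_density_def sum_nonneg)

lemma W1p_norm_eq:
  fixes u :: "complex \<Rightarrow> 'b::euclidean_space"
  assumes S: "open S" and p: "p \<ge> 1" and u: "u \<in> W1p p S"
  shows "integrable (lebesgue_on S) (W1p_density p S u)"
    and "W1p_norm p S u = (\<integral>x. W1p_density p S u x \<partial>lebesgue_on S) powr (1 / p)"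
    and "W1p_norm p S u powr p = (\<integral>x. W1p_density p S u x \<partial>lebesgue_on S)"
proof -
  note U = W1p_weak_partial[OF S u]
  have i: "integrable (lebesgue_on S) (\<lambda>x. norm (u x) powr p)"
    "\<And>b. b \<in> Basis \<Longrightarrow> integrable (lebesgue_on S) (\<lambda>x. norm (weak_partial S u b x) powr p)"
    using Lp_onD(2)[OF U(2)] u by (auto simp: W1p_def Lp_on_def)
  show "integrable (lebesgue_on S) (W1p_density p S u)"
    unfolding W1p_density_def[abs_def] using i by (intro Bochner_Integration.integrable_add Bochner_Integration.integrable_sum) auto
  have eq: "(\<integral>x. W1p_density p S u x \<partial>lebesgue_on S) =
    integral\<^sup>L (lebesgue_on S) (\<lambda>x. norm (u x) powr p) +
            (\<Sum>b\<in>Basis. integral\<^sup>L (lebesgue_on S) (\<lambda>x. norm (weak_partial S u b x) powr p))"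
    unfolding W1p_density_def using i
    by (subst Bochner_Integration.integral_add) (auto intro!: Bochner_Integration.integral_sum Bochner_Integration.integrable_sum)
  show 1: "W1p_norm p S u = (\<integral>x. W1p_density p S u x \<partial>lebesgue_on S) powr (1 / p)"
    unfolding eq W1p_norm_def using u by simp
  have "(\<integral>x. W1p_density p S u x \<partial>lebesgue_on S) \<ge> 0" by (simp add: W1p_density_nonneg integral_nonneg_AE)
  then show "W1p_norm p S u powr p = (\<integral>x. W1p_density p S u x \<partial>lebesgue_on S)"
    unfolding 1 using p by (simp add: powr_powr)
qed

lemma W1p_norm_nonneg: "W1p_norm p S u \<ge> 0"
  by (simp add: W1p_norm_def)

lemma W1p_norm_add_le:
  fixes u v :: "complex \<Rightarrow> 'b::euclidean_space"
  assumes S: "open S" and p: "p \<ge> 1" and u: "u \<in> W1p p S" and v: "v \<in> W1p p S"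
  shows "W1p_norm p S (\<lambda>x. u x + v x) \<le> W1p_norm p S u + W1p_norm p S v"
proof (rule field_le_epsilon)
  fix e :: real assume e: "e > 0"
  \<comment> \<open>The summands e/2 keep the weights positive when a norm vanishes.\<close>
  define a where "a = W1p_norm p S u + e / 2"
  define b where "b = W1p_norm p S v + e / 2"
  have ab: "a > 0" "b > 0" using e W1p_norm_nonneg[of p S u] W1p_norm_nonneg[of p S v] by (auto simp: a_def b_def)
  let ?C = "(a + b) powr (p - 1)"
  have uv: "(\<lambda>x. u x + v x) \<in> W1p p S" using W1p_linear(1)[OF S p u v, of 1 1] by simp
  have "AE x in lebesgue_on S. \<forall>c\<in>Basis. weak_partial S (\<lambda>x. u x + v x) c x = weak_partial S u c x + weak_partial S v c x"
    using W1p_linear(2)[OF S p u v, of _ 1 1] by (subst AE_ball_countable) (auto intro: countable_finite)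
  then have ae: "AE x in lebesgue_on S. W1p_density p S (\<lambda>x. u x + v x) x \<le>
      ?C * (a powr (1 - p) * W1p_density p S u x + b powr (1 - p) * W1p_density p S v x)"
  proof eventually_elim
    case (elim x)
    have "W1p_density p S (\<lambda>x. u x + v x) x = norm (u x + v x) powr p + (\<Sum>c\<in>Basis. norm (weak_partial S u c x + weak_partial S v c x) powr p)"
      using elim by (simp add: W1p_density_def)
    also have "\<dots> \<le> ?C * (a powr (1 - p) * norm (u x) powr p + b powr (1 - p) * norm (v x) powr p) +
      (\<Sum>c\<in>Basis. ?C * (a powr (1 - p) * norm (weak_partial S u c x) powr p + b powr (1 - p) * norm (weak_partial S v c x) powr p))"
      by (intro add_mono sum_mono norm_add_powr_le ab p)
    also have "\<dots> = ?C * (a powr (1 - p) * W1p_density p S u x + b powr (1 - p) * W1p_density p S v x)"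
      by (simp add: W1p_density_def sum_distrib_left[symmetric] sum.distrib algebra_simps)
    finally show ?case .
  qed
  note int = W1p_norm_eq(1)[OF S p]
  have "W1p_norm p S (\<lambda>x. u x + v x) powr p \<le>
      (\<integral>x. ?C * (a powr (1 - p) * W1p_density p S u x + b powr (1 - p) * W1p_density p S v x) \<partial>lebesgue_on S)"
    unfolding W1p_norm_eq(3)[OF S p uv] using int[OF u] int[OF v]
    by (intro integral_mono_AE int[OF uv] ae) auto
  also have "\<dots> = ?C * (a powr (1 - p) * W1p_norm p S u powr p + b powr (1 - p) * W1p_norm p S v powr p)"
    unfolding W1p_norm_eq(3)[OF S p u] W1p_norm_eq(3)[OF S p v] using int[OF u] int[OF v] by simp
  also have "\<dots> \<le> ?C * (a powr (1 - p) * a powr p + b powr (1 - p) * b powr p)"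
    using e p W1p_norm_nonneg[of p S u] W1p_norm_nonneg[of p S v]
    by (intro mult_left_mono add_mono powr_mono2) (auto simp: a_def b_def)
  \<comment> \<open>Since a^(1-p) a^p = a, and likewise for b, the bracket is a + b.\<close>
  also have "\<dots> = (a + b) powr p"
    using ab by (simp add: powr_add[symmetric] powr_diff)
  finally have "W1p_norm p S (\<lambda>x. u x + v x) \<le> a + b"
    using ab p W1p_norm_nonneg[of p S "\<lambda>x. u x + v x"] powr_less_mono2[of p "a + b" "W1p_norm p S (\<lambda>x. u x + v x)"]
    by (meson add_pos_pos less_eq_real_def not_le order_less_le_trans zero_less_one)
  then show "W1p_norm p S (\<lambda>x. u x + v x) \<le> W1p_norm p S u + W1p_norm p S v + e" by (simp add: a_def b_def)
qed

lemma W1p_norm_minus: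
  fixes u :: "complex \<Rightarrow> 'b::euclidean_space"
  assumes S: "open S" and p: "p \<ge> 1" and u: "u \<in> W1p p S"
  shows "W1p_norm p S (\<lambda>x. - u x) = W1p_norm p S u"
proof -
  have mu: "(\<lambda>x. - u x) \<in> W1p p S" using W1p_linear(1)[OF S p u u, of "-1" 0] by simp
  have "AE x in lebesgue_on S. \<forall>c\<in>Basis. weak_partial S (\<lambda>x. - u x) c x = - weak_partial S u c x"
    using W1p_linear(2)[OF S p u u, of _ "-1" 0] by (subst AE_ball_countable) (auto intro: countable_finite)
  then have "AE x in lebesgue_on S. W1p_density p S (\<lambda>x. - u x) x = W1p_density p S u x"
    by eventually_elim (simp add: W1p_density_def)
  then have "(\<integral>x. W1p_density p S (\<lambda>x. - u x) x \<partial>lebesgue_on S) = (\<integral>x. W1p_density p S u x \<partial>lebesgue_on S)"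
    using W1p_norm_eq(1)[OF S p] u mu by (intro integral_cong_AE) auto
  then show ?thesis by (simp add: W1p_norm_eq(2)[OF S p] u mu)
qed

lemma W1p_norm_mono:
  fixes u :: "complex \<Rightarrow> 'b::euclidean_space"
  assumes S: "open S" "open T" "T \<subseteq> S" and p: "p \<ge> 1" and u: "u \<in> W1p p S"
  shows "W1p_norm p T u \<le> W1p_norm p S u"
proof -
  have uT: "u \<in> W1p p T" by (rule W1p_subset(1)[OF S u])
  have "AE x in lebesgue_on T. \<forall>b\<in>Basis. weak_partial T u b x = weak_partial S u b x"
    using W1p_subset(2)[OF S u] by (subst AE_ball_countable) (auto intro: countable_finite)
  then have "AE x in lebesgue_on T. W1p_density p T u x \<le> W1p_density p S u x"
    by eventually_elim (simp add: W1p_density_def)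
  then have "(\<integral>x. W1p_density p T u x \<partial>lebesgue_on T) \<le> (\<integral>x. W1p_density p S u x \<partial>lebesgue_on S)"
    using W1p_norm_eq(1)[OF S(1) p u] S
    by (intro integral_mono_lebesgue_on_AE) (auto simp: W1p_density_nonneg)
  then show ?thesis
    unfolding W1p_norm_eq(2)[OF S(1) p u] W1p_norm_eq(2)[OF S(2) p uT] using p
    by (intro powr_mono2) (auto intro!: integral_nonneg_AE simp: W1p_density_nonneg)
qed

text \<open>Continuity upgrades vanishing almost everywhere to vanishing everywhere, because the
  nonzero set is open and null.\<close>

lemma W1p_norm_eq_0_imp:
  fixes u :: "complex \<Rightarrow> 'b::euclidean_space"
  assumes S: "open S" and p: "p \<ge> 1" and u: "u \<in> W1p p S" and 0: "W1p_norm p S u = 0" and cont: "continuous_on S u"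
    and x: "x \<in> S"
  shows "u x = 0"
proof -
  have "(\<integral>x. W1p_density p S u x \<partial>lebesgue_on S) = 0" using W1p_norm_eq(3)[OF S p u] 0 by simp
  then have "AE x in lebesgue_on S. W1p_density p S u x = 0"
    using W1p_norm_eq(1)[OF S p u] by (subst (asm) integral_nonneg_eq_0_iff_AE) (auto simp: W1p_density_nonneg)
  then have "AE x in lebesgue_on S. norm (u x) = 0"
  proof eventually_elim
    case (elim x)
    then have "norm (u x) powr p = 0"
      unfolding W1p_density_def by (subst (asm) add_nonneg_eq_0_iff) (auto intro: sum_nonneg)
    then show ?case by simp
  qed
  then have ae: "AE x in lebesgue. x \<in> S \<longrightarrow> u x = 0" using S by (simp add: AE_lebesgue_on_iff)
  show ?thesis
  proof (rule ccontr)
    assume nz: "u x \<noteq> 0"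
    have op: "open (S \<inter> u -` (- {0}))"
      using cont S by (intro continuous_open_preimage) auto
    have "AE x in lebesgue. x \<notin> S \<inter> u -` (- {0})" using ae by eventually_elim auto
    moreover have "S \<inter> u -` (- {0}) \<in> sets lebesgue" using op by simp
    ultimately have "negligible (S \<inter> u -` (- {0}))"
      by (simp only: negligible_iff_null_sets AE_iff_null_sets)
    then show False
      using open_not_negligible[OF op] x nz by blast
  qed
qed

section \<open>The metric space of manifold-valued Sobolev maps\<close>

lemma W1p_mapsD:
  assumes "f \<in> W1p_maps p S X i"
  shows "f \<in> extensional S" "continuous_map (top_of_set S) X f" "i \<circ> f \<in> W1p p S"
    "\<And>x. x \<in> S \<Longrightarrow> f x \<in> topspace X"
  using assms continuous_map_image_subset_topspace[of "top_of_set S" X f] by (auto simp: W1p_maps_def)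

lemma W1p_maps_diff:
  fixes i :: "'m \<Rightarrow> 'b::euclidean_space" and f g :: "complex \<Rightarrow> 'm"
  assumes "open S" "p \<ge> 1" "i \<circ> f \<in> W1p p S" "i \<circ> g \<in> W1p p S"
  shows "(\<lambda>\<zeta>. i (f \<zeta>) - i (g \<zeta>)) \<in> W1p p S"
    and "b \<in> Basis \<Longrightarrow> AE x in lebesgue_on S. weak_partial S (\<lambda>\<zeta>. i (f \<zeta>) - i (g \<zeta>)) b x =
      weak_partial S (i \<circ> f) b x - weak_partial S (i \<circ> g) b x"
  using W1p_linear(1)[OF assms, of 1 "-1"] W1p_linear(2)[OF assms, of b 1 "-1"] by simp_all

lemma W1p_metric_space:
  fixes i :: "'m \<Rightarrow> 'b::euclidean_space"
  assumes S: "open S" and p: "p \<ge> 1" and i: "continuous_map X euclidean i" "inj_on i (topspace X)"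
  shows "Metric_space (W1p_maps p S X i) (W1p_dist p S i)"
proof
  fix f g h
  show "0 \<le> W1p_dist p S i f g" by (simp add: W1p_dist_def W1p_norm_nonneg)
  show "W1p_dist p S i f g = W1p_dist p S i g f"
  proof (cases "(\<lambda>\<zeta>. i (f \<zeta>) - i (g \<zeta>)) \<in> W1p p S")
    case True
    then show ?thesis unfolding W1p_dist_def using W1p_norm_minus[OF S p True] by simp
  next
    \<comment> \<open>Symmetry is demanded of all pairs of functions; when the difference is not in
      \<open>W1p\<close>, neither is its negative, and both norms take the dummy value 0.\<close>
    case False
    then have "(\<lambda>\<zeta>. i (g \<zeta>) - i (f \<zeta>)) \<notin> W1p p S"
      using W1p_linear(1)[OF S p, of "\<lambda>\<zeta>. i (g \<zeta>) - i (f \<zeta>)" "\<lambda>\<zeta>. i (g \<zeta>) - i (f \<zeta>)" "-1" 0] by auto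
    with False show ?thesis by (simp add: W1p_dist_def W1p_norm_def)
  qed
  assume f: "f \<in> W1p_maps p S X i" and g: "g \<in> W1p_maps p S X i"
  note F = W1p_mapsD[OF f] and G = W1p_mapsD[OF g]
  note fg = W1p_maps_diff(1)[OF S p F(3) G(3)]
  show "(W1p_dist p S i f g = 0) = (f = g)"
  proof
    assume 0: "W1p_dist p S i f g = 0"
    have cont: "continuous_on S (\<lambda>\<zeta>. i (f \<zeta>) - i (g \<zeta>))"
      using continuous_map_compose[OF F(2) i(1)] continuous_map_compose[OF G(2) i(1)]
      by (auto simp: o_def intro: continuous_on_diff)
    have "f x = g x" if "x \<in> S" for x
      using W1p_norm_eq_0_imp[OF S p fg 0[unfolded W1p_dist_def] cont that] F(4)[OF that] G(4)[OF that] i(2)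
      by (auto dest: inj_onD)
    then show "f = g" using F(1) G(1) by (rule extensionalityI[rotated 2])
  next
    assume "f = g"
    have "W1p_norm p S (\<lambda>\<zeta>. 0 :: 'b) = 0"
    proof -
      have z: "(\<lambda>\<zeta>. 0 :: 'b) \<in> W1p p S" using W1p_linear(1)[OF S p F(3) F(3), of 0 0] by simp
      have "AE x in lebesgue_on S. \<forall>c\<in>Basis. weak_partial S (\<lambda>x. 0::'b) c x = 0"
        using W1p_linear(2)[OF S p F(3) F(3), of _ 0 0] by (subst AE_ball_countable) (auto intro: countable_finite)
      then have "AE x in lebesgue_on S. W1p_density p S (\<lambda>x. 0::'b) x = 0"
        by eventually_elim (use p in \<open>simp add: W1p_density_def\<close>)
      then have "(\<integral>x. W1p_density p S (\<lambda>x. 0::'b) x \<partial>lebesgue_on S) = 0"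
        by (rule integral_eq_zero_AE)
      then show ?thesis by (simp add: W1p_norm_eq(2)[OF S p z])
    qed
    then show "W1p_dist p S i f g = 0" using \<open>f = g\<close> by (simp add: W1p_dist_def)
  qed
  assume h: "h \<in> W1p_maps p S X i"
  note H = W1p_mapsD[OF h]
  show "W1p_dist p S i f h \<le> W1p_dist p S i f g + W1p_dist p S i g h"
    unfolding W1p_dist_def using W1p_norm_add_le[OF S p fg W1p_maps_diff(1)[OF S p G(3) H(3)]] by simp
qed

text \<open>Weak derivatives are only Lebesgue measurable, while the averages along segments are
  Fubini arguments on products of Borel spaces; extension by 0 makes the representative global.
  Components are treated one by one.\<close>

lemma borel_representative:
  fixes w :: "'a::euclidean_space \<Rightarrow> 'b::euclidean_space"
  assumes S: "open S" and w: "w \<in> borel_measurable (lebesgue_on S)"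
  obtains w' where "w' \<in> borel_measurable borel" "\<And>x. x \<notin> S \<Longrightarrow> w' x = 0" "AE x in lebesgue_on S. w x = w' x"
proof -
  have S': "S \<in> sets lebesgue" using S by simp
  have m: "(\<lambda>x. (if x \<in> S then w x else 0) \<bullet> b) \<in> borel_measurable lebesgue" for b
    using borel_measurable_if_I[OF w S'] by (rule borel_measurable_inner) simp
  have "\<forall>b. \<exists>v. v \<in> borel_measurable lborel \<and> (AE x in lborel. (if x \<in> S then w x else 0) \<bullet> b = v x)"
    using completion_ex_borel_measurable_real[OF m] by blast
  then obtain v where v: "\<And>b. v b \<in> borel_measurable lborel" "\<And>b. AE x in lborel. (if x \<in> S then w x else 0) \<bullet> b = v b x"
    by metis
  have [measurable]: "v b \<in> borel_measurable borel" for b using v(1)[of b] by simp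
  have [measurable]: "S \<in> sets borel" using S by simp
  show ?thesis
  proof (rule that[of "\<lambda>x. indicator S x *\<^sub>R (\<Sum>b\<in>Basis. v b x *\<^sub>R b)"])
    show "(\<lambda>x. indicator S x *\<^sub>R (\<Sum>b\<in>Basis. v b x *\<^sub>R b)) \<in> borel_measurable borel" by measurable
    have "AE x in lborel. \<forall>b\<in>Basis. (if x \<in> S then w x else 0) \<bullet> b = v b x"
      using v(2) by (subst AE_ball_countable) (auto intro: countable_finite)
    then have "AE x in lebesgue. \<forall>b\<in>Basis. (if x \<in> S then w x else 0) \<bullet> b = v b x" by (rule AE_completion)
    then have "AE x in lebesgue. x \<in> S \<longrightarrow> w x = indicator S x *\<^sub>R (\<Sum>b\<in>Basis. v b x *\<^sub>R b)"
    proof eventually_elim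
      case (elim x)
      show ?case
      proof
        assume x: "x \<in> S"
        have "w x = (\<Sum>b\<in>Basis. (w x \<bullet> b) *\<^sub>R b)" by (simp add: euclidean_representation)
        also have "\<dots> = (\<Sum>b\<in>Basis. v b x *\<^sub>R b)" using elim x by (intro sum.cong) auto
        finally show "w x = indicator S x *\<^sub>R (\<Sum>b\<in>Basis. v b x *\<^sub>R b)" using x by simp
      qed
    qed
    then show "AE x in lebesgue_on S. w x = indicator S x *\<^sub>R (\<Sum>b\<in>Basis. v b x *\<^sub>R b)"
      using S' by (simp add: AE_lebesgue_on_iff)
  qed simp
qed

lemma nn_integral_Borel_extension:
  fixes h g :: "'a::euclidean_space \<Rightarrow> real"
  assumes S: "open S" and h: "h \<in> borel_measurable borel" "\<And>x. x \<notin> S \<Longrightarrow> h x = 0" "\<And>x. h x \<ge> 0"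
    and le: "AE x in lebesgue_on S. h x \<le> g x" and g: "integrable (lebesgue_on S) g"
  shows "(\<integral>\<^sup>+x. ennreal (h x) \<partial>lborel) \<le> ennreal (\<integral>x. g x \<partial>lebesgue_on S)"
proof -
  have S': "S \<in> sets lebesgue" using S by simp
  have ae: "AE x in lebesgue. x \<in> S \<longrightarrow> h x \<le> g x" using le S' by (simp add: AE_lebesgue_on_iff)
  have int: "integrable lebesgue (\<lambda>x. indicator S x *\<^sub>R g x)" using g S' by (simp add: integrable_lebesgue_on_iff)
  have "(\<integral>\<^sup>+x. ennreal (h x) \<partial>lborel) = (\<integral>\<^sup>+x. ennreal (h x) \<partial>lebesgue)"
    by (simp add: nn_integral_completion)
  also have "\<dots> \<le> (\<integral>\<^sup>+x. ennreal (indicator S x *\<^sub>R g x) \<partial>lebesgue)"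
  proof (rule nn_integral_mono_AE)
    show "AE x in lebesgue. ennreal (h x) \<le> ennreal (indicator S x *\<^sub>R g x)"
      using ae
    proof eventually_elim
      case (elim x)
      then show ?case using h(2)[of x] by (cases "x \<in> S") (auto intro: ennreal_leI)
    qed
  qed
  also have "\<dots> = ennreal (\<integral>x. indicator S x *\<^sub>R g x \<partial>lebesgue)"
  proof (rule nn_integral_eq_integral[OF int])
    show "AE x in lebesgue. 0 \<le> indicator S x *\<^sub>R g x"
      using ae
    proof eventually_elim
      case (elim x)
      then show ?case using h(3)[of x] by (cases "x \<in> S") auto
    qed
  qed
  also have "(\<integral>x. indicator S x *\<^sub>R g x \<partial>lebesgue) = (\<integral>x. g x \<partial>lebesgue_on S)"
    using integral_restrict_space[of S lebesgue g] S' by simp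
  finally show ?thesis .
qed

text \<open>Supplies the gradient bound that enters the averages. The constant comes from (a + b)^p
  \<le> 2^(p-1) (a^p + b^p), enlarged to 2^p.\<close>

lemma W1p_borel_partials:
  fixes u :: "complex \<Rightarrow> 'b::euclidean_space"
  assumes S: "open S" and p: "p \<ge> 1" and u: "u \<in> W1p p S"
  obtains w1 w2 where "w1 \<in> borel_measurable borel" "w2 \<in> borel_measurable borel"
    "is_weak_partial S u 1 w1" "is_weak_partial S u \<i> w2"
    "(\<integral>\<^sup>+y. ennreal ((norm (w1 y) + norm (w2 y)) powr p) \<partial>lborel) \<le> ennreal (2 powr p * W1p_norm p S u powr p)"
proof -
  have B: "(1::complex) \<in> Basis" "\<i> \<in> Basis" by (auto simp: Basis_complex_def)
  note U1 = W1p_weak_partial[OF S u B(1)] and U2 = W1p_weak_partial[OF S u B(2)]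
  obtain w1 where w1: "w1 \<in> borel_measurable borel" "\<And>x. x \<notin> S \<Longrightarrow> w1 x = 0" "AE x in lebesgue_on S. weak_partial S u 1 x = w1 x"
    using borel_representative[OF S Lp_onD(1)[OF U1(2)]] by blast
  obtain w2 where w2: "w2 \<in> borel_measurable borel" "\<And>x. x \<notin> S \<Longrightarrow> w2 x = 0" "AE x in lebesgue_on S. weak_partial S u \<i> x = w2 x"
    using borel_representative[OF S Lp_onD(1)[OF U2(2)]] by blast
  have S': "S \<in> sets lebesgue" using S by simp
  have loc: "u locally_integrable_on S" "w1 locally_integrable_on S" "w2 locally_integrable_on S"
    using Lp_on_locally_integrable[OF p _ S'] U1(3) Lp_on_cong_AE[OF S' U1(2) w1(3)] Lp_on_cong_AE[OF S' U2(2) w2(3)] by blast+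
  note int = W1p_norm_eq(1)[OF S p u]
  have [measurable]: "w1 \<in> borel_measurable borel" "w2 \<in> borel_measurable borel" by fact+
  show ?thesis
  proof (rule that[OF w1(1) w2(1)])
    show "is_weak_partial S u 1 w1" by (rule is_weak_partial_cong_AE[OF S U1(1) w1(3) _ loc(1,2)]) simp
    show "is_weak_partial S u \<i> w2" by (rule is_weak_partial_cong_AE[OF S U2(1) w2(3) _ loc(1,3)]) simp
    have "(\<integral>\<^sup>+y. ennreal ((norm (w1 y) + norm (w2 y)) powr p) \<partial>lborel) \<le>
      ennreal (\<integral>x. 2 powr p * W1p_density p S u x \<partial>lebesgue_on S)"
    proof (rule nn_integral_Borel_extension[OF S])
      show "AE x in lebesgue_on S. (norm (w1 x) + norm (w2 x)) powr p \<le> 2 powr p * W1p_density p S u x"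
        using w1(3) w2(3)
      proof eventually_elim
        case (elim x)
        have "(norm (w1 x) + norm (w2 x)) powr p \<le> 2 powr (p - 1) * (norm (w1 x) powr p + norm (w2 x) powr p)"
          using norm_add_powr_le[of 1 1 p "norm (w1 x)" "norm (w2 x)"] p by simp
        also have "\<dots> \<le> 2 powr p * W1p_density p S u x"
          using elim by (intro mult_mono powr_mono) (auto simp: W1p_density_def Basis_complex_def sum_nonneg)
        finally show ?case .
      qed
      show "integrable (lebesgue_on S) (\<lambda>x. 2 powr p * W1p_density p S u x)" using int by simp
    qed (use w1(2) w2(2) p in \<open>auto, measurable\<close>)
    then show "(\<integral>\<^sup>+y. ennreal ((norm (w1 y) + norm (w2 y)) powr p) \<partial>lborel) \<le> ennreal (2 powr p * W1p_norm p S u powr p)"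
      using int by (simp add: W1p_norm_eq(3)[OF S p u])
  qed
qed

section \<open>Charts, tangent vectors and the embedding\<close>

text \<open>Charts give continuity of derivatives only for each fixed vector; in finite dimension
  the values on a basis control the operator norm.\<close>

lemma linear_pointwise_diff_bound:
  fixes L L' :: "'a::euclidean_space \<Rightarrow> 'b::real_normed_vector"
  assumes "linear L" "linear L'"
  shows "norm (L' v - L v) \<le> (\<Sum>b\<in>Basis. norm (L' b - L b)) * norm v"
proof -
  have eq: "f v = (\<Sum>b\<in>Basis. (v \<bullet> b) *\<^sub>R f b)" if "linear f" for f :: "'a \<Rightarrow> 'b"
    using linear_sum[OF that, of "\<lambda>b. (v \<bullet> b) *\<^sub>R b" Basis] linear_cmul[OF that]
    by (simp add: euclidean_representation)
  have "L' v - L v = (\<Sum>b\<in>Basis. (v \<bullet> b) *\<^sub>R (L' b - L b))"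
    by (simp add: eq[OF assms(1)] eq[OF assms(2)] scaleR_diff_right sum_subtractf)
  also have "norm \<dots> \<le> (\<Sum>b\<in>Basis. norm v * norm (L' b - L b))"
    by (rule sum_norm_le) (simp add: Basis_le_norm mult_right_mono)
  finally show ?thesis by (subst mult.commute) (simp add: sum_distrib_left)
qed

lemma tendsto_linear_apply:
  fixes L :: "nat \<Rightarrow> 'a::euclidean_space \<Rightarrow> 'b::real_normed_vector"
  assumes L: "\<And>n. linear (L n)" "linear M" and conv: "\<And>e. (\<lambda>n. L n e) \<longlonglongrightarrow> M e" and v: "v \<longlonglongrightarrow> a"
  shows "(\<lambda>n. L n (v n)) \<longlonglongrightarrow> M a"
proof -
  have eq: "f w = (\<Sum>b\<in>Basis. (w \<bullet> b) *\<^sub>R f b)" if "linear f" for f :: "'a \<Rightarrow> 'b" and w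
    using linear_sum[OF that, of "\<lambda>b. (w \<bullet> b) *\<^sub>R b" Basis] linear_cmul[OF that]
    by (simp add: euclidean_representation)
  have "(\<lambda>n. \<Sum>b\<in>Basis. (v n \<bullet> b) *\<^sub>R L n b) \<longlonglongrightarrow> (\<Sum>b\<in>Basis. (a \<bullet> b) *\<^sub>R M b)"
    by (intro tendsto_intros conv v)
  then show ?thesis by (simp add: eq[OF L(1), symmetric] eq[OF L(2), symmetric])
qed

text \<open>The limit \<open>M\<close> is bounded below, so the sequence \<open>v\<close> is bounded
  and \<open>M (v n)\<close> has the same limit as \<open>L n (v n)\<close>. That limit lies in the
  closed range of \<open>M\<close>, and the lower bound pulls the convergence back. It recovers
  coordinates of tangent vectors from their images in the ambient space.\<close>

lemma converging_injective_linear: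
  fixes L :: "nat \<Rightarrow> 'a::euclidean_space \<Rightarrow> 'b::euclidean_space"
  assumes L: "\<And>n. linear (L n)" "linear M" "inj M" and conv: "\<And>e. (\<lambda>n. L n e) \<longlonglongrightarrow> M e"
    and Lv: "(\<lambda>n. L n (v n)) \<longlonglongrightarrow> d"
  obtains a where "v \<longlonglongrightarrow> a" "M a = d"
proof -
  obtain m where m: "m > 0" "\<And>x. m * norm x \<le> norm (M x)"
    using linear_inj_bounded_below_pos[OF L(2,3)] by blast
  define \<delta> where "\<delta> n = (\<Sum>b\<in>Basis. norm (L n b - M b))" for n
  have \<delta>0: "\<delta> \<longlonglongrightarrow> 0"
    unfolding \<delta>_def using tendsto_sum[of Basis "\<lambda>b n. norm (L n b - M b)" "\<lambda>_. 0" sequentially] conv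
    by (simp add: LIM_zero tendsto_norm_zero)
  have diff: "norm (L n (v n) - M (v n)) \<le> \<delta> n * norm (v n)" for n
    unfolding \<delta>_def by (rule linear_pointwise_diff_bound[OF L(2) L(1)])
  \<comment> \<open>Once the operator distance is below m/2, half of the lower bound
    \<open>m\<close> survives.\<close>
  have ev: "\<forall>\<^sub>F n in sequentially. norm (v n) \<le> 2 / m * norm (L n (v n))"
  proof -
    have "\<forall>\<^sub>F n in sequentially. \<delta> n < m / 2" using \<delta>0 m(1) by (intro order_tendstoD(2)) auto
    then show ?thesis
    proof eventually_elim
      case (elim n)
      have "m * norm (v n) \<le> norm (M (v n))" by (rule m(2))
      also have "\<dots> \<le> norm (L n (v n)) + norm (L n (v n) - M (v n))" by norm
      also have "\<dots> \<le> norm (L n (v n)) + m / 2 * norm (v n)"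
        using diff[of n] elim by (meson add_left_mono less_imp_le mult_right_mono norm_ge_zero order_trans)
      finally show ?case using m(1) by (simp add: field_simps)
    qed
  qed
  have "(\<lambda>n. 2 / m * norm (L n (v n))) \<longlonglongrightarrow> 2 / m * norm d" by (intro tendsto_intros Lv)
  then have "(\<lambda>n. \<delta> n * (2 / m * norm (L n (v n)))) \<longlonglongrightarrow> 0" using tendsto_mult[OF \<delta>0] by fastforce
  moreover have "\<forall>\<^sub>F n in sequentially. norm (L n (v n) - M (v n)) \<le> \<delta> n * (2 / m * norm (L n (v n)))"
    using ev
  proof eventually_elim
    case (elim n)
    have "\<delta> n \<ge> 0" by (simp add: \<delta>_def sum_nonneg)
    then show ?case using diff[of n] elim by (meson mult_left_mono order_trans)
  qed
  ultimately have "(\<lambda>n. L n (v n) - M (v n)) \<longlonglongrightarrow> 0"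
    by (rule Lim_null_comparison[rotated])
  from tendsto_diff[OF Lv this] have Mv: "(\<lambda>n. M (v n)) \<longlonglongrightarrow> d" by simp
  have "closed (range M)"
    using closed_subspace[OF linear_subspace_image[OF L(2) subspace_UNIV]] .
  then obtain a where a: "d = M a"
    using closed_sequentially[of "range M" "\<lambda>n. M (v n)" d] Mv by blast
  have "(\<lambda>n. 1 / m * norm (M (v n) - d)) \<longlonglongrightarrow> 1 / m * norm (d - d)" by (intro tendsto_intros Mv)
  moreover have "norm (v n - a) \<le> 1 / m * norm (M (v n) - d)" for n
    using m(2)[of "v n - a"] m(1) by (simp add: a linear_diff[OF L(2)] field_simps)
  ultimately have "(\<lambda>n. v n - a) \<longlonglongrightarrow> 0"
    by (intro Lim_null_comparison[where f="\<lambda>n. v n - a"]) auto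
  then have "v \<longlonglongrightarrow> a" by (simp add: LIM_zero_iff)
  with a that show ?thesis by blast
qed

locale embedded_manifold =
  fixes X :: "'m topology" and A :: "('m, 'e::euclidean_space) chart set" and i :: "'m \<Rightarrow> 'b::euclidean_space"
  assumes manifold: "smooth_manifold X A" and embedding: "smooth_embedding X A i"
begin

abbreviation coord_embedding :: "('m, 'e) chart \<Rightarrow> 'e \<Rightarrow> 'b" where
  "coord_embedding c \<equiv> i \<circ> chart_inv c"

abbreviation coord_differential :: "('m, 'e) chart \<Rightarrow> 'e \<Rightarrow> 'e \<Rightarrow> 'b" where
  "coord_differential c x \<equiv> frechet_derivative (coord_embedding c) (at x)"

lemma chart:
  assumes "c \<in> A"
  shows "openin X (fst c)" "open (chart_image c)" "fst c \<subseteq> topspace X"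
    "homeomorphic_map (subtopology X (fst c)) (top_of_set (chart_image c)) (snd c)"
    "inj_on (snd c) (fst c)"
proof -
  have c: "is_chart X c" using manifold assms by (auto simp: smooth_manifold_def)
  then show 1: "openin X (fst c)" "open (chart_image c)"
    "homeomorphic_map (subtopology X (fst c)) (top_of_set (chart_image c)) (snd c)"
    by (auto simp: is_chart_def)
  show 2: "fst c \<subseteq> topspace X" using 1(1) by (rule openin_subset)
  show "inj_on (snd c) (fst c)"
    using homeomorphic_imp_injective_map[OF 1(3)] 2 by (simp add: inf_absorb2)
qed

lemma chart_inv_chart: "c \<in> A \<Longrightarrow> q \<in> fst c \<Longrightarrow> chart_inv c (snd c q) = q"
  unfolding chart_inv_def by (simp add: chart(5))

lemma chart_chart_inv: "x \<in> chart_image c \<Longrightarrow> chart_inv c x \<in> fst c" "x \<in> chart_image c \<Longrightarrow> snd c (chart_inv c x) = x"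
  unfolding chart_inv_def by (auto intro: inv_into_into f_inv_into_f)

lemma chart_image_open:
  assumes "c \<in> A" "openin X V" "V \<subseteq> fst c"
  shows "open (snd c ` V)"
proof -
  have "openin (subtopology X (fst c)) V" using assms by (auto simp: openin_subtopology)
  then have "openin (top_of_set (chart_image c)) (snd c ` V)"
    using homeomorphic_imp_open_map[OF chart(4)[OF assms(1)]] by (auto simp: open_map_def)
  then show ?thesis using chart(2)[OF assms(1)] by (simp add: openin_open_eq)
qed

lemma chart_continuous: "c \<in> A \<Longrightarrow> continuous_map (subtopology X (fst c)) euclidean (snd c)"
  using homeomorphic_imp_continuous_map[OF chart(4)] continuous_map_into_fulltopology by blast

lemma embedding_inj: "inj_on i (topspace X)"
  and embedding_continuous: "continuous_map X euclidean i"
  using embedding unfolding smooth_embedding_def embedding_map_def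
  by (auto dest: homeomorphic_imp_injective_map homeomorphic_imp_continuous_map continuous_map_into_fulltopology)

text \<open>An embedding is open onto its image. This allows convergence of points of the manifold
  to be tested through \<open>i\<close> alone.\<close>

lemma embedding_open:
  assumes "openin X V" "q \<in> V"
  obtains r where "r > 0" "\<And>q'. q' \<in> topspace X \<Longrightarrow> i q' \<in> ball (i q) r \<Longrightarrow> q' \<in> V"
proof -
  have "homeomorphic_map X (top_of_set (i ` topspace X)) i"
    using embedding unfolding smooth_embedding_def embedding_map_def by simp
  then have "openin (top_of_set (i ` topspace X)) (i ` V)"
    using homeomorphic_imp_open_map assms(1) by (auto simp: open_map_def)
  then obtain T where T: "open T" "i ` V = i ` topspace X \<inter> T" by (auto simp: openin_open)
  then obtain r where r: "r > 0" "ball (i q) r \<subseteq> T" using assms(2) open_contains_ball by blast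
  show ?thesis
  proof (rule that[OF r(1)])
    fix q' assume q': "q' \<in> topspace X" "i q' \<in> ball (i q) r"
    then have "i q' \<in> i ` V" using T(2) r(2) by blast
    then obtain q'' where "q'' \<in> V" "i q' = i q''" by auto
    then show "q' \<in> V" using embedding_inj q'(1) openin_subset[OF assms(1)] by (auto dest: inj_onD)
  qed
qed

lemma embedding_chart_nbhd:
  assumes "c \<in> A" "q \<in> fst c" "open W" "snd c q \<in> W"
  obtains r where "r > 0" "\<And>q'. q' \<in> topspace X \<Longrightarrow> i q' \<in> ball (i q) r \<Longrightarrow> q' \<in> fst c \<and> snd c q' \<in> W"
proof -
  have "openin (subtopology X (fst c)) {q' \<in> topspace (subtopology X (fst c)). snd c q' \<in> W}"
    using chart_continuous[OF assms(1)] assms(3) by (auto simp: continuous_map_def)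
  then have "openin X {q' \<in> fst c. snd c q' \<in> W}"
    using chart(1,3)[OF assms(1)] by (simp add: openin_open_subtopology inf_absorb2 Collect_conj_eq)
  from embedding_open[OF this, of q] assms(2,4) obtain r where
    "r > 0" "\<And>q'. q' \<in> topspace X \<Longrightarrow> i q' \<in> ball (i q) r \<Longrightarrow> q' \<in> {q' \<in> fst c. snd c q' \<in> W}" by blast
  then show ?thesis by (intro that) auto
qed

lemma continuous_map_via_embedding:
  assumes "f \<in> topspace Y \<rightarrow> topspace X" "continuous_map Y euclidean (i \<circ> f)"
  shows "continuous_map Y X f"
proof -
  have "homeomorphic_map X (top_of_set (i ` topspace X)) i"
    using embedding unfolding smooth_embedding_def embedding_map_def by simp
  then obtain g where g: "homeomorphic_maps X (top_of_set (i ` topspace X)) i g"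
    by (auto simp: homeomorphic_map_maps)
  have "continuous_map Y (top_of_set (i ` topspace X)) (i \<circ> f)"
    using assms by (auto simp: continuous_map_in_subtopology)
  from continuous_map_compose[OF this] have "continuous_map Y X (g \<circ> (i \<circ> f))"
    using g by (auto simp: homeomorphic_maps_def)
  then show ?thesis
    by (rule continuous_map_eq) (use g assms(1) in \<open>auto simp: homeomorphic_maps_def\<close>)
qed

lemma coord_embedding_smooth: "c \<in> A \<Longrightarrow> smooth_on (chart_image c) (coord_embedding c)"
  using embedding by (auto simp: smooth_embedding_def)

lemma coord_embedding_derivative:
  "c \<in> A \<Longrightarrow> x \<in> chart_image c \<Longrightarrow> (coord_embedding c has_derivative coord_differential c x) (at x)"
  by (rule smooth_on_frechet_derivative[OF coord_embedding_smooth])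

lemma coord_differential_continuous:
  "c \<in> A \<Longrightarrow> continuous_on (chart_image c) (\<lambda>x. coord_differential c x e)"
  by (rule smooth_on_continuous_derivative[OF coord_embedding_smooth])

lemma charts_atD: "c \<in> charts_at A q \<Longrightarrow> c \<in> A" "c \<in> charts_at A q \<Longrightarrow> q \<in> fst c"
  "c \<in> charts_at A q \<Longrightarrow> snd c q \<in> chart_image c"
  by (auto simp: charts_at_def)

lemma charts_at_ex:
  assumes "q \<in> topspace X" obtains c where "c \<in> charts_at A q"
  using manifold assms by (auto simp: smooth_manifold_def charts_at_def)

lemma transition_open: "c \<in> A \<Longrightarrow> c' \<in> A \<Longrightarrow> open (snd c ` (fst c \<inter> fst c'))"
  by (rule chart_image_open) (auto intro: openin_Int chart(1))

lemma transition_derivative: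
  assumes "c \<in> charts_at A q" "c' \<in> charts_at A q"
  shows "(snd c' \<circ> chart_inv c has_derivative frechet_derivative (snd c' \<circ> chart_inv c) (at (snd c q))) (at (snd c q))"
proof (rule smooth_on_frechet_derivative)
  show "smooth_on (snd c ` (fst c \<inter> fst c')) (snd c' \<circ> chart_inv c)"
    using manifold assms charts_atD by (auto simp: smooth_manifold_def)
qed (use assms charts_atD in auto)

text \<open>The chain rule for the embedding read in two charts; it removes the dependence of
  \<open>differential_at\<close> on the chosen chart.\<close>

lemma coord_differential_transition:
  assumes c: "c \<in> charts_at A q" "c' \<in> charts_at A q"
  shows "coord_differential c (snd c q) e =
    coord_differential c' (snd c' q) (frechet_derivative (snd c' \<circ> chart_inv c) (at (snd c q)) e)"
proof -
  note A = charts_atD[OF c(1)] charts_atD[OF c(2)]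
  have q: "snd c' (chart_inv c (snd c q)) = snd c' q" by (simp add: chart_inv_chart A)
  have "(coord_embedding c' \<circ> (snd c' \<circ> chart_inv c) has_derivative
      coord_differential c' (snd c' q) \<circ> frechet_derivative (snd c' \<circ> chart_inv c) (at (snd c q))) (at (snd c q))"
    using transition_derivative[OF c] coord_embedding_derivative[OF A(4,6)] q
    by (intro diff_chain_at) (auto simp: o_def)
  then have "(coord_embedding c has_derivative
      coord_differential c' (snd c' q) \<circ> frechet_derivative (snd c' \<circ> chart_inv c) (at (snd c q))) (at (snd c q))"
  proof (rule has_derivative_transform_within_open)
    show "open (snd c ` (fst c \<inter> fst c'))" by (rule transition_open[OF A(1,4)])
    show "snd c q \<in> snd c ` (fst c \<inter> fst c')" using A by auto
    fix x assume "x \<in> snd c ` (fst c \<inter> fst c')"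
    then show "(coord_embedding c' \<circ> (snd c' \<circ> chart_inv c)) x = coord_embedding c x"
      using A by (auto simp: chart_inv_chart)
  qed
  then show ?thesis by (metis comp_apply frechet_derivative_at)
qed

text \<open>The chain rule on a triple overlap. It is the compatibility condition that makes
  \<open>coord_vector\<close> a tangent vector.\<close>

lemma transition_cocycle:
  assumes c: "c \<in> charts_at A q" "c' \<in> charts_at A q" "c'' \<in> charts_at A q"
  shows "frechet_derivative (snd c'' \<circ> chart_inv c) (at (snd c q)) e =
    frechet_derivative (snd c'' \<circ> chart_inv c') (at (snd c' q)) (frechet_derivative (snd c' \<circ> chart_inv c) (at (snd c q)) e)"
proof -
  note A = charts_atD[OF c(1)] charts_atD[OF c(2)] charts_atD[OF c(3)]
  let ?D = "fst c \<inter> (fst c' \<inter> fst c'')"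
  have q: "snd c' (chart_inv c (snd c q)) = snd c' q" by (simp add: chart_inv_chart A)
  have "((snd c'' \<circ> chart_inv c') \<circ> (snd c' \<circ> chart_inv c) has_derivative
      frechet_derivative (snd c'' \<circ> chart_inv c') (at (snd c' q)) \<circ> frechet_derivative (snd c' \<circ> chart_inv c) (at (snd c q))) (at (snd c q))"
    using transition_derivative[OF c(1,2)] transition_derivative[OF c(2,3)] q
    by (intro diff_chain_at) (auto simp: o_def)
  then have "(snd c'' \<circ> chart_inv c has_derivative
      frechet_derivative (snd c'' \<circ> chart_inv c') (at (snd c' q)) \<circ> frechet_derivative (snd c' \<circ> chart_inv c) (at (snd c q))) (at (snd c q))"
  proof (rule has_derivative_transform_within_open)
    show "open (snd c ` ?D)"
      by (rule chart_image_open) (use A in \<open>auto intro!: openin_Int chart(1)\<close>)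
    show "snd c q \<in> snd c ` ?D" using A by auto
    fix x assume "x \<in> snd c ` ?D"
    then show "((snd c'' \<circ> chart_inv c') \<circ> (snd c' \<circ> chart_inv c)) x = (snd c'' \<circ> chart_inv c) x"
      using A by (auto simp: chart_inv_chart)
  qed
  then show ?thesis by (metis comp_apply frechet_derivative_at)
qed

lemma transition_self:
  assumes c: "c \<in> charts_at A q"
  shows "frechet_derivative (snd c \<circ> chart_inv c) (at (snd c q)) e = e"
proof -
  note A = charts_atD[OF c]
  have "frechet_derivative (snd c \<circ> chart_inv c) (at (snd c q)) = frechet_derivative (\<lambda>x. x) (at (snd c q))"
    by (rule frechet_derivative_cong_open(2)[OF chart(2)[OF A(1)] A(3)]) (simp add: chart_chart_inv)
  then show ?thesis by simp
qed

lemma coord_vector_tangent: "c \<in> charts_at A q \<Longrightarrow> coord_vector A c q e \<in> tangent_space A q"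
  unfolding tangent_space_def coord_vector_def mem_Collect_eq
  by (intro conjI allI impI ballI; simp only: if_True if_False) (rule transition_cocycle)

lemma coord_vector_self: "c \<in> charts_at A q \<Longrightarrow> coord_vector A c q e c = e"
  by (simp add: coord_vector_def transition_self)

lemma tangent_eq_coord_vector:
  "v \<in> tangent_space A q \<Longrightarrow> c \<in> charts_at A q \<Longrightarrow> v = coord_vector A c q (v c)"
  unfolding tangent_space_def coord_vector_def fun_eq_iff mem_Collect_eq by (metis (full_types))

lemma differential_at_eq:
  assumes "v \<in> tangent_space A q" "c \<in> charts_at A q"
  shows "differential_at A i q v = coord_differential c (snd c q) (v c)"
proof -
  define c0 where "c0 = (SOME c. c \<in> charts_at A q)"
  have c0: "c0 \<in> charts_at A q" unfolding c0_def using assms(2) by (rule someI)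
  have vc: "v c = frechet_derivative (snd c \<circ> chart_inv c0) (at (snd c0 q)) (v c0)"
    using assms c0 unfolding tangent_space_def by blast
  have "differential_at A i q v = coord_differential c0 (snd c0 q) (v c0)"
    by (simp add: differential_at_def c0_def Let_def)
  also have "\<dots> = coord_differential c (snd c q) (v c)"
    unfolding vc by (rule coord_differential_transition[OF c0 assms(2)])
  finally show ?thesis .
qed

lemma coord_differential_linear: "c \<in> charts_at A q \<Longrightarrow> linear (coord_differential c (snd c q))"
  by (rule has_derivative_linear, rule coord_embedding_derivative, erule charts_atD(1), erule charts_atD(3))

lemma coord_differential_inj:
  assumes c: "c \<in> charts_at A q"
  shows "inj (coord_differential c (snd c q))"
proof (rule injI)
  fix e e' assume eq: "coord_differential c (snd c q) e = coord_differential c (snd c q) e'"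
  have "q \<in> topspace X" using charts_atD[OF c] chart(3) by blast
  then have "inj_on (differential_at A i q) (tangent_space A q)"
    using embedding by (auto simp: smooth_embedding_def)
  moreover have "differential_at A i q (coord_vector A c q e) = differential_at A i q (coord_vector A c q e')"
    using eq by (simp add: differential_at_eq[OF coord_vector_tangent[OF c] c] coord_vector_self[OF c])
  ultimately have "coord_vector A c q e = coord_vector A c q e'"
    using coord_vector_tangent[OF c] by (auto dest: inj_onD)
  from fun_cong[OF this, of c] show "e = e'" by (simp only: coord_vector_self[OF c])
qed

text \<open>The equation \<open>df \<circ> \<i> = J \<circ> df\<close> at a point, in terms of \<open>a = df(1)\<close>, is closed under limits.\<close>

lemma J_complex_limit:
  assumes J: "almost_complex_structure X A J"
    and q: "q \<in> topspace X" and qk: "\<And>k. qk k \<in> topspace X" and lim: "(\<lambda>k. i (qk k)) \<longlonglongrightarrow> i q"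
    and a: "\<And>k. ak k \<in> tangent_space A (qk k)"
    and d1: "(\<lambda>k. differential_at A i (qk k) (ak k)) \<longlonglongrightarrow> d1"
    and d2: "(\<lambda>k. differential_at A i (qk k) (J (qk k) (ak k))) \<longlonglongrightarrow> d2"
  obtains a where "a \<in> tangent_space A q" "differential_at A i q a = d1" "differential_at A i q (J q a) = d2"
proof -
  obtain c where c: "c \<in> charts_at A q" using charts_at_ex[OF q] by blast
  note C = charts_atD[OF c]
  \<comment> \<open>The structure in the coordinates of the fixed chart; smoothness of
    \<open>J\<close> makes it continuous in the point for each fixed \<open>e\<close>.\<close>
  define Jc where "Jc x e = J (chart_inv c x) (coord_vector A c (chart_inv c x) e) c" for x e
  have Jlin: "J q (\<lambda>c. s *\<^sub>R v c + t *\<^sub>R w c) = (\<lambda>c. s *\<^sub>R J q v c + t *\<^sub>R J q w c)"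
    and Jtan: "J q v \<in> tangent_space A q"
    if "q \<in> topspace X" "v \<in> tangent_space A q" "w \<in> tangent_space A q" for q v w s t
    using J that unfolding almost_complex_structure_def by blast+
  have Jc_lin: "linear (Jc (snd c q))" if "c \<in> charts_at A q" for q
  proof -
    have qx: "q \<in> topspace X" using charts_atD[OF that] chart(3) by blast
    have inv: "chart_inv c (snd c q) = q" by (simp add: chart_inv_chart charts_atD[OF that])
    have lin: "coord_vector A c q (s *\<^sub>R e + t *\<^sub>R e') = (\<lambda>c'. s *\<^sub>R coord_vector A c q e c' + t *\<^sub>R coord_vector A c q e' c')" for s t e e'
    proof
      fix c'
      show "coord_vector A c q (s *\<^sub>R e + t *\<^sub>R e') c' = s *\<^sub>R coord_vector A c q e c' + t *\<^sub>R coord_vector A c q e' c'"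
        using has_derivative_linear[OF transition_derivative[OF that, of c']]
        by (simp add: coord_vector_def linear_add linear_cmul)
    qed
    have *: "Jc (snd c q) (s *\<^sub>R e + t *\<^sub>R e') = s *\<^sub>R Jc (snd c q) e + t *\<^sub>R Jc (snd c q) e'" for s t e e'
      unfolding Jc_def inv lin by (simp add: Jlin[OF qx coord_vector_tangent[OF that] coord_vector_tangent[OF that]])
    show ?thesis
      using *[of 1 _ 1] *[of _ _ 0] by (intro linearI) simp_all
  qed
  have J_eq: "J q v c = Jc (snd c q) (v c)" if "c \<in> charts_at A q" "v \<in> tangent_space A q" for q v
    unfolding Jc_def using that tangent_eq_coord_vector[OF that(2,1)]
    by (simp add: chart_inv_chart charts_atD[OF that(1)])
  have Jc_cont: "continuous_on (chart_image c) (\<lambda>x. Jc x e)" for e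
    unfolding Jc_def using J C(1) by (intro smooth_on_imp_continuous_on) (auto simp: almost_complex_structure_def)
  have xk: "(\<lambda>k. snd c (qk k)) \<longlonglongrightarrow> snd c q" and evk: "\<forall>\<^sub>F k in sequentially. c \<in> charts_at A (qk k)"
  proof -
    have ev: "\<forall>\<^sub>F k in sequentially. qk k \<in> fst c \<and> snd c (qk k) \<in> W" if W: "open W" "snd c q \<in> W" for W
    proof -
      obtain r where r: "r > 0" "\<And>q'. q' \<in> topspace X \<Longrightarrow> i q' \<in> ball (i q) r \<Longrightarrow> q' \<in> fst c \<and> snd c q' \<in> W"
        using embedding_chart_nbhd[OF C(1,2) W] by blast
      have "\<forall>\<^sub>F k in sequentially. i (qk k) \<in> ball (i q) r"
        using lim r(1) by (intro topological_tendstoD) auto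
      then show ?thesis by eventually_elim (use r(2) qk in blast)
    qed
    show "(\<lambda>k. snd c (qk k)) \<longlonglongrightarrow> snd c q"
      by (rule topological_tendstoI) (use ev in \<open>fast elim: eventually_mono\<close>)
    show "\<forall>\<^sub>F k in sequentially. c \<in> charts_at A (qk k)"
      using ev[of UNIV] C(1) by (auto simp: charts_at_def elim: eventually_mono)
  qed
  \<comment> \<open>Dropping finitely many terms puts the whole sequence into the domain of one
    chart, so the linear limit lemmas apply to every term.\<close>
  then obtain N where N: "\<And>k. k \<ge> N \<Longrightarrow> c \<in> charts_at A (qk k)"
    by (auto simp: eventually_sequentially)
  define Q where "Q k = qk (k + N)" for k
  have cQ: "c \<in> charts_at A (Q k)" for k unfolding Q_def by (rule N) simp
  have xQ: "(\<lambda>k. snd c (Q k)) \<longlonglongrightarrow> snd c q" unfolding Q_def by (rule LIMSEQ_ignore_initial_segment[OF xk])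
  define V where "V k = ak (k + N)" for k
  have V: "V k \<in> tangent_space A (Q k)" for k by (simp add: V_def Q_def a)
  have QX: "Q k \<in> topspace X" for k by (simp add: Q_def qk)
  have cont: "(\<lambda>k. F (snd c (Q k))) \<longlonglongrightarrow> F (snd c q)" if "continuous_on (chart_image c) F" for F :: "'e \<Rightarrow> 'z::topological_space"
    by (rule continuous_on_tendsto_compose[OF that xQ C(3)]) (rule always_eventually, use charts_atD(3)[OF cQ] in blast)
  have "(\<lambda>k. differential_at A i (Q k) (V k)) \<longlonglongrightarrow> d1"
    unfolding Q_def V_def by (rule LIMSEQ_ignore_initial_segment[OF d1])
  then have L1: "(\<lambda>k. coord_differential c (snd c (Q k)) (V k c)) \<longlonglongrightarrow> d1"
    by (simp only: differential_at_eq[OF V cQ])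
  \<comment> \<open>Injectivity of the differential of \<open>i\<close> yields a limit of the
    coordinate vectors from the limit of their ambient images.\<close>
  obtain e where e: "(\<lambda>k. V k c) \<longlonglongrightarrow> e" "coord_differential c (snd c q) e = d1"
    using converging_injective_linear[OF coord_differential_linear[OF cQ] coord_differential_linear[OF c] coord_differential_inj[OF c]
      cont[OF coord_differential_continuous[OF C(1)]] L1] by blast
  have "(\<lambda>k. differential_at A i (Q k) (J (Q k) (V k))) \<longlonglongrightarrow> d2"
    unfolding Q_def V_def by (rule LIMSEQ_ignore_initial_segment[OF d2])
  then have L2: "(\<lambda>k. coord_differential c (snd c (Q k)) (Jc (snd c (Q k)) (V k c))) \<longlonglongrightarrow> d2"
    by (simp only: differential_at_eq[OF Jtan[OF QX V V] cQ] J_eq[OF cQ V])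
  have "(\<lambda>k. Jc (snd c (Q k)) (V k c)) \<longlonglongrightarrow> Jc (snd c q) e"
    by (rule tendsto_linear_apply[OF Jc_lin[OF cQ] Jc_lin[OF c] cont[OF Jc_cont] e(1)])
  from tendsto_linear_apply[OF coord_differential_linear[OF cQ] coord_differential_linear[OF c]
      cont[OF coord_differential_continuous[OF C(1)]] this]
  have d2': "coord_differential c (snd c q) (Jc (snd c q) e) = d2"
    using L2 LIMSEQ_unique by blast
  define a where "a = coord_vector A c q e"
  have at: "a \<in> tangent_space A q" unfolding a_def by (rule coord_vector_tangent[OF c])
  have ac: "a c = e" unfolding a_def by (rule coord_vector_self[OF c])
  show ?thesis
  proof (rule that[OF at])
    show "differential_at A i q a = d1" using differential_at_eq[OF at c] ac e(2) by simp
    show "differential_at A i q (J q a) = d2"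
      using differential_at_eq[OF Jtan[OF q at at] c] J_eq[OF c at] ac d2' by simp
  qed
qed

end

section \<open>The induced distance\<close>

context embedded_manifold
begin

lemma induced_dist_refl:
  assumes "q \<in> topspace X"
  shows "induced_dist X i q q = 0"
proof -
  have "induced_length i (\<lambda>_. q) = 0" by (simp add: induced_length_def o_def)
  moreover have "pathin X (\<lambda>_. q)" using assms by (simp add: pathin_const)
  moreover have "(i \<circ> (\<lambda>_. q)) piecewise_C1_differentiable_on {0..1}"
    by (simp add: o_def piecewise_C1_differentiable_const)
  ultimately have "induced_dist X i q q \<le> 0"
    unfolding induced_dist_def by (intro INF_lower2[where i="\<lambda>_. q"]) auto
  then show ?thesis by simp
qed

lemma pathin_iff_embedding:
  "pathin X \<gamma> \<longleftrightarrow> \<gamma> ` {0..1} \<subseteq> topspace X \<and> continuous_on {0..1} (i \<circ> \<gamma>)"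
proof
  assume p: "pathin X \<gamma>"
  then show "\<gamma> ` {0..1} \<subseteq> topspace X \<and> continuous_on {0..1} (i \<circ> \<gamma>)"
    using continuous_map_compose[OF _ embedding_continuous, of "top_of_set {0..1}" \<gamma>]
    unfolding pathin_def by (auto dest!: continuous_map_image_subset_topspace)
next
  assume "\<gamma> ` {0..1} \<subseteq> topspace X \<and> continuous_on {0..1} (i \<circ> \<gamma>)"
  then show "pathin X \<gamma>"
    unfolding pathin_def by (intro continuous_map_via_embedding) auto
qed

text \<open>At the exceptional points nothing is known about \<open>vector_derivative\<close>;
  setting the speed to 0 there gives a Borel function, to which affine substitutions apply.\<close>

lemma piecewise_C1_speed:
  fixes g :: "real \<Rightarrow> 'b"
  assumes "g piecewise_C1_differentiable_on {0..1}"
  obtains S F where "finite S" "F \<in> borel_measurable borel" "\<And>t. t \<in> {0..1} - S \<Longrightarrow> g differentiable (at t)"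
    "\<And>t. t \<in> {0..1} - S \<Longrightarrow> F t = norm (vector_derivative g (at t))" "\<And>t. t \<notin> {0..1} - S \<Longrightarrow> F t = 0"
proof -
  obtain S where S: "finite S" "g C1_differentiable_on ({0..1} - S)"
    using assms by (auto simp: piecewise_C1_differentiable_on_def)
  have "closed S" using S(1) by (rule finite_imp_closed)
  then have m: "{0..1} - S \<in> sets borel" by (intro sets.Diff) auto
  have "(\<lambda>t. indicator ({0..1} - S) t *\<^sub>R norm (vector_derivative g (at t))) \<in> borel_measurable borel"
    using S(2) by (intro borel_measurable_continuous_on_indicator[OF m] continuous_on_norm) (auto simp: C1_differentiable_on_eq)
  then show ?thesis
    using S by (intro that[of S "\<lambda>t. indicator ({0..1} - S) t *\<^sub>R norm (vector_derivative g (at t))"])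
      (auto simp: C1_differentiable_on_eq)
qed

text \<open>Each half runs at double speed on an interval of half the length. Extending both speeds
  by 0 off [0,1] lets a single formula describe the joined speed and the substitutions run over the
  whole line.\<close>

lemma length_join:
  fixes g1 g2 :: "real \<Rightarrow> 'b"
  assumes g1: "g1 piecewise_C1_differentiable_on {0..1}" and g2: "g2 piecewise_C1_differentiable_on {0..1}"
  shows "(\<integral>\<^sup>+t\<in>{0..1}. ennreal (norm (vector_derivative (g1 +++ g2) (at t))) \<partial>lborel) \<le>
    (\<integral>\<^sup>+t\<in>{0..1}. ennreal (norm (vector_derivative g1 (at t))) \<partial>lborel) +
    (\<integral>\<^sup>+t\<in>{0..1}. ennreal (norm (vector_derivative g2 (at t))) \<partial>lborel)"
proof -
  obtain S1 F1 where S1: "finite S1" and F1m[measurable]: "F1 \<in> borel_measurable borel" and F1: "\<And>t. t \<in> {0..1} - S1 \<Longrightarrow> g1 differentiable (at t)"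
    "\<And>t. t \<in> {0..1} - S1 \<Longrightarrow> F1 t = norm (vector_derivative g1 (at t))" "\<And>t. t \<notin> {0..1} - S1 \<Longrightarrow> F1 t = 0"
    using piecewise_C1_speed[OF g1] by blast
  obtain S2 F2 where S2: "finite S2" and F2m[measurable]: "F2 \<in> borel_measurable borel" and F2: "\<And>t. t \<in> {0..1} - S2 \<Longrightarrow> g2 differentiable (at t)"
    "\<And>t. t \<in> {0..1} - S2 \<Longrightarrow> F2 t = norm (vector_derivative g2 (at t))" "\<And>t. t \<notin> {0..1} - S2 \<Longrightarrow> F2 t = 0"
    using piecewise_C1_speed[OF g2] by blast
  \<comment> \<open>The exceptional points of both curves, carried to the joined parameter, together
    with the junction and the end points.\<close>
  define N where "N = {0, 1/2, 1} \<union> (\<lambda>s. s / 2) ` S1 \<union> (\<lambda>s. (s + 1) / 2) ` S2"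
  have N: "finite N" using S1 S2 by (simp add: N_def)
  have d: "norm (vector_derivative (g1 +++ g2) (at t)) = 2 * F1 (2 * t) + 2 * F2 (2 * t - 1)"
    if t: "t \<in> {0..1}" "t \<notin> N" for t
  proof (cases "t < 1 / 2")
    case True
    have t': "2 * t \<in> {0..1} - S1"
    proof -
      have "2 * t \<notin> S1"
      proof
        assume "2 * t \<in> S1"
        then have "(2 * t) / 2 \<in> N" unfolding N_def by blast
        then show False using t(2) by simp
      qed
      then show ?thesis using t True by auto
    qed
    have "(g1 has_vector_derivative vector_derivative g1 (at (2 * t))) (at (2 * t))"
      using F1(1)[OF t'] by (simp add: vector_derivative_works)
    then have "((g1 \<circ> (\<lambda>t. 2 * t)) has_vector_derivative 2 *\<^sub>R vector_derivative g1 (at (2 * t))) (at t)"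
      by (intro vector_diff_chain_at) (auto intro!: derivative_eq_intros simp: has_vector_derivative_def)
    then have "((g1 +++ g2) has_vector_derivative 2 *\<^sub>R vector_derivative g1 (at (2 * t))) (at t)"
      by (rule has_vector_derivative_transform_within_open[of _ _ _ "{..<1/2}"]) (use True in \<open>auto simp: joinpaths_def\<close>)
    then have "vector_derivative (g1 +++ g2) (at t) = 2 *\<^sub>R vector_derivative g1 (at (2 * t))"
      by (rule vector_derivative_at)
    moreover have "F2 (2 * t - 1) = 0" using True by (intro F2(3)) auto
    ultimately show ?thesis using F1(2)[OF t'] by simp
  next
    case False
    then have t2: "t > 1 / 2" using t by (auto simp: N_def)
    have t': "2 * t - 1 \<in> {0..1} - S2"
    proof -
      have "2 * t - 1 \<notin> S2"
      proof
        assume "2 * t - 1 \<in> S2"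
        then have "((2 * t - 1) + 1) / 2 \<in> N" unfolding N_def by blast
        then show False using t(2) by simp
      qed
      then show ?thesis using t t2 by auto
    qed
    have "(g2 has_vector_derivative vector_derivative g2 (at (2 * t - 1))) (at (2 * t - 1))"
      using F2(1)[OF t'] by (simp add: vector_derivative_works)
    then have "((g2 \<circ> (\<lambda>t. 2 * t - 1)) has_vector_derivative 2 *\<^sub>R vector_derivative g2 (at (2 * t - 1))) (at t)"
      by (intro vector_diff_chain_at) (auto intro!: derivative_eq_intros simp: has_vector_derivative_def)
    then have "((g1 +++ g2) has_vector_derivative 2 *\<^sub>R vector_derivative g2 (at (2 * t - 1))) (at t)"
      by (rule has_vector_derivative_transform_within_open[of _ _ _ "{1/2<..}"]) (use t2 in \<open>auto simp: joinpaths_def\<close>)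
    then have "vector_derivative (g1 +++ g2) (at t) = 2 *\<^sub>R vector_derivative g2 (at (2 * t - 1))"
      by (rule vector_derivative_at)
    moreover have "F1 (2 * t) = 0" using t2 by (intro F1(3)) auto
    ultimately show ?thesis using F2(2)[OF t'] by simp
  qed
  have pos: "F1 t \<ge> 0" "F2 t \<ge> 0" for t
    by (cases "t \<in> {0..1} - S1", use F1(2,3) in simp, use F1(2,3) in simp,
      cases "t \<in> {0..1} - S2", use F2(2,3) in simp, use F2(2,3) in simp)
  have two: "ennreal (2 * a + 2 * b) = ennreal 2 * ennreal a + ennreal 2 * ennreal b" if "a \<ge> 0" "b \<ge> 0" for a b
    using that ennreal_plus[of "2 * a" "2 * b"] ennreal_mult[of 2 a] ennreal_mult[of 2 b] by simp
  have ae: "AE t in lborel. t \<notin> N"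
    using N by (intro AE_not_in) (simp add: finite_imp_null_set_lborel)
  have "(\<integral>\<^sup>+t\<in>{0..1}. ennreal (norm (vector_derivative (g1 +++ g2) (at t))) \<partial>lborel) \<le>
    (\<integral>\<^sup>+t. ennreal 2 * ennreal (F1 (2 * t)) + ennreal 2 * ennreal (F2 (2 * t - 1)) \<partial>lborel)"
  proof (rule nn_integral_mono_AE)
    show "AE t in lborel. ennreal (norm (vector_derivative (g1 +++ g2) (at t))) * indicator {0..1} t \<le>
       ennreal 2 * ennreal (F1 (2 * t)) + ennreal 2 * ennreal (F2 (2 * t - 1))"
      using ae
    proof eventually_elim
      case (elim t)
      show ?case
      proof (cases "t \<in> {0..1}")
        case True
        show ?thesis using True by (simp only: d[OF True elim] two[OF pos] indicator_simps mult_1_right order_refl)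
      qed simp
    qed
  qed
  also have "\<dots> = ennreal 2 * (\<integral>\<^sup>+t. ennreal (F1 (2 * t)) \<partial>lborel) + ennreal 2 * (\<integral>\<^sup>+t. ennreal (F2 (2 * t - 1)) \<partial>lborel)"
    by (subst nn_integral_add) (auto simp: nn_integral_cmult)
  also have "ennreal 2 * (\<integral>\<^sup>+t. ennreal (F1 (2 * t)) \<partial>lborel) = (\<integral>\<^sup>+t. ennreal (F1 t) \<partial>lborel)"
    using nn_integral_real_affine[of "\<lambda>t. ennreal (F1 t)" 2 0] by simp
  also have "ennreal 2 * (\<integral>\<^sup>+t. ennreal (F2 (2 * t - 1)) \<partial>lborel) = (\<integral>\<^sup>+t. ennreal (F2 t) \<partial>lborel)"
    using nn_integral_real_affine[of "\<lambda>t. ennreal (F2 t)" 2 "-1"] by simp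
  also have "(\<integral>\<^sup>+t. ennreal (F1 t) \<partial>lborel) \<le> (\<integral>\<^sup>+t\<in>{0..1}. ennreal (norm (vector_derivative g1 (at t))) \<partial>lborel)"
    by (rule nn_integral_mono) (use F1(2,3) in \<open>force simp: indicator_def\<close>)
  also have "(\<integral>\<^sup>+t. ennreal (F2 t) \<partial>lborel) \<le> (\<integral>\<^sup>+t\<in>{0..1}. ennreal (norm (vector_derivative g2 (at t))) \<partial>lborel)"
    by (rule nn_integral_mono) (use F2(2,3) in \<open>force simp: indicator_def\<close>)
  finally show ?thesis by (simp add: add_mono)
qed

lemma induced_dist_triangle:
  "induced_dist X i q1 q3 \<le> induced_dist X i q1 q2 + induced_dist X i q2 q3"
proof -
  let ?P = "\<lambda>q q'. {\<gamma>. pathin X \<gamma> \<and> (i \<circ> \<gamma>) piecewise_C1_differentiable_on {0..1} \<and> \<gamma> 0 = q \<and> \<gamma> 1 = q'}"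
  have *: "induced_dist X i q1 q3 \<le> induced_length i \<gamma>1 + induced_length i \<gamma>2"
    if "\<gamma>1 \<in> ?P q1 q2" "\<gamma>2 \<in> ?P q2 q3" for \<gamma>1 \<gamma>2
  proof -
    define \<gamma> where "\<gamma> t = (if t \<le> 1/2 then \<gamma>1 (2 * t) else \<gamma>2 (2 * t - 1))" for t :: real
    have i\<gamma>: "i \<circ> \<gamma> = (i \<circ> \<gamma>1) +++ (i \<circ> \<gamma>2)" by (auto simp: \<gamma>_def joinpaths_def fun_eq_iff)
    have fin: "pathfinish (i \<circ> \<gamma>1) = pathstart (i \<circ> \<gamma>2)" using that by (simp add: pathfinish_def pathstart_def)
    have v: "(i \<circ> \<gamma>) piecewise_C1_differentiable_on {0..1}"
      unfolding i\<gamma> using valid_path_join[of "i \<circ> \<gamma>1" "i \<circ> \<gamma>2"] that fin by (simp add: valid_path_def)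
    have "\<gamma> \<in> ?P q1 q3"
    proof (intro CollectI conjI v)
      have "\<gamma> ` {0..1} \<subseteq> topspace X"
        using that unfolding \<gamma>_def pathin_iff_embedding by (auto simp: image_subset_iff)
      moreover have "continuous_on {0..1} (i \<circ> \<gamma>)" using v by (simp add: piecewise_C1_differentiable_on_def)
      ultimately show "pathin X \<gamma>" by (simp add: pathin_iff_embedding)
      show "\<gamma> 0 = q1" "\<gamma> 1 = q3" using that by (simp_all add: \<gamma>_def)
    qed
    then have "induced_dist X i q1 q3 \<le> induced_length i \<gamma>"
      unfolding induced_dist_def by (rule INF_lower)
    also have "\<dots> \<le> induced_length i \<gamma>1 + induced_length i \<gamma>2"
      unfolding induced_length_def i\<gamma> using that by (intro length_join) auto
    finally show ?thesis .
  qed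
  show ?thesis
  proof (rule ennreal_le_epsilon)
    fix e :: real assume fin: "induced_dist X i q1 q2 + induced_dist X i q2 q3 < top" and e: "e > 0"
    \<comment> \<open>Nearly shortest curves are found below a value strictly larger than the
      infimum, which exists only for finite distances.\<close>
    have less: "a < a + ennreal (e / 2)" if "a < top" for a
      using that e by (cases a) (auto simp: ennreal_plus[symmetric] ennreal_less_iff simp del: ennreal_plus)
    have "induced_dist X i q1 q2 < induced_dist X i q1 q2 + ennreal (e / 2)"
      "induced_dist X i q2 q3 < induced_dist X i q2 q3 + ennreal (e / 2)"
      using fin e by (auto intro!: less)
    then obtain \<gamma>1 \<gamma>2 where \<gamma>: "\<gamma>1 \<in> ?P q1 q2" "induced_length i \<gamma>1 < induced_dist X i q1 q2 + ennreal (e / 2)"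
      "\<gamma>2 \<in> ?P q2 q3" "induced_length i \<gamma>2 < induced_dist X i q2 q3 + ennreal (e / 2)"
      unfolding induced_dist_def INF_less_iff by blast
    have "induced_dist X i q1 q3 \<le> induced_length i \<gamma>1 + induced_length i \<gamma>2" by (rule *[OF \<gamma>(1,3)])
    also have "\<dots> \<le> (induced_dist X i q1 q2 + ennreal (e / 2)) + (induced_dist X i q2 q3 + ennreal (e / 2))"
      using \<gamma>(2,4) by (intro add_mono) auto
    also have "\<dots> = induced_dist X i q1 q2 + induced_dist X i q2 q3 + (ennreal (e / 2) + ennreal (e / 2))"
      by (simp only: ac_simps)
    also have "ennreal (e / 2) + ennreal (e / 2) = ennreal e"
      using e by (subst ennreal_plus[symmetric]) auto
    finally show "induced_dist X i q1 q3 \<le> induced_dist X i q1 q2 + induced_dist X i q2 q3 + ennreal e" .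
  qed
qed

text \<open>Nearby points are joined by the straight segment in a chart, with displacement
  \<open>h\<close>. Close to \<open>q\<close> the differential of \<open>i\<close> at
  \<open>h\<close> deviates from its value at \<open>q\<close> by at most a third of the norm of
  that value. So the length is at most 4/3 and the chord at least 2/3 of this norm, which gives the
  factor 2.\<close>

lemma induced_dist_local:
  assumes q: "q \<in> topspace X"
  obtains r where "r > 0" "\<And>q1 q2. q1 \<in> topspace X \<Longrightarrow> q2 \<in> topspace X \<Longrightarrow> i q1 \<in> ball (i q) r \<Longrightarrow>
    i q2 \<in> ball (i q) r \<Longrightarrow> induced_dist X i q1 q2 \<le> ennreal (2 * norm (i q1 - i q2))"
proof -
  obtain c where c: "c \<in> charts_at A q" using charts_at_ex[OF q] by blast
  note C = charts_atD[OF c]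
  let ?\<psi> = "coord_embedding c" and ?D = "coord_differential c"
  define x0 where "x0 = snd c q"
  have lin0: "linear (?D x0)" unfolding x0_def by (rule coord_differential_linear[OF c])
  obtain m where m: "m > 0" "\<And>h. m * norm h \<le> norm (?D x0 h)"
    using linear_inj_bounded_below_pos[OF lin0] coord_differential_inj[OF c] unfolding x0_def by blast
  have lin: "linear (?D x)" if "x \<in> chart_image c" for x
    using coord_embedding_derivative[OF C(1) that] by (rule has_derivative_linear)
  have "continuous_on (chart_image c) (\<lambda>x. \<Sum>b\<in>Basis. norm (?D x b - ?D x0 b))"
    by (intro continuous_intros coord_differential_continuous C(1))
  then have "isCont (\<lambda>x. \<Sum>b\<in>Basis. norm (?D x b - ?D x0 b)) x0"
    by (rule continuous_on_interior) (simp only: interior_open[OF chart(2)[OF C(1)]] C(3) x0_def)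
  then have "((\<lambda>x. \<Sum>b\<in>Basis. norm (?D x b - ?D x0 b)) \<longlongrightarrow> (\<Sum>b\<in>Basis. norm (?D x0 b - ?D x0 b))) (nhds x0)"
    unfolding continuous_at by (rule tendsto_at_iff_tendsto_nhds[of "\<lambda>x. \<Sum>b\<in>Basis. norm (?D x b - ?D x0 b)", THEN iffD1])
  then have "((\<lambda>x. \<Sum>b\<in>Basis. norm (?D x b - ?D x0 b)) \<longlongrightarrow> 0) (nhds x0)" by simp
  \<comment> \<open>The lower bound \<open>m\<close> will turn this absolute closeness into a
    relative one.\<close>
  then have "\<forall>\<^sub>F x in nhds x0. (\<Sum>b\<in>Basis. norm (?D x b - ?D x0 b)) < m / 3"
    using m(1) by (intro order_tendstoD(2)) auto
  moreover have "\<forall>\<^sub>F x in nhds x0. x \<in> chart_image c"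
    using chart(2)[OF C(1)] C(3) by (auto simp: eventually_nhds x0_def)
  ultimately have "\<forall>\<^sub>F x in nhds x0. x \<in> chart_image c \<and> (\<Sum>b\<in>Basis. norm (?D x b - ?D x0 b)) < m / 3"
    by eventually_elim simp
  then obtain s where s: "s > 0" "\<And>x. x \<in> ball x0 s \<Longrightarrow> x \<in> chart_image c"
    "\<And>x. x \<in> ball x0 s \<Longrightarrow> (\<Sum>b\<in>Basis. norm (?D x b - ?D x0 b)) < m / 3"
    by (auto simp: eventually_nhds_metric dist_commute)
  have near: "norm (?D x h - ?D x0 h) \<le> 1/3 * norm (?D x0 h)" if x: "x \<in> ball x0 s" for x h
  proof -
    have "norm (?D x h - ?D x0 h) \<le> (\<Sum>b\<in>Basis. norm (?D x b - ?D x0 b)) * norm h"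
      by (rule linear_pointwise_diff_bound[OF lin0 lin[OF s(2)[OF x]]])
    also have "\<dots> \<le> m / 3 * norm h" using s(3)[OF x] by (intro mult_right_mono) auto
    also have "\<dots> \<le> 1/3 * norm (?D x0 h)" using m(2)[of h] by simp
    finally show ?thesis .
  qed
  obtain r where r: "r > 0" "\<And>q'. q' \<in> topspace X \<Longrightarrow> i q' \<in> ball (i q) r \<Longrightarrow> q' \<in> fst c \<and> snd c q' \<in> ball x0 s"
    using embedding_chart_nbhd[OF C(1,2), of "ball x0 s"] s(1) x0_def by auto
  show ?thesis
  proof (rule that[OF r(1)])
    fix q1 q2 assume q12: "q1 \<in> topspace X" "q2 \<in> topspace X" "i q1 \<in> ball (i q) r" "i q2 \<in> ball (i q) r"
    define x1 x2 where "x1 = snd c q1" and "x2 = snd c q2"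
    define h where "h = x2 - x1"
    have q1: "q1 \<in> fst c" "x1 \<in> ball x0 s" and q2: "q2 \<in> fst c" "x2 \<in> ball x0 s"
      using r(2) q12 by (auto simp: x1_def x2_def)
    have seg: "x1 + t *\<^sub>R h \<in> ball x0 s" if "t \<in> {0..1}" for t
    proof -
      have "x1 + t *\<^sub>R h = (1 - t) *\<^sub>R x1 + t *\<^sub>R x2" by (simp add: h_def algebra_simps)
      then show ?thesis using convexD_alt[OF convex_ball q1(2) q2(2), of t] that by simp
    qed
    define \<gamma> where "\<gamma> t = chart_inv c (x1 + t *\<^sub>R h)" for t
    have der: "((i \<circ> \<gamma>) has_vector_derivative ?D (x1 + t *\<^sub>R h) h) (at t)" if "t \<in> {0..1}" for t
    proof -
      have 1: "((\<lambda>t. x1 + t *\<^sub>R h) has_vector_derivative h) (at t)"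
        by (auto intro!: derivative_eq_intros simp: has_vector_derivative_def)
      have 2: "(?\<psi> has_derivative ?D (x1 + t *\<^sub>R h)) (at (x1 + t *\<^sub>R h))"
        by (rule coord_embedding_derivative[OF C(1) s(2)[OF seg[OF that]]])
      have "((\<lambda>t. ?\<psi> (x1 + t *\<^sub>R h)) has_derivative (\<lambda>k. ?D (x1 + t *\<^sub>R h) (k *\<^sub>R h))) (at t)"
        using has_derivative_compose[OF 1[unfolded has_vector_derivative_def] 2] .
      moreover have "?D (x1 + t *\<^sub>R h) (k *\<^sub>R h) = k *\<^sub>R ?D (x1 + t *\<^sub>R h) h" for k
        by (rule linear_cmul[OF has_derivative_linear[OF 2]])
      ultimately show ?thesis by (simp add: has_vector_derivative_def \<gamma>_def o_def)
    qed
    have vd: "vector_derivative (i \<circ> \<gamma>) (at t) = ?D (x1 + t *\<^sub>R h) h" if "t \<in> {0..1}" for t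
      using der[OF that] by (rule vector_derivative_at)
    have cont: "continuous_on {0..1} (\<lambda>t. ?D (x1 + t *\<^sub>R h) h)"
    proof (rule continuous_on_compose2[OF coord_differential_continuous[OF C(1)]])
      show "(\<lambda>t. x1 + t *\<^sub>R h) ` {0..1} \<subseteq> chart_image c"
        by (rule image_subsetI) (rule s(2)[OF seg])
    qed (intro continuous_intros)
    have "(i \<circ> \<gamma>) C1_differentiable_on {0..1}"
      unfolding C1_differentiable_on_def
      by (intro exI[of _ "\<lambda>t. ?D (x1 + t *\<^sub>R h) h"] conjI ballI der cont)
    then have C1: "(i \<circ> \<gamma>) piecewise_C1_differentiable_on {0..1}"
      by (rule C1_differentiable_imp_piecewise)
    have "\<gamma> ` {0..1} \<subseteq> topspace X"
    proof (rule image_subsetI)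
      fix t :: real assume "t \<in> {0..1}"
      then have "\<gamma> t \<in> fst c" unfolding \<gamma>_def by (intro chart_chart_inv(1) s(2) seg)
      then show "\<gamma> t \<in> topspace X" using chart(3)[OF C(1)] by (rule subsetD[rotated])
    qed
    then have "pathin X \<gamma>" using C1 by (simp add: pathin_iff_embedding piecewise_C1_differentiable_on_def)
    moreover have "\<gamma> 0 = q1" "\<gamma> 1 = q2"
      using chart_inv_chart[OF C(1) q1(1)] chart_inv_chart[OF C(1) q2(1)]
      by (simp_all add: \<gamma>_def h_def x1_def x2_def)
    ultimately have "induced_dist X i q1 q2 \<le> induced_length i \<gamma>"
      unfolding induced_dist_def using C1 by (intro INF_lower) auto
    also have "\<dots> \<le> (\<integral>\<^sup>+t\<in>{0..1::real}. ennreal (4/3 * norm (?D x0 h)) \<partial>lborel)"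
      unfolding induced_length_def
    proof (rule nn_integral_mono)
      fix t :: real
      show "ennreal (norm (vector_derivative (i \<circ> \<gamma>) (at t))) * indicator {0..1} t \<le> ennreal (4/3 * norm (?D x0 h)) * indicator {0..1} t"
      proof (cases "t \<in> {0..1}")
        case True
        have "norm (?D (x1 + t *\<^sub>R h) h) \<le> norm (?D x0 h) + norm (?D (x1 + t *\<^sub>R h) h - ?D x0 h)"
          by (metis add.commute norm_triangle_sub)
        also have "\<dots> \<le> 4/3 * norm (?D x0 h)" using near[OF seg[OF True], of h] by simp
        finally show ?thesis using True by (simp add: vd[OF True] ennreal_leI)
      qed simp
    qed
    also have "\<dots> = ennreal (4/3 * norm (?D x0 h))" by (simp add: nn_integral_cmult_indicator)
    also have "\<dots> \<le> ennreal (2 * norm (i q1 - i q2))"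
    proof (rule ennreal_leI)
      \<comment> \<open>The mean value inequality for the curve minus a uniform linear motion bounds
        the chord from below.\<close>
      have "norm (((i \<circ> \<gamma>) 1 - 1 *\<^sub>R ?D x0 h) - ((i \<circ> \<gamma>) 0 - 0 *\<^sub>R ?D x0 h)) \<le> 1/3 * norm (?D x0 h) * norm (1 - (0::real))"
      proof (rule differentiable_bound[where S="{0..1}" and f'="\<lambda>t k. k *\<^sub>R (?D (x1 + t *\<^sub>R h) h - ?D x0 h)"])
        fix t :: real assume t: "t \<in> {0..1}"
        have "((\<lambda>t. (i \<circ> \<gamma>) t - t *\<^sub>R ?D x0 h) has_vector_derivative (?D (x1 + t *\<^sub>R h) h - ?D x0 h)) (at t within {0..1})"
          by (intro has_vector_derivative_diff has_vector_derivative_at_within[OF der[OF t]])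
            (auto intro!: derivative_eq_intros simp: has_vector_derivative_def)
        then show "((\<lambda>t. (i \<circ> \<gamma>) t - t *\<^sub>R ?D x0 h) has_derivative (\<lambda>k. k *\<^sub>R (?D (x1 + t *\<^sub>R h) h - ?D x0 h))) (at t within {0..1})"
          by (simp add: has_vector_derivative_def)
        show "onorm (\<lambda>k. k *\<^sub>R (?D (x1 + t *\<^sub>R h) h - ?D x0 h)) \<le> 1/3 * norm (?D x0 h)"
        proof (rule onorm_le)
          fix k :: real
          show "norm (k *\<^sub>R (?D (x1 + t *\<^sub>R h) h - ?D x0 h)) \<le> 1/3 * norm (?D x0 h) * norm k"
            using mult_left_mono[OF near[OF seg[OF t], of h], of "\<bar>k\<bar>"] by (simp add: mult_ac)
        qed
      qed auto
      then have "norm (i q2 - i q1 - ?D x0 h) \<le> 1/3 * norm (?D x0 h)"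
        using \<open>\<gamma> 0 = q1\<close> \<open>\<gamma> 1 = q2\<close> by (simp add: algebra_simps)
      moreover have "norm (?D x0 h) \<le> norm (i q2 - i q1) + norm (i q2 - i q1 - ?D x0 h)"
        by (metis norm_minus_commute norm_triangle_sub)
      ultimately show "4/3 * norm (?D x0 h) \<le> 2 * norm (i q1 - i q2)"
        by (simp add: norm_minus_commute)
    qed
    finally show "induced_dist X i q1 q2 \<le> ennreal (2 * norm (i q1 - i q2))" .
  qed
qed

text \<open>A Lebesgue number argument: covering by half radii leaves room for the second point.
  Only one of the two points has to lie in \<open>K\<close>, which matters because maps approaching
  a limit need not take values in a given compact set.\<close>

lemma induced_dist_compact:
  assumes "compactin X K"
  obtains \<eta> where "\<eta> > 0" "\<And>q q'. q \<in> K \<Longrightarrow> q' \<in> topspace X \<Longrightarrow> norm (i q - i q') < \<eta> \<Longrightarrow>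
    induced_dist X i q q' \<le> ennreal (2 * norm (i q - i q'))"
    "\<And>q q'. q \<in> K \<Longrightarrow> q' \<in> topspace X \<Longrightarrow> norm (i q - i q') < \<eta> \<Longrightarrow>
    induced_dist X i q' q \<le> ennreal (2 * norm (i q - i q'))"
proof -
  have KX: "K \<subseteq> topspace X" using assms by (rule compactin_subset_topspace)
  have "\<forall>q\<in>K. \<exists>r>0. \<forall>q1 q2. q1 \<in> topspace X \<longrightarrow> q2 \<in> topspace X \<longrightarrow> i q1 \<in> ball (i q) r \<longrightarrow>
    i q2 \<in> ball (i q) r \<longrightarrow> induced_dist X i q1 q2 \<le> ennreal (2 * norm (i q1 - i q2))"
  proof
    fix q assume "q \<in> K"
    then have "q \<in> topspace X" using KX by auto
    from induced_dist_local[OF this]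
    show "\<exists>r>0. \<forall>q1 q2. q1 \<in> topspace X \<longrightarrow> q2 \<in> topspace X \<longrightarrow> i q1 \<in> ball (i q) r \<longrightarrow>
      i q2 \<in> ball (i q) r \<longrightarrow> induced_dist X i q1 q2 \<le> ennreal (2 * norm (i q1 - i q2))" by metis
  qed
  then obtain r where r: "\<And>q. q \<in> K \<Longrightarrow> r q > 0" "\<And>q q1 q2. q \<in> K \<Longrightarrow> q1 \<in> topspace X \<Longrightarrow> q2 \<in> topspace X \<Longrightarrow> i q1 \<in> ball (i q) (r q) \<Longrightarrow>
    i q2 \<in> ball (i q) (r q) \<Longrightarrow> induced_dist X i q1 q2 \<le> ennreal (2 * norm (i q1 - i q2))"
    by metis
  have "compactin euclidean (i ` K)" by (rule image_compactin[OF assms embedding_continuous])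
  then have "compact (i ` K)" by simp
  moreover have "i ` K \<subseteq> (\<Union>q\<in>K. ball (i q) (r q / 2))" using r(1) by fastforce
  ultimately obtain D where D: "D \<subseteq> K" "finite D" "i ` K \<subseteq> (\<Union>q\<in>D. ball (i q) (r q / 2))"
    using compactE_image[of "i ` K" K "\<lambda>q. ball (i q) (r q / 2)"] by auto
  define \<eta> where "\<eta> = Min (insert 1 ((\<lambda>q. r q / 2) ` D))"
  have \<eta>: "\<eta> > 0" using D r(1) by (auto simp: \<eta>_def subset_iff)
  have \<eta>_le: "\<eta> \<le> r q / 2" if "q \<in> D" for q
    unfolding \<eta>_def using D(2) that by (intro Min_le) auto
  have *: "\<exists>p\<in>K. i q \<in> ball (i p) (r p) \<and> i q' \<in> ball (i p) (r p)" if q: "q \<in> K" "norm (i q - i q') < \<eta>" for q q'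
  proof -
    obtain p where p: "p \<in> D" "dist (i p) (i q) < r p / 2" using D(3) q(1) by auto
    have "dist (i p) (i q') \<le> dist (i p) (i q) + dist (i q) (i q')" by (rule dist_triangle)
    also have "\<dots> < r p" using p q(2) \<eta>_le[OF p(1)] by (simp add: dist_norm)
    finally show ?thesis using p D(1) r(1)[of p] by (intro bexI[of _ p]) auto
  qed
  show ?thesis
  proof (rule that[OF \<eta>])
    fix q q' assume q: "q \<in> K" "q' \<in> topspace X" "norm (i q - i q') < \<eta>"
    then obtain p where p: "p \<in> K" "i q \<in> ball (i p) (r p)" "i q' \<in> ball (i p) (r p)" using * by blast
    show "induced_dist X i q q' \<le> ennreal (2 * norm (i q - i q'))" using r(2)[OF p(1) _ q(2) p(2,3)] q(1) KX by blast
    show "induced_dist X i q' q \<le> ennreal (2 * norm (i q - i q'))" using r(2)[OF p(1) q(2) _ p(3,2)] q(1) KX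
      by (auto simp: norm_minus_commute)
  qed
qed

lemma induced_dist_chain:
  assumes "\<And>j. j < n \<Longrightarrow> induced_dist X i (q j) (q (Suc j)) \<le> ennreal (a j)" "\<And>j. j < n \<Longrightarrow> a j \<ge> 0" "q 0 \<in> topspace X"
  shows "induced_dist X i (q 0) (q n) \<le> ennreal (\<Sum>j<n. a j)"
  using assms
proof (induction n)
  case 0 then show ?case by (simp add: induced_dist_refl)
next
  case (Suc n)
  have "induced_dist X i (q 0) (q (Suc n)) \<le> induced_dist X i (q 0) (q n) + induced_dist X i (q n) (q (Suc n))"
    by (rule induced_dist_triangle)
  also have "\<dots> \<le> ennreal (\<Sum>j<n. a j) + ennreal (a n)"
    using Suc by (intro add_mono) auto
  also have "\<dots> = ennreal (\<Sum>j<Suc n. a j)"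
    using Suc.prems(2) by (subst ennreal_plus[symmetric]) (auto intro!: sum_nonneg)
  finally show ?case .
qed

end

section \<open>Interior cones for \<open>C\<^sup>1\<close> domains\<close>

lemma C1_locally_Lipschitz:
  fixes h :: "real \<Rightarrow> real"
  assumes "h C1_differentiable_on UNIV"
  obtains L where "L \<ge> 0" "\<And>x y. x \<in> {-r..r} \<Longrightarrow> y \<in> {-r..r} \<Longrightarrow> \<bar>h x - h y\<bar> \<le> L * \<bar>x - y\<bar>"
proof -
  obtain D where D: "\<And>x. (h has_vector_derivative D x) (at x)" "continuous_on UNIV D"
    using assms by (auto simp: C1_differentiable_on_def)
  have "bounded (D ` {-r..r})"
    using D(2) by (intro compact_imp_bounded compact_continuous_image) (auto intro: continuous_on_subset)
  then obtain L where L: "\<And>x. x \<in> {-r..r} \<Longrightarrow> \<bar>D x\<bar> \<le> L"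
    unfolding bounded_iff by (metis image_eqI real_norm_def)
  show ?thesis
  proof (rule that[of "max L 0"])
    fix x y assume xy: "x \<in> {-r..r}" "y \<in> {-r..r}"
    have "norm (h x - h y) \<le> max L 0 * norm (x - y)"
    proof (rule field_differentiable_bound[where f'=D and S="{-r..r}"])
      show "(h has_field_derivative D z) (at z within {-r..r})" for z
        using D(1)[of z] by (simp add: has_real_derivative_iff_has_vector_derivative has_vector_derivative_at_within)
      show "norm (D z) \<le> max L 0" if "z \<in> {-r..r}" for z using L[OF that] by simp
    qed (use xy in auto)
    then show "\<bar>h x - h y\<bar> \<le> max L 0 * \<bar>x - y\<bar>" by simp
  qed simp
qed

text \<open>In rotated coordinates the domain lies above the graph of a function with local
  Lipschitz constant \<open>L\<close>. Moving upwards by \<open>R\<close> with an error below c R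
  gains height at least R (1 - c - L c) = R/2 over the graph, and proportionally along the way. So
  the segments stay inside, and their end points lie in one compact set whatever the starting point.
  At an interior point a ball does the same.\<close>

lemma C1_boundary_cone:
  assumes S: "open S" "C1_boundary S" and z0: "z0 \<in> closure S"
  obtains \<nu> :: complex and c \<rho> :: real where "norm \<nu> = 1" "c > 0" "c \<le> 1" "\<rho> > 0"
    "\<And>R. 0 < R \<Longrightarrow> R < \<rho> \<Longrightarrow> \<exists>K. compact K \<and> K \<subseteq> S \<and>
      (\<forall>\<zeta>\<in>S \<inter> ball z0 \<rho>. \<forall>w\<in>ball (R *\<^sub>R \<nu>) (c * R). (\<forall>t\<in>{0..1}. \<zeta> + t *\<^sub>R w \<in> S) \<and> \<zeta> + w \<in> K)"
proof (cases "z0 \<in> S")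
  case True
  then obtain r where r: "r > 0" "ball z0 r \<subseteq> S" using S(1) open_contains_ball by blast
  \<comment> \<open>The displacements have length at most twice \<rho>, so the segments stay within
    3/4 of the radius \<open>r\<close> around \<open>z0\<close>.\<close>
  define \<rho> where "\<rho> = r / 4"
  have "\<exists>K. compact K \<and> K \<subseteq> S \<and>
      (\<forall>\<zeta>\<in>S \<inter> ball z0 \<rho>. \<forall>w\<in>ball (R *\<^sub>R (1::complex)) (1 * R). (\<forall>t\<in>{0..1}. \<zeta> + t *\<^sub>R w \<in> S) \<and> \<zeta> + w \<in> K)"
    if R: "0 < R" "R < \<rho>" for R
  proof (intro exI conjI ballI)
    show "compact (cball z0 (3 * \<rho>))" by simp
    show "cball z0 (3 * \<rho>) \<subseteq> S" using r by (auto simp: \<rho>_def)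
    fix \<zeta> w assume z: "\<zeta> \<in> S \<inter> ball z0 \<rho>" "w \<in> ball (R *\<^sub>R (1::complex)) (1 * R)"
    have w: "norm w \<le> 2 * \<rho>"
      using z(2) R norm_triangle_ineq2[of w "complex_of_real R"] by (auto simp: dist_norm norm_minus_commute scaleR_conv_of_real)
    have t: "\<zeta> + t *\<^sub>R w \<in> cball z0 (3 * \<rho>)" if "t \<in> {0..1}" for t
    proof -
      have "norm (t *\<^sub>R w) \<le> norm w" using that by (simp add: mult_left_le_one_le)
      then have "norm (\<zeta> - z0 + t *\<^sub>R w) \<le> 3 * \<rho>"
        using z(1) w norm_triangle_ineq[of "\<zeta> - z0" "t *\<^sub>R w"] by (auto simp: dist_norm norm_minus_commute)
      then show ?thesis by (simp add: dist_norm norm_minus_commute algebra_simps)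
    qed
    show "\<zeta> + w \<in> cball z0 (3 * \<rho>)" using t[of 1] by simp
    show "\<zeta> + t *\<^sub>R w \<in> S" if "t \<in> {0..1}" for t
      using t[OF that] r by (auto simp: \<rho>_def)
  qed
  then show ?thesis using r(1) by (intro that[of 1 1 \<rho>]) (auto simp: \<rho>_def)
next
  case False
  then have "z0 \<in> frontier S" using z0 S(1) by (simp add: frontier_def interior_open)
  then obtain a r h where a: "norm a = 1" "r > 0" "(h :: real \<Rightarrow> real) C1_differentiable_on UNIV"
    "\<And>z. z \<in> ball z0 r \<Longrightarrow> z \<in> S \<longleftrightarrow> Im (a * (z - z0)) > h (Re (a * (z - z0)))"
    using S(2) unfolding C1_boundary_def by blast
  obtain L where L: "L \<ge> 0" "\<And>x y. x \<in> {-r..r} \<Longrightarrow> y \<in> {-r..r} \<Longrightarrow> \<bar>h x - h y\<bar> \<le> L * \<bar>x - y\<bar>"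
    using C1_locally_Lipschitz[OF a(3)] by blast
  \<comment> \<open>Multiplication by \<open>a\<close> sends \<nu> to the imaginary unit, the
    direction into the epigraph.\<close>
  define \<nu> where "\<nu> = \<i> / a"
  define c where "c = 1 / (2 * (1 + L))"
  define \<rho> where "\<rho> = r / 4"
  have \<nu>: "norm \<nu> = 1" using a(1) by (simp add: \<nu>_def norm_divide)
  have c: "c > 0" "c \<le> 1 / 2" "c + L * c = 1 / 2"
    using L(1) by (auto simp: c_def field_simps)
  \<comment> \<open>The height over the boundary graph.\<close>
  define H where "H z = Im (a * (z - z0)) - h (Re (a * (z - z0)))" for z
  have in_S: "z \<in> S \<longleftrightarrow> H z > 0" if "z \<in> ball z0 r" for z
    using a(4)[OF that] by (simp add: H_def)
  have h_cont: "continuous_on UNIV h" using a(3) C1_differentiable_imp_continuous_on by blast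
  have H_cont: "continuous_on UNIV H"
    unfolding H_def by (intro continuous_intros continuous_on_compose2[OF h_cont]) auto
  have "\<exists>K. compact K \<and> K \<subseteq> S \<and>
      (\<forall>\<zeta>\<in>S \<inter> ball z0 \<rho>. \<forall>w\<in>ball (R *\<^sub>R \<nu>) (c * R). (\<forall>t\<in>{0..1}. \<zeta> + t *\<^sub>R w \<in> S) \<and> \<zeta> + w \<in> K)"
    if R: "0 < R" "R < \<rho>" for R
  proof (intro exI conjI ballI)
    define K where "K = cball z0 (3 * \<rho>) \<inter> H -` {R / 2..}"
    show "compact K"
      unfolding K_def using H_cont by (intro compact_Int_closed closed_vimage) auto
    have ball_r: "cball z0 (3 * \<rho>) \<subseteq> ball z0 r" using a(2) by (auto simp: \<rho>_def)
    show "K \<subseteq> S" using R(1) ball_r in_S by (auto simp: K_def)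
    fix \<zeta> w assume z: "\<zeta> \<in> S \<inter> ball z0 \<rho>" "w \<in> ball (R *\<^sub>R \<nu>) (c * R)"
    have "\<zeta> \<in> ball z0 r" using z(1) a(2) by (auto simp: \<rho>_def)
    then have H\<zeta>: "H \<zeta> > 0" using z(1) in_S by auto
    define e where "e = w - R *\<^sub>R \<nu>"
    have e: "norm e < c * R" using z(2) by (simp add: e_def dist_norm norm_minus_commute)
    have cR: "c * R \<le> R" using c R(1) by (simp add: mult_left_le_one_le)
    have w: "norm w \<le> 2 * \<rho>"
    proof -
      have "norm w \<le> norm (R *\<^sub>R \<nu>) + norm e"
        using norm_triangle_ineq[of "R *\<^sub>R \<nu>" e] by (simp add: e_def)
      also have "\<dots> = R + norm e" using R(1) \<nu> by simp
      also have "\<dots> \<le> 2 * \<rho>" using order_less_le_trans[OF e cR] R by linarith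
      finally show ?thesis .
    qed
    have aw: "a * w = \<i> * R + a * e"
      using a(1) by (auto simp: e_def \<nu>_def scaleR_conv_of_real field_simps)
    have ae: "\<bar>Re (a * e)\<bar> \<le> c * R" "\<bar>Im (a * e)\<bar> \<le> c * R"
      using abs_Re_le_cmod[of "a * e"] abs_Im_le_cmod[of "a * e"] e a(1) by (auto simp: norm_mult)
    have t: "\<zeta> + t *\<^sub>R w \<in> cball z0 (3 * \<rho>) \<and> H (\<zeta> + t *\<^sub>R w) \<ge> H \<zeta> + t * (R / 2)" if t: "t \<in> {0..1}" for t
    proof
      have "norm (t *\<^sub>R w) \<le> norm w" using t by (simp add: mult_left_le_one_le)
      then have n: "norm (\<zeta> - z0 + t *\<^sub>R w) \<le> 3 * \<rho>"
        using z(1) w norm_triangle_ineq[of "\<zeta> - z0" "t *\<^sub>R w"] by (auto simp: dist_norm norm_minus_commute)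
      then show "\<zeta> + t *\<^sub>R w \<in> cball z0 (3 * \<rho>)" by (simp add: dist_norm norm_minus_commute algebra_simps)
      define x where "x = Re (a * (\<zeta> - z0))"
      define y where "y = Re (a * (\<zeta> + t *\<^sub>R w - z0))"
      have yx: "y - x = t * Re (a * e)"
      proof -
        have "a * (\<zeta> + t *\<^sub>R w - z0) = a * (\<zeta> - z0) + t *\<^sub>R (a * w)"
          by (simp add: algebra_simps)
        then show ?thesis by (simp add: x_def y_def aw)
      qed
      have im: "Im (a * (\<zeta> + t *\<^sub>R w - z0)) - Im (a * (\<zeta> - z0)) = t * (R + Im (a * e))"
      proof -
        have "a * (\<zeta> + t *\<^sub>R w - z0) = a * (\<zeta> - z0) + t *\<^sub>R (a * w)"
          by (simp add: algebra_simps)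
        then show ?thesis by (simp add: aw)
      qed
      have "\<bar>x\<bar> \<le> r" "\<bar>y\<bar> \<le> r"
      proof -
        have "\<bar>x\<bar> \<le> norm (a * (\<zeta> - z0))" "\<bar>y\<bar> \<le> norm (a * (\<zeta> + t *\<^sub>R w - z0))"
          unfolding x_def y_def by (rule abs_Re_le_cmod)+
        moreover have "norm (\<zeta> - z0) \<le> r" "norm (\<zeta> + t *\<^sub>R w - z0) \<le> r"
          using z(1) n a(2) by (auto simp: \<rho>_def dist_norm norm_minus_commute algebra_simps)
        ultimately show "\<bar>x\<bar> \<le> r" "\<bar>y\<bar> \<le> r" by (simp_all add: norm_mult a(1))
      qed
      then have "\<bar>h y - h x\<bar> \<le> L * \<bar>y - x\<bar>" by (intro L(2)) (simp_all add: abs_le_iff)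
      then have "h y - h x \<le> L * \<bar>y - x\<bar>" by (rule order_trans[OF abs_ge_self])
      also have "\<dots> \<le> L * (t * (c * R))"
        unfolding yx using t ae(1) L(1) by (intro mult_left_mono) (auto simp: abs_mult mult_left_mono)
      finally have hy: "h y - h x \<le> L * (t * (c * R))" .
      have "t * Im (a * e) \<ge> - (t * (c * R))"
        using mult_left_mono[of "- (c * R)" "Im (a * e)" t] ae(2) t by auto
      then have "H (\<zeta> + t *\<^sub>R w) - H \<zeta> \<ge> t * R - t * (c * R) - L * (t * (c * R))"
        using im hy by (simp add: H_def x_def y_def algebra_simps)
      moreover have "t * R - t * (c * R) - L * (t * (c * R)) = t * R * (1 - (c + L * c))"
        by (simp add: algebra_simps)
      ultimately show "H (\<zeta> + t *\<^sub>R w) \<ge> H \<zeta> + t * (R / 2)" using c(3) by simp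
    qed
    show "\<zeta> + w \<in> K" using t[of 1] H\<zeta> by (simp add: K_def)
    fix s :: real assume s: "s \<in> {0..1}"
    have "0 \<le> s * (R / 2)" using s R(1) by simp
    then have "H (\<zeta> + s *\<^sub>R w) > 0" using conjunct2[OF t[OF s]] H\<zeta> by linarith
    then show "\<zeta> + s *\<^sub>R w \<in> S" using t[OF s] ball_r in_S by auto
  qed
  then show ?thesis using a(2) c \<nu> by (intro that[of \<nu> c \<rho>]) (auto simp: \<rho>_def)
qed

section \<open>Uniform closeness of Sobolev maps\<close>

text \<open>If the sum were at least \<open>C\<close> for all pairs, so would be its mean, yet the
  three means add up to less. The choice is joint because one segment has to serve both maps and the
  gap at its end point.\<close>

lemma average_selection:
  fixes H1 H2 H3 :: "complex \<Rightarrow> complex \<Rightarrow> ennreal"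
  assumes meas: "case_prod H1 \<in> borel_measurable (lborel \<Otimes>\<^sub>M lborel)" "case_prod H2 \<in> borel_measurable (lborel \<Otimes>\<^sub>M lborel)"
      "case_prod H3 \<in> borel_measurable (lborel \<Otimes>\<^sub>M lborel)"
    and U[measurable]: "U \<in> sets borel" and V[measurable]: "V \<in> sets borel"
    and UV: "emeasure lborel V * emeasure lborel U = ennreal M" "M > 0"
    and b: "(\<integral>\<^sup>+v\<in>V. (\<integral>\<^sup>+x\<in>U. H1 v x \<partial>lborel) \<partial>lborel) \<le> ennreal b1 * ennreal M"
      "(\<integral>\<^sup>+v\<in>V. (\<integral>\<^sup>+x\<in>U. H2 v x \<partial>lborel) \<partial>lborel) \<le> ennreal b2 * ennreal M"
      "(\<integral>\<^sup>+v\<in>V. (\<integral>\<^sup>+x\<in>U. H3 v x \<partial>lborel) \<partial>lborel) \<le> ennreal b3 * ennreal M"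
    and b0: "b1 \<ge> 0" "b2 \<ge> 0" "b3 \<ge> 0" "b1 + b2 + b3 < C"
  obtains v x where "v \<in> V" "x \<in> U" "H1 v x + H2 v x + H3 v x < ennreal C"
proof -
  have "\<exists>v\<in>V. \<exists>x\<in>U. H1 v x + H2 v x + H3 v x < ennreal C"
  proof (rule ccontr)
    assume "\<not> (\<exists>v\<in>V. \<exists>x\<in>U. H1 v x + H2 v x + H3 v x < ennreal C)"
    then have ge: "ennreal C \<le> H1 v x + H2 v x + H3 v x" if "v \<in> V" "x \<in> U" for v x
      using that by (meson not_le)
    have m1[measurable]: "(\<lambda>x. H1 v x) \<in> borel_measurable lborel" "(\<lambda>x. H2 v x) \<in> borel_measurable lborel"
      "(\<lambda>x. H3 v x) \<in> borel_measurable lborel" for v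
      using measurable_Pair2[OF meas(1), of v] measurable_Pair2[OF meas(2), of v] measurable_Pair2[OF meas(3), of v] by simp_all
    have m2: "(\<lambda>v. \<integral>\<^sup>+x\<in>U. H v x \<partial>lborel) \<in> borel_measurable lborel"
      if [measurable]: "case_prod H \<in> borel_measurable (lborel \<Otimes>\<^sub>M lborel)" for H :: "complex \<Rightarrow> complex \<Rightarrow> ennreal"
      by measurable
    note m2' = m2[OF meas(1)] m2[OF meas(2)] m2[OF meas(3)]
    have add3: "(\<integral>\<^sup>+v. f v * indicator V v + g v * indicator V v + h v * indicator V v \<partial>lborel) =
      (\<integral>\<^sup>+v\<in>V. f v \<partial>lborel) + (\<integral>\<^sup>+v\<in>V. g v \<partial>lborel) + (\<integral>\<^sup>+v\<in>V. h v \<partial>lborel)"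
      if [measurable]: "f \<in> borel_measurable lborel" "g \<in> borel_measurable lborel" "h \<in> borel_measurable lborel"
      for f g h :: "complex \<Rightarrow> ennreal"
      by (subst nn_integral_add, measurable)+
    have "ennreal C * ennreal M = (\<integral>\<^sup>+v\<in>V. (\<integral>\<^sup>+x\<in>U. ennreal C \<partial>lborel) \<partial>lborel)"
    proof -
      have "(\<integral>\<^sup>+x\<in>U. ennreal C \<partial>lborel) = ennreal C * emeasure lborel U"
        by (rule nn_integral_cmult_indicator) simp
      then have "(\<integral>\<^sup>+v\<in>V. (\<integral>\<^sup>+x\<in>U. ennreal C \<partial>lborel) \<partial>lborel) = ennreal C * emeasure lborel U * emeasure lborel V"
        by (simp only:) (rule nn_integral_cmult_indicator, simp)
      then show ?thesis using UV(1) by (simp add: mult_ac)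
    qed
    also have "\<dots> \<le> (\<integral>\<^sup>+v\<in>V. (\<integral>\<^sup>+x\<in>U. (H1 v x + H2 v x + H3 v x) \<partial>lborel) \<partial>lborel)"
    proof (intro nn_integral_mono)
      fix v
      show "(\<integral>\<^sup>+x\<in>U. ennreal C \<partial>lborel) * indicator V v \<le> (\<integral>\<^sup>+x\<in>U. (H1 v x + H2 v x + H3 v x) \<partial>lborel) * indicator V v"
      proof (cases "v \<in> V")
        case True
        have "(\<integral>\<^sup>+x\<in>U. ennreal C \<partial>lborel) \<le> (\<integral>\<^sup>+x\<in>U. (H1 v x + H2 v x + H3 v x) \<partial>lborel)"
          by (rule nn_integral_mono) (auto simp: indicator_def intro: ge[OF True])
        then show ?thesis by (rule mult_right_mono) simp
      qed simp
    qed
    also have "\<dots> = (\<integral>\<^sup>+v. (\<integral>\<^sup>+x\<in>U. H1 v x \<partial>lborel) * indicator V v + (\<integral>\<^sup>+x\<in>U. H2 v x \<partial>lborel) * indicator V v + (\<integral>\<^sup>+x\<in>U. H3 v x \<partial>lborel) * indicator V v \<partial>lborel)"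
    proof (rule nn_integral_cong)
      fix v
      have "(\<integral>\<^sup>+x\<in>U. (H1 v x + H2 v x + H3 v x) \<partial>lborel) = (\<integral>\<^sup>+x\<in>U. H1 v x \<partial>lborel) + (\<integral>\<^sup>+x\<in>U. H2 v x \<partial>lborel) + (\<integral>\<^sup>+x\<in>U. H3 v x \<partial>lborel)"
        unfolding distrib_right by (subst nn_integral_add, measurable)+
      then show "(\<integral>\<^sup>+x\<in>U. (H1 v x + H2 v x + H3 v x) \<partial>lborel) * indicator V v =
        (\<integral>\<^sup>+x\<in>U. H1 v x \<partial>lborel) * indicator V v + (\<integral>\<^sup>+x\<in>U. H2 v x \<partial>lborel) * indicator V v + (\<integral>\<^sup>+x\<in>U. H3 v x \<partial>lborel) * indicator V v"
        by (simp only: distrib_right)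
    qed
    also have "\<dots> = (\<integral>\<^sup>+v\<in>V. (\<integral>\<^sup>+x\<in>U. H1 v x \<partial>lborel) \<partial>lborel) + (\<integral>\<^sup>+v\<in>V. (\<integral>\<^sup>+x\<in>U. H2 v x \<partial>lborel) \<partial>lborel) + (\<integral>\<^sup>+v\<in>V. (\<integral>\<^sup>+x\<in>U. H3 v x \<partial>lborel) \<partial>lborel)"
      by (rule add3[OF m2'])
    also have "\<dots> \<le> ennreal b1 * ennreal M + ennreal b2 * ennreal M + ennreal b3 * ennreal M"
      by (intro add_mono b)
    also have "\<dots> = ennreal ((b1 + b2 + b3) * M)"
      using b0 UV(2) by (simp add: ennreal_mult[symmetric] ennreal_plus[symmetric] distrib_right del: ennreal_plus)
    finally have "ennreal (C * M) \<le> ennreal ((b1 + b2 + b3) * M)"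
      using b0 UV(2) by (simp add: ennreal_mult[symmetric])
    then have "C * M \<le> (b1 + b2 + b3) * M" using b0 UV(2) by (subst (asm) ennreal_le_iff) auto
    then show False using b0(4) UV(2) by simp
  qed
  then show ?thesis using that by blast
qed

text \<open>Young's inequality at a constant level \<open>l\<close>; for fixed \<open>x\<close>,
  translation turns the integral over directions into a global one. Once \<open>l\<close> is fixed,
  the second term is small together with \<open>D\<close>.\<close>

lemma average_end_value:
  fixes d :: "complex \<Rightarrow> real"
  assumes [measurable]: "d \<in> borel_measurable borel" "U \<in> sets borel" "V \<in> sets borel"
    and d: "\<And>y. d y \<ge> 0" and l: "l > 0" and p: "p > 1" and m: "emeasure lborel V = ennreal m" "m > 0"
    and D: "(\<integral>\<^sup>+y. ennreal (d y powr p) \<partial>lborel) \<le> ennreal D" "D \<ge> 0"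
  shows "(\<integral>\<^sup>+v\<in>V. (\<integral>\<^sup>+x\<in>U. ennreal (d (x + v)) \<partial>lborel) \<partial>lborel) \<le>
    ennreal (l + l powr (1 - p) * D / m) * (emeasure lborel V * emeasure lborel U)"
proof -
  have "(\<integral>\<^sup>+v\<in>V. (\<integral>\<^sup>+x\<in>U. ennreal (d (x + v)) \<partial>lborel) \<partial>lborel) =
      (\<integral>\<^sup>+v. (\<integral>\<^sup>+x. ennreal (d (x + v)) * indicator U x * indicator V v \<partial>lborel) \<partial>lborel)"
    by (intro nn_integral_cong nn_integral_multc[symmetric]) measurable
  also have "\<dots> = (\<integral>\<^sup>+x. (\<integral>\<^sup>+v. ennreal (d (x + v)) * indicator U x * indicator V v \<partial>lborel) \<partial>lborel)"
    by (rule lborel_pair.Fubini') measurable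
  also have "\<dots> \<le> (\<integral>\<^sup>+x. ennreal (l * m + l powr (1 - p) * D) * indicator U x \<partial>lborel)"
  proof (rule nn_integral_mono)
    fix x
    have "(\<integral>\<^sup>+v. ennreal (d (x + v)) * indicator U x * indicator V v \<partial>lborel) \<le>
      (\<integral>\<^sup>+v. (ennreal l * indicator V v + ennreal (l powr (1 - p)) * ennreal (d (v + x) powr p)) * indicator U x \<partial>lborel)"
    proof (rule nn_integral_mono)
      fix v
      have "ennreal (d (x + v)) \<le> ennreal l + ennreal (l powr (1 - p)) * ennreal (d (v + x) powr p)"
        using le_add_powr[OF d l, of p "x + v"] p l
        by (simp add: ennreal_mult[symmetric] ennreal_plus[symmetric] ennreal_leI add.commute del: ennreal_plus)
      then show "ennreal (d (x + v)) * indicator U x * indicator V v \<le>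
        (ennreal l * indicator V v + ennreal (l powr (1 - p)) * ennreal (d (v + x) powr p)) * indicator U x"
        by (auto simp: indicator_def)
    qed
    also have "\<dots> = (\<integral>\<^sup>+v. ennreal l * indicator V v + ennreal (l powr (1 - p)) * ennreal (d (v + x) powr p) \<partial>lborel) * indicator U x"
      by (rule nn_integral_multc) measurable
    also have "(\<integral>\<^sup>+v. ennreal l * indicator V v + ennreal (l powr (1 - p)) * ennreal (d (v + x) powr p) \<partial>lborel) =
      ennreal l * emeasure lborel V + ennreal (l powr (1 - p)) * (\<integral>\<^sup>+v. ennreal (d (v + x) powr p) \<partial>lborel)"
      by (subst nn_integral_add) (auto simp: nn_integral_cmult)
    also have "(\<integral>\<^sup>+v. ennreal (d (v + x) powr p) \<partial>lborel) = (\<integral>\<^sup>+y. ennreal (d y powr p) \<partial>lborel)"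
      by (rule nn_integral_translate[of "\<lambda>y. ennreal (d y powr p)"]) measurable
    also have "ennreal l * emeasure lborel V + ennreal (l powr (1 - p)) * (\<integral>\<^sup>+y. ennreal (d y powr p) \<partial>lborel) \<le>
        ennreal l * ennreal m + ennreal (l powr (1 - p)) * ennreal D"
      unfolding m(1) by (intro add_mono mult_left_mono D) auto
    also have "\<dots> = ennreal (l * m + l powr (1 - p) * D)"
      using l m(2) D(2) by (simp add: ennreal_mult[symmetric] ennreal_plus[symmetric] del: ennreal_plus)
    finally show "(\<integral>\<^sup>+v. ennreal (d (x + v)) * indicator U x * indicator V v \<partial>lborel) \<le>
        ennreal (l * m + l powr (1 - p) * D) * indicator U x"
      by (simp add: mult_right_mono)
  qed
  also have "\<dots> = ennreal (l * m + l powr (1 - p) * D) * emeasure lborel U"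
    by (rule nn_integral_cmult_indicator) simp
  also have "l * m + l powr (1 - p) * D = (l + l powr (1 - p) * D / m) * m"
    using m(2) by (simp add: distrib_right)
  also have "ennreal \<dots> = ennreal (l + l powr (1 - p) * D / m) * ennreal m"
    using l m(2) D(2) by (intro ennreal_mult) auto
  finally show ?thesis by (simp add: m(1) mult.assoc)
qed

text \<open>Averaging over \<open>x\<close> as well as over \<open>v\<close> avoids choosing representatives of the weak derivatives on
  segments. A large weight \<open>\<Lambda>\<close> forces the values at \<open>x + v\<close> to be very close.\<close>

lemma segment_selection:
  fixes u u' :: "complex \<Rightarrow> 'b::euclidean_space"
  assumes S: "open S" and p: "p > 2"
    and u: "u \<in> W1p p S" "continuous_on S u" and u': "u' \<in> W1p p S" "continuous_on S u'"
    and U: "open U" and V: "V \<in> sets borel"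
    and \<mu>: "emeasure lborel U = ennreal mU" "mU > 0" "emeasure lborel V = ennreal m" "m > 0"
    and K: "compact K" "K \<subseteq> S"
    and in_K: "\<And>x v t. x \<in> U \<Longrightarrow> v \<in> V \<Longrightarrow> t \<in> {0..1} \<Longrightarrow> x + t *\<^sub>R v \<in> K" and n: "n > 0"
    and \<rho>: "\<And>v. v \<in> V \<Longrightarrow> norm v \<le> \<rho>" "\<rho> \<ge> 0" and lam: "lam > 0" and l: "l > 0" and \<Lambda>: "\<Lambda> \<ge> 0"
    and M: "2 powr p * W1p_norm p S u powr p \<le> M" "2 powr p * W1p_norm p S u' powr p \<le> M"
    and C: "2 * (\<rho> * (p / (p - 2)) * (lam + lam powr (1 - p) * M / m)) +
      \<Lambda> * (l + l powr (1 - p) * W1p_norm p S (\<lambda>x. u' x - u x) powr p / m) < C"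
  obtains x v where "x \<in> U" "v \<in> V"
    "(\<Sum>j<n. norm (u (x + (Suc j / n) *\<^sub>R v) - u (x + (j / n) *\<^sub>R v))) +
     (\<Sum>j<n. norm (u' (x + (Suc j / n) *\<^sub>R v) - u' (x + (j / n) *\<^sub>R v))) +
     \<Lambda> * norm (u' (x + v) - u (x + v)) < C"
proof -
  have p1: "p \<ge> 1" using p by simp
  have Kb[measurable]: "K \<in> sets borel" using K(1) by (rule borel_compact)
  have Ub[measurable]: "U \<in> sets borel" using U by simp
  note V[measurable]
  have M0: "M \<ge> 0" using M(1) by (smt (verit) mult_nonneg_nonneg powr_ge_zero)
  define b where "b = \<rho> * (p / (p - 2)) * (lam + lam powr (1 - p) * M / m)"
  have b0: "b \<ge> 0" using \<rho>(2) p lam M0 \<mu>(4) by (simp add: b_def)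
  have diff: "(\<lambda>x. u' x - u x) \<in> W1p p S" using W1p_linear(1)[OF S p1 u'(1) u(1), of 1 "-1"] by simp
  define D where "D = W1p_norm p S (\<lambda>x. u' x - u x) powr p"
  \<comment> \<open>Borel versions on the whole plane give measurability in both variables; on the
    segments considered they agree with the original functions.\<close>
  define cut where "cut f x = indicator K x *\<^sub>R f x" for f :: "complex \<Rightarrow> 'b" and x
  define poly where "poly f v x = (\<Sum>j<n. norm (f (x + (Suc j / n) *\<^sub>R v) - f (x + (j / n) *\<^sub>R v)))" for f :: "complex \<Rightarrow> 'b" and v x
  have cutm: "cut f \<in> borel_measurable borel" if "continuous_on S f" for f
    unfolding cut_def[abs_def] using Kb continuous_on_subset[OF that K(2)] by (rule borel_measurable_continuous_on_indicator)
  have [measurable]: "cut u \<in> borel_measurable borel" "cut u' \<in> borel_measurable borel" using cutm u(2) u'(2) by auto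
  have cut_eq: "cut f (x + t *\<^sub>R v) = f (x + t *\<^sub>R v)" if "x \<in> U" "v \<in> V" "t \<in> {0..1}" for f x v t
    using in_K[OF that] by (simp add: cut_def)
  have j01: "real j / n \<in> {0..1}" if "j \<le> n" for j using that n by (auto simp: divide_le_eq)
  have poly_eq: "poly (cut f) v x = poly f v x" if "x \<in> U" "v \<in> V" for f v x
    unfolding poly_def using cut_eq[OF that] j01 by (intro sum.cong refl) (simp add: Suc_le_eq del: of_nat_Suc)
  have pm: "case_prod (\<lambda>v x. ennreal (poly f v x)) \<in> borel_measurable (lborel \<Otimes>\<^sub>M lborel)"
    if [measurable]: "f \<in> borel_measurable borel" for f
    unfolding poly_def by measurable
  have poly_bound: "(\<integral>\<^sup>+v\<in>V. (\<integral>\<^sup>+x\<in>U. ennreal (poly (cut f) v x) \<partial>lborel) \<partial>lborel) \<le> ennreal b * ennreal (m * mU)"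
    if f: "f \<in> W1p p S" "continuous_on S f" "2 powr p * W1p_norm p S f powr p \<le> M" for f
  proof -
    obtain w1 w2 where w: "w1 \<in> borel_measurable borel" "w2 \<in> borel_measurable borel"
      "is_weak_partial S f 1 w1" "is_weak_partial S f \<i> w2"
      "(\<integral>\<^sup>+y. ennreal ((norm (w1 y) + norm (w2 y)) powr p) \<partial>lborel) \<le> ennreal (2 powr p * W1p_norm p S f powr p)"
      using W1p_borel_partials[OF S p1 f(1)] by blast
    have "(\<integral>\<^sup>+v\<in>V. (\<integral>\<^sup>+x\<in>U. ennreal (poly (cut f) v x) \<partial>lborel) \<partial>lborel) =
      (\<integral>\<^sup>+v\<in>V. (\<integral>\<^sup>+x\<in>U. ennreal (poly f v x) \<partial>lborel) \<partial>lborel)"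
    proof (rule nn_integral_cong)
      fix v
      show "(\<integral>\<^sup>+x\<in>U. ennreal (poly (cut f) v x) \<partial>lborel) * indicator V v = (\<integral>\<^sup>+x\<in>U. ennreal (poly f v x) \<partial>lborel) * indicator V v"
      proof (cases "v \<in> V")
        case True
        have "(\<integral>\<^sup>+x\<in>U. ennreal (poly (cut f) v x) \<partial>lborel) = (\<integral>\<^sup>+x\<in>U. ennreal (poly f v x) \<partial>lborel)"
          by (rule nn_integral_cong) (auto simp: indicator_def poly_eq[OF _ True])
        then show ?thesis by simp
      qed simp
    qed
    also have "\<dots> \<le> ennreal (\<rho> * (p / (p - 2))) * (ennreal lam * emeasure lborel V +
      ennreal (lam powr (1 - p)) * (\<integral>\<^sup>+y. ennreal ((norm (w1 y) + norm (w2 y)) powr p) \<partial>lborel)) * emeasure lborel U"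
      unfolding poly_def by (rule averaged_subdivision_bound[OF S w(3,4,1,2) f(2) U K in_K n V \<rho>(1) p lam])
    also have "\<dots> \<le> ennreal (\<rho> * (p / (p - 2))) * (ennreal lam * ennreal m + ennreal (lam powr (1 - p)) * ennreal M) * ennreal mU"
      unfolding \<mu>(1,3) using order_trans[OF w(5) ennreal_leI[OF f(3)]]
      by (intro mult_right_mono mult_left_mono add_left_mono) auto
    also have "\<dots> = ennreal (\<rho> * (p / (p - 2)) * (lam * m + lam powr (1 - p) * M) * mU)"
      using \<rho>(2) p lam M0 \<mu>(2,4) by (simp add: ennreal_mult[symmetric] ennreal_plus[symmetric] del: ennreal_plus)
    also have "lam * m + lam powr (1 - p) * M = (lam + lam powr (1 - p) * M / m) * m"
      using \<mu>(4) by (simp add: distrib_right)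
    also have "\<rho> * (p / (p - 2)) * ((lam + lam powr (1 - p) * M / m) * m) * mU = b * (m * mU)"
      unfolding b_def by (simp only: mult.assoc)
    also have "ennreal (b * (m * mU)) = ennreal b * ennreal (m * mU)"
      using b0 \<mu> by (simp add: ennreal_mult)
    finally show ?thesis .
  qed
  have H3: "(\<integral>\<^sup>+v\<in>V. (\<integral>\<^sup>+x\<in>U. ennreal (\<Lambda> * norm (cut u' (x + v) - cut u (x + v))) \<partial>lborel) \<partial>lborel) \<le>
      ennreal (\<Lambda> * (l + l powr (1 - p) * D / m)) * ennreal (m * mU)"
  proof -
    define d where "d y = norm (cut u' y - cut u y)" for y
    have [measurable]: "d \<in> borel_measurable borel" unfolding d_def by measurable
    have out: "d x = 0" if "x \<notin> S" for x using that K(2) by (auto simp: d_def cut_def indicator_def)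
    have "(\<integral>\<^sup>+y. ennreal (d y powr p) \<partial>lborel) \<le> ennreal (\<integral>x. W1p_density p S (\<lambda>x. u' x - u x) x \<partial>lebesgue_on S)"
    proof (rule nn_integral_Borel_extension[OF S])
      show "AE x in lebesgue_on S. d x powr p \<le> W1p_density p S (\<lambda>x. u' x - u x) x"
        by (intro AE_I2) (auto simp: d_def cut_def indicator_def W1p_density_def sum_nonneg)
    qed (use out W1p_norm_eq(1)[OF S p1 diff] in \<open>auto\<close>)
    then have dD: "(\<integral>\<^sup>+y. ennreal (d y powr p) \<partial>lborel) \<le> ennreal D"
      unfolding D_def W1p_norm_eq(3)[OF S p1 diff] .
    have "(\<integral>\<^sup>+v\<in>V. (\<integral>\<^sup>+x\<in>U. ennreal (\<Lambda> * d (x + v)) \<partial>lborel) \<partial>lborel) =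
      (\<integral>\<^sup>+v. ennreal \<Lambda> * ((\<integral>\<^sup>+x\<in>U. ennreal (d (x + v)) \<partial>lborel) * indicator V v) \<partial>lborel)"
    proof (rule nn_integral_cong)
      fix v
      have "(\<integral>\<^sup>+x\<in>U. ennreal (\<Lambda> * d (x + v)) \<partial>lborel) = ennreal \<Lambda> * (\<integral>\<^sup>+x\<in>U. ennreal (d (x + v)) \<partial>lborel)"
        using \<Lambda> by (subst nn_integral_cmult[symmetric]) (auto simp: ennreal_mult d_def mult.assoc)
      then show "(\<integral>\<^sup>+x\<in>U. ennreal (\<Lambda> * d (x + v)) \<partial>lborel) * indicator V v =
        ennreal \<Lambda> * ((\<integral>\<^sup>+x\<in>U. ennreal (d (x + v)) \<partial>lborel) * indicator V v)"
        by (simp add: mult.assoc)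
    qed
    also have "\<dots> = ennreal \<Lambda> * (\<integral>\<^sup>+v\<in>V. (\<integral>\<^sup>+x\<in>U. ennreal (d (x + v)) \<partial>lborel) \<partial>lborel)"
      by (rule nn_integral_cmult) measurable
    also have "\<dots> \<le> ennreal \<Lambda> * (ennreal (l + l powr (1 - p) * D / m) * (emeasure lborel V * emeasure lborel U))"
      using dD p by (intro mult_left_mono average_end_value[OF _ Ub V _ l _ \<mu>(3,4)]) (auto simp: d_def D_def)
    also have "\<dots> = ennreal (\<Lambda> * (l + l powr (1 - p) * D / m)) * ennreal (m * mU)"
      using \<Lambda> l \<mu> by (simp add: ennreal_mult[symmetric] D_def mult.assoc del: ennreal_plus)
    finally show ?thesis by (simp only: d_def)
  qed
  have m3: "case_prod (\<lambda>v x. ennreal (\<Lambda> * norm (cut u' (x + v) - cut u (x + v)))) \<in> borel_measurable (lborel \<Otimes>\<^sub>M lborel)"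
    by measurable
  obtain v x where vx: "v \<in> V" "x \<in> U"
    "ennreal (poly (cut u) v x) + ennreal (poly (cut u') v x) + ennreal (\<Lambda> * norm (cut u' (x + v) - cut u (x + v))) < ennreal C"
  proof (rule average_selection[OF pm pm m3 Ub V _ _ poly_bound[OF u M(1)] poly_bound[OF u' M(2)] H3 b0 b0])
    show "emeasure lborel V * emeasure lborel U = ennreal (m * mU)" using \<mu> by (simp add: ennreal_mult)
    show "m * mU > 0" using \<mu> by simp
    show "0 \<le> \<Lambda> * (l + l powr (1 - p) * D / m)" using \<Lambda> l \<mu> by (simp add: D_def)
    show "b + b + \<Lambda> * (l + l powr (1 - p) * D / m) < C" using C unfolding b_def D_def by simp
  qed auto
  have nn: "poly f v x \<ge> 0" for f v x unfolding poly_def by (simp add: sum_nonneg)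
  have "ennreal (poly u v x + poly u' v x + \<Lambda> * norm (u' (x + v) - u (x + v))) < ennreal C"
    using vx(3) cut_eq[OF vx(2,1), of 1] nn \<Lambda>
    by (simp add: poly_eq[OF vx(2,1)] ennreal_plus[symmetric] del: ennreal_plus)
  then have "poly u v x + poly u' v x + \<Lambda> * norm (u' (x + v) - u (x + v)) < C"
    using nn \<Lambda> by (subst (asm) ennreal_less_iff) auto
  then show ?thesis using vx(1,2) by (intro that[of x v]) (simp_all only: poly_def)
qed

section \<open>Limits and gluing of \<open>J\<close>-holomorphic maps\<close>

lemma weak_derivative_complex:
  "weak_derivative S u x v = Re v *\<^sub>R weak_partial S u 1 x + Im v *\<^sub>R weak_partial S u \<i> x"
  by (simp add: weak_derivative_def Basis_complex_def inner_complex_def)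

lemma tendsto_zero_if_powr_le:
  fixes y :: "nat \<Rightarrow> 'b::real_normed_vector"
  assumes p: "p > 0" and le: "\<And>n. norm (y n) powr p \<le> d n" and d: "d \<longlonglongrightarrow> 0"
  shows "y \<longlonglongrightarrow> 0"
proof (rule Lim_null_comparison)
  have d0: "d n \<ge> 0" for n using le[of n] by (meson order_trans powr_ge_zero)
  show "(\<lambda>n. d n powr (1 / p)) \<longlonglongrightarrow> 0"
    by (rule tendsto_zero_powrI[OF d tendsto_const]) (use p d0 in auto)
  show "\<forall>\<^sub>F n in sequentially. norm (y n) \<le> d n powr (1 / p)"
  proof (rule always_eventually, rule allI)
    fix n
    have "norm (y n) = (norm (y n) powr p) powr (1 / p)" using p by (simp add: powr_powr)
    also have "\<dots> \<le> d n powr (1 / p)" using p le[of n] by (intro powr_mono2) auto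
    finally show "norm (y n) \<le> d n powr (1 / p)" .
  qed
qed

context embedded_manifold
begin

lemma tangent_space_lincomb:
  assumes "v \<in> tangent_space A q" "w \<in> tangent_space A q"
  shows "(\<lambda>c. s *\<^sub>R v c + t *\<^sub>R w c) \<in> tangent_space A q"
  unfolding tangent_space_def mem_Collect_eq
proof (intro conjI allI impI ballI)
  fix c assume "c \<notin> charts_at A q"
  then have "v c = 0" "w c = 0" using assms unfolding tangent_space_def by blast+
  then show "s *\<^sub>R v c + t *\<^sub>R w c = 0" by simp
next
  fix c c' assume c: "c \<in> charts_at A q" "c' \<in> charts_at A q"
  have l: "linear (frechet_derivative (snd c' \<circ> chart_inv c) (at (snd c q)))"
    by (rule has_derivative_linear[OF transition_derivative[OF c]])
  have "v c' = frechet_derivative (snd c' \<circ> chart_inv c) (at (snd c q)) (v c)"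
    "w c' = frechet_derivative (snd c' \<circ> chart_inv c) (at (snd c q)) (w c)"
    using assms c unfolding tangent_space_def by blast+
  then show "s *\<^sub>R v c' + t *\<^sub>R w c' = frechet_derivative (snd c' \<circ> chart_inv c) (at (snd c q)) (s *\<^sub>R v c + t *\<^sub>R w c)"
    by (simp only: linear_add[OF l] linear_cmul[OF l])
qed

lemma differential_at_lincomb:
  assumes q: "q \<in> topspace X" and v: "v \<in> tangent_space A q" and w: "w \<in> tangent_space A q"
  shows "differential_at A i q (\<lambda>c. s *\<^sub>R v c + t *\<^sub>R w c) = s *\<^sub>R differential_at A i q v + t *\<^sub>R differential_at A i q w"
proof -
  obtain c where c: "c \<in> charts_at A q" using charts_at_ex[OF q] by blast
  show ?thesis
    by (simp only: differential_at_eq[OF tangent_space_lincomb[OF v w] c] differential_at_eq[OF v c] differential_at_eq[OF w c]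
      linear_add[OF coord_differential_linear[OF c]] linear_cmul[OF coord_differential_linear[OF c]])
qed

text \<open>Convergence of the norms is L^1 convergence of the densities to 0, so along a
  subsequence the maps and both weak partials converge at almost every point, where
  \<open>J_complex_limit\<close> applies.\<close>

lemma J_holomorphic_limit:
  assumes J: "almost_complex_structure X A J" and S: "open S" and p: "p \<ge> 1"
    and f: "\<And>k. f k \<in> J_holomorphic_maps p S X A J i" and g: "g \<in> W1p_maps p S X i"
    and conv: "(\<lambda>k. W1p_dist p S i (f k) g) \<longlonglongrightarrow> 0"
  shows "g \<in> J_holomorphic_maps p S X A J i"
proof -
  have fW: "f k \<in> W1p_maps p S X i" for k using f by (simp add: J_holomorphic_maps_def)
  note G = W1p_mapsD[OF g] and F = W1p_mapsD[OF fW]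
  define u where "u k \<zeta> = i (f k \<zeta>) - i (g \<zeta>)" for k \<zeta>
  have uW: "u k \<in> W1p p S" for k unfolding u_def[abs_def] by (rule W1p_maps_diff(1)[OF S p F(3) G(3)])
  have "W1p_dist p S i (f k) g = W1p_norm p S (u k)" for k unfolding W1p_dist_def u_def[abs_def] ..
  then have "(\<lambda>k. W1p_norm p S (u k)) \<longlonglongrightarrow> 0" using conv by simp
  then have "(\<lambda>k. W1p_norm p S (u k) powr p) \<longlonglongrightarrow> 0"
    using p by (intro tendsto_zero_powrI[OF _ tendsto_const]) (auto simp: W1p_norm_nonneg)
  then have "(\<lambda>k. \<integral>x. norm (W1p_density p S (u k) x) \<partial>lebesgue_on S) \<longlonglongrightarrow> 0"
    by (simp add: W1p_norm_eq(3)[OF S p uW] W1p_density_nonneg)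
  from tendsto_L1_AE_subseq[OF W1p_norm_eq(1)[OF S p uW] this]
  obtain r where r: "strict_mono r" "AE x in lebesgue_on S. (\<lambda>n. W1p_density p S (u (r n)) x) \<longlonglongrightarrow> 0" by blast
  \<comment> \<open>One null set serves all k, since there are countably many.\<close>
  have df: "AE x in lebesgue_on S. \<forall>k. \<exists>df.
       (\<forall>v. df v \<in> tangent_space A (f k x) \<and>
            differential_at A i (f k x) (df v) = weak_derivative S (i \<circ> f k) x v) \<and>
       (\<forall>v. df (\<i> * v) = J (f k x) (df v))"
    using f by (subst AE_all_countable) (simp add: J_holomorphic_maps_def)
  have B: "(1::complex) \<in> Basis" "\<i> \<in> Basis" by (auto simp: Basis_complex_def)
  have wp: "AE x in lebesgue_on S. \<forall>k. weak_partial S (u k) b x = weak_partial S (i \<circ> f k) b x - weak_partial S (i \<circ> g) b x"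
    if "b \<in> Basis" for b
    unfolding u_def[abs_def] using W1p_maps_diff(2)[OF S p F(3) G(3) that] by (subst AE_all_countable) blast
  have "AE x in lebesgue_on S. \<exists>df.
       (\<forall>v. df v \<in> tangent_space A (g x) \<and>
            differential_at A i (g x) (df v) = weak_derivative S (i \<circ> g) x v) \<and>
       (\<forall>v. df (\<i> * v) = J (g x) (df v))"
    using r(2) df wp[OF B(1)] wp[OF B(2)] AE_space
  proof eventually_elim
    case (elim x)
    have x: "x \<in> S" using elim(5) by simp
    note d0 = elim(1)
    have le: "norm (u (r n) x) powr p \<le> W1p_density p S (u (r n)) x"
      "c \<in> Basis \<Longrightarrow> norm (weak_partial S (u (r n)) c x) powr p \<le> W1p_density p S (u (r n)) x" for n c
    proof -
      show "norm (u (r n) x) powr p \<le> W1p_density p S (u (r n)) x"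
        by (simp add: W1p_density_def sum_nonneg)
      show "norm (weak_partial S (u (r n)) c x) powr p \<le> W1p_density p S (u (r n)) x" if "c \<in> Basis"
        using member_le_sum[of c Basis "\<lambda>b. norm (weak_partial S (u (r n)) b x) powr p"] that
        by (simp add: W1p_density_def add_increasing)
    qed
    have p0: "p > 0" using p by simp
    have c0: "(\<lambda>n. i (f (r n) x)) \<longlonglongrightarrow> i (g x)"
      using tendsto_zero_if_powr_le[OF p0 le(1) d0] by (simp add: u_def LIM_zero_iff)
    have c1: "(\<lambda>n. weak_partial S (i \<circ> f (r n)) b x) \<longlonglongrightarrow> weak_partial S (i \<circ> g) b x" if "b \<in> Basis"
      "\<forall>k. weak_partial S (u k) b x = weak_partial S (i \<circ> f k) b x - weak_partial S (i \<circ> g) b x" for b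
      using tendsto_zero_if_powr_le[OF p0 le(2)[OF that(1)] d0] that(2) by (simp add: LIM_zero_iff)
    obtain df where df: "\<And>k v. df k v \<in> tangent_space A (f k x)"
      "\<And>k v. differential_at A i (f k x) (df k v) = weak_derivative S (i \<circ> f k) x v"
      "\<And>k v. df k (\<i> * v) = J (f k x) (df k v)"
      using elim(2) by metis
    have d1: "(\<lambda>n. differential_at A i (f (r n) x) (df (r n) 1)) \<longlonglongrightarrow> weak_partial S (i \<circ> g) 1 x"
      using c1[OF B(1) elim(3)] by (simp add: df(2) weak_derivative_complex)
    have d2: "(\<lambda>n. differential_at A i (f (r n) x) (J (f (r n) x) (df (r n) 1))) \<longlonglongrightarrow> weak_partial S (i \<circ> g) \<i> x"
      using c1[OF B(2) elim(4)] by (simp add: df(3)[symmetric] df(2) weak_derivative_complex)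
    have qx: "g x \<in> topspace X" by (rule G(4)[OF x])
    obtain a where a: "a \<in> tangent_space A (g x)" "differential_at A i (g x) a = weak_partial S (i \<circ> g) 1 x"
      "differential_at A i (g x) (J (g x) a) = weak_partial S (i \<circ> g) \<i> x"
      by (rule J_complex_limit[OF J qx F(4)[OF x] c0 df(1) d1 d2])
    have Jt: "J (g x) v \<in> tangent_space A (g x)"
      and Jl: "J (g x) (\<lambda>c. s *\<^sub>R v c + t *\<^sub>R w c) = (\<lambda>c. s *\<^sub>R J (g x) v c + t *\<^sub>R J (g x) w c)"
      and JJ: "J (g x) (J (g x) v) = (\<lambda>c. - v c)"
      if "v \<in> tangent_space A (g x)" "w \<in> tangent_space A (g x)" for v w s t
      using J qx that unfolding almost_complex_structure_def by blast+
    note Ja = Jt[OF a(1) a(1)]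
    \<comment> \<open>A complex linear differential is determined by its value \<open>a\<close> at
      1; that \<open>J\<close> squares to -1 gives the equation for all vectors.\<close>
    define dg where "dg v = (\<lambda>c. Re v *\<^sub>R a c + Im v *\<^sub>R J (g x) a c)" for v
    show ?case
    proof (intro exI[of _ dg] conjI allI)
      fix v
      show "dg v \<in> tangent_space A (g x)" unfolding dg_def by (rule tangent_space_lincomb[OF a(1) Ja])
      show "differential_at A i (g x) (dg v) = weak_derivative S (i \<circ> g) x v"
        unfolding dg_def weak_derivative_complex by (simp only: differential_at_lincomb[OF qx a(1) Ja] a(2,3))
      show "dg (\<i> * v) = J (g x) (dg v)"
        unfolding dg_def Jl[OF a(1) Ja] JJ[OF a(1) a(1)] by (simp add: fun_eq_iff)
    qed
  qed
  then show ?thesis using g by (simp add: J_holomorphic_maps_def)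
qed

text \<open>On the overlap the two maps coincide, so by uniqueness their weak derivatives agree
  almost everywhere there and can be merged into one function before gluing.\<close>

lemma J_holomorphic_glue:
  assumes S: "open S" and T: "open T" and p: "p \<ge> 1"
    and f: "f \<in> J_holomorphic_maps p S X A J i" and g: "g \<in> J_holomorphic_maps p T X A J i"
    and h: "h \<in> extensional (S \<union> T)" "\<And>x. x \<in> S \<Longrightarrow> h x = f x" "\<And>x. x \<in> T \<Longrightarrow> h x = g x"
  shows "h \<in> J_holomorphic_maps p (S \<union> T) X A J i"
proof -
  have fW: "f \<in> W1p_maps p S X i" and gW: "g \<in> W1p_maps p T X i" using f g by (simp_all add: J_holomorphic_maps_def)
  note F = W1p_mapsD[OF fW] and G = W1p_mapsD[OF gW]
  have O: "open (S \<union> T)" "open (S \<inter> T)" using S T by auto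
  have sets: "S \<in> sets lebesgue" "T \<in> sets lebesgue" "S \<union> T \<in> sets lebesgue" "S \<inter> T \<in> sets lebesgue" using S T by auto
  have aeS: "AE x in lebesgue_on S. (i \<circ> f) x = (i \<circ> h) x" and aeT: "AE x in lebesgue_on T. (i \<circ> g) x = (i \<circ> h) x"
    using h by (auto intro!: AE_I2)
  have LpS: "i \<circ> h \<in> Lp_on p S"
    by (rule Lp_on_cong_AE[where u="i \<circ> f", OF sets(1) _ aeS]) (use F(3) in \<open>simp add: W1p_def\<close>)
  have LpT: "i \<circ> h \<in> Lp_on p T"
    by (rule Lp_on_cong_AE[where u="i \<circ> g", OF sets(2) _ aeT]) (use G(3) in \<open>simp add: W1p_def\<close>)
  have Lp: "i \<circ> h \<in> Lp_on p (S \<union> T)" by (rule Lp_on_Un[OF LpS LpT sets(1,2)])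
  have loc: "u locally_integrable_on R" if "u \<in> Lp_on p R" "R \<in> sets lebesgue" for R and u :: "complex \<Rightarrow> 'b"
    by (rule Lp_on_locally_integrable[OF p that])
  define w where "w b x = (if x \<in> S then weak_partial S (i \<circ> f) b x else weak_partial T (i \<circ> g) b x)" for b x
  have w: "is_weak_partial (S \<union> T) (i \<circ> h) b (w b) \<and> w b \<in> Lp_on p (S \<union> T) \<and>
      (AE x in lebesgue_on S. weak_partial S (i \<circ> f) b x = w b x) \<and> (AE x in lebesgue_on T. weak_partial T (i \<circ> g) b x = w b x)"
    if b: "b \<in> Basis" for b
  proof -
    note Fb = W1p_weak_partial[OF S F(3) b] and Gb = W1p_weak_partial[OF T G(3) b]
    have wS: "AE x in lebesgue_on S. weak_partial S (i \<circ> f) b x = w b x" by (auto simp: w_def intro!: AE_I2)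
    have fS: "is_weak_partial S (i \<circ> h) b (weak_partial S (i \<circ> f) b)"
      by (rule is_weak_partial_cong_AE[OF S Fb(1) _ aeS loc[OF LpS sets(1)] loc[OF Fb(2) sets(1)]]) simp
    have gT: "is_weak_partial T (i \<circ> h) b (weak_partial T (i \<circ> g) b)"
      by (rule is_weak_partial_cong_AE[OF T Gb(1) _ aeT loc[OF LpT sets(2)] loc[OF Gb(2) sets(2)]]) simp
    have "AE x in lebesgue_on (S \<inter> T). weak_partial S (i \<circ> f) b x = weak_partial T (i \<circ> g) b x"
      by (rule weak_partial_unique[OF O(2) is_weak_partial_restrict[OF fS _ S O(2)] is_weak_partial_restrict[OF gT _ T O(2)]]) auto
    then have "AE x in lebesgue. x \<in> S \<inter> T \<longrightarrow> weak_partial S (i \<circ> f) b x = weak_partial T (i \<circ> g) b x"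
      by (simp only: AE_lebesgue_on_iff[OF sets(4)])
    then have "AE x in lebesgue. x \<in> T \<longrightarrow> weak_partial T (i \<circ> g) b x = w b x"
      by eventually_elim (auto simp: w_def)
    then have wT: "AE x in lebesgue_on T. weak_partial T (i \<circ> g) b x = w b x"
      by (simp only: AE_lebesgue_on_iff[OF sets(2)])
    have wLS: "w b \<in> Lp_on p S" by (rule Lp_on_cong_AE[OF sets(1) Fb(2) wS])
    have wLT: "w b \<in> Lp_on p T" by (rule Lp_on_cong_AE[OF sets(2) Gb(2) wT])
    have wL: "w b \<in> Lp_on p (S \<union> T)" by (rule Lp_on_Un[OF wLS wLT sets(1,2)])
    have "is_weak_partial S (i \<circ> h) b (w b)"
      by (rule is_weak_partial_cong_AE[OF S fS wS _ loc[OF LpS sets(1)] loc[OF wLS sets(1)]]) simp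
    moreover have "is_weak_partial T (i \<circ> h) b (w b)"
      by (rule is_weak_partial_cong_AE[OF T gT wT _ loc[OF LpT sets(2)] loc[OF wLT sets(2)]]) simp
    ultimately have "is_weak_partial (S \<union> T) (i \<circ> h) b (w b)"
      by (rule is_weak_partial_glue[OF S T _ _ loc[OF Lp sets(3)] loc[OF wL sets(3)]])
    then show ?thesis using wL wS wT by simp
  qed
  have hW1p: "i \<circ> h \<in> W1p p (S \<union> T)"
    by (rule W1pI[OF Lp, of w]) (use w in blast)+
  have cont: "continuous_on (S \<union> T) (i \<circ> h)"
  proof (rule continuous_on_open_Un[OF S T])
    show "continuous_on S (i \<circ> h)"
      using continuous_map_compose[OF F(2) embedding_continuous] h(2) by (auto intro: continuous_on_eq)
    show "continuous_on T (i \<circ> h)"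
      using continuous_map_compose[OF G(2) embedding_continuous] h(3) by (auto intro: continuous_on_eq)
  qed
  have "continuous_map (top_of_set (S \<union> T)) X h"
    by (rule continuous_map_via_embedding) (use h F(4) G(4) cont in auto)
  then have hW: "h \<in> W1p_maps p (S \<union> T) X i" using h(1) hW1p by (simp add: W1p_maps_def)
  have B: "(1::complex) \<in> Basis" "\<i> \<in> Basis" by (auto simp: Basis_complex_def)
  \<comment> \<open>Written with the merged derivative \<open>w\<close>, the equation no longer
    mentions a domain, so it can be collected from \<open>S\<close> and \<open>T\<close> and then
    read on the union.\<close>
  let ?Q = "\<lambda>x. \<exists>df. (\<forall>v. df v \<in> tangent_space A (h x) \<and>
            differential_at A i (h x) (df v) = Re v *\<^sub>R w 1 x + Im v *\<^sub>R w \<i> x) \<and>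
       (\<forall>v. df (\<i> * v) = J (h x) (df v))"
  have "AE x in lebesgue_on S. \<exists>df. (\<forall>v. df v \<in> tangent_space A (f x) \<and>
            differential_at A i (f x) (df v) = weak_derivative S (i \<circ> f) x v) \<and>
       (\<forall>v. df (\<i> * v) = J (f x) (df v))" using f by (simp add: J_holomorphic_maps_def)
  then have QS: "AE x in lebesgue_on S. ?Q x"
    using conjunct1[OF conjunct2[OF conjunct2[OF w[OF B(1)]]]] conjunct1[OF conjunct2[OF conjunct2[OF w[OF B(2)]]]] AE_space
  proof eventually_elim
    case (elim x)
    then have "h x = f x" using h(2) by simp
    with elim(1) show ?case unfolding weak_derivative_complex elim(2,3) by simp
  qed
  have "AE x in lebesgue_on T. \<exists>df. (\<forall>v. df v \<in> tangent_space A (g x) \<and>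
            differential_at A i (g x) (df v) = weak_derivative T (i \<circ> g) x v) \<and>
       (\<forall>v. df (\<i> * v) = J (g x) (df v))" using g by (simp add: J_holomorphic_maps_def)
  then have QT: "AE x in lebesgue_on T. ?Q x"
    using conjunct2[OF conjunct2[OF conjunct2[OF w[OF B(1)]]]] conjunct2[OF conjunct2[OF conjunct2[OF w[OF B(2)]]]] AE_space
  proof eventually_elim
    case (elim x)
    then have "h x = g x" using h(3) by simp
    with elim(1) show ?case unfolding weak_derivative_complex elim(2,3) by simp
  qed
  have "AE x in lebesgue. (x \<in> S \<longrightarrow> ?Q x) \<and> (x \<in> T \<longrightarrow> ?Q x)"
    using QS QT unfolding AE_lebesgue_on_iff[OF sets(1)] AE_lebesgue_on_iff[OF sets(2)] by (rule AE_conjI)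
  then have "AE x in lebesgue. x \<in> S \<union> T \<longrightarrow> ?Q x" by (rule AE_mp) (rule AE_I2, blast)
  then have Q: "AE x in lebesgue_on (S \<union> T). ?Q x" unfolding AE_lebesgue_on_iff[OF sets(3)] .
  have uniq: "AE x in lebesgue_on (S \<union> T). weak_partial (S \<union> T) (i \<circ> h) b x = w b x" if "b \<in> Basis" for b
    using w[OF that] by (intro weak_partial_unique[OF O(1) W1p_weak_partial(1)[OF O(1) hW1p that]]) blast
  have "AE x in lebesgue_on (S \<union> T). \<exists>df. (\<forall>v. df v \<in> tangent_space A (h x) \<and>
            differential_at A i (h x) (df v) = weak_derivative (S \<union> T) (i \<circ> h) x v) \<and>
       (\<forall>v. df (\<i> * v) = J (h x) (df v))"
    using Q uniq[OF B(1)] uniq[OF B(2)]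
  proof eventually_elim
    case (elim x)
    show ?case unfolding weak_derivative_complex elim(2,3) by (rule elim(1))
  qed
  then show ?thesis using hW by (simp add: J_holomorphic_maps_def)
qed

section \<open>Convergence in the induced distance\<close>

text \<open>The walk back along the second map uses the opposite order of arguments.\<close>

lemma induced_dist_chain_reverse:
  assumes "\<And>j. j < n \<Longrightarrow> induced_dist X i (q (Suc j)) (q j) \<le> ennreal (a j)" "\<And>j. j < n \<Longrightarrow> a j \<ge> 0" "q 0 \<in> topspace X"
  shows "induced_dist X i (q n) (q 0) \<le> ennreal (\<Sum>j<n. a j)"
  using assms
proof (induction n)
  case 0 then show ?case by (simp add: induced_dist_refl)
next
  case (Suc n)
  have "induced_dist X i (q (Suc n)) (q 0) \<le> induced_dist X i (q (Suc n)) (q n) + induced_dist X i (q n) (q 0)"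
    by (rule induced_dist_triangle)
  also have "\<dots> \<le> ennreal (a n) + ennreal (\<Sum>j<n. a j)"
    using Suc by (intro add_mono) auto
  also have "\<dots> = ennreal (\<Sum>j<Suc n. a j)"
    using Suc.prems(2) by (subst ennreal_plus[symmetric]) (auto intro!: sum_nonneg simp: add.commute)
  finally show ?case .
qed

text \<open>Uniform continuity on \<open>K\<close> makes all steps of a fine subdivision short
  enough for the comparison of distances near a compact set; its factor 2 is the one in the bound.
  The threshold \<open>N\<close> serves all segments inside \<open>K\<close> at once.\<close>

lemma induced_dist_segment:
  fixes f :: "complex \<Rightarrow> 'm"
  assumes f: "continuous_map (top_of_set S) X f" and K: "compact K" "K \<subseteq> S" and \<rho>: "\<rho> \<ge> 0"
  shows "\<exists>N>0. \<forall>n\<ge>N. \<forall>x v. norm v \<le> \<rho> \<longrightarrow> (\<forall>t\<in>{0..1}. x + t *\<^sub>R v \<in> K) \<longrightarrow>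
      induced_dist X i (f x) (f (x + v)) \<le> ennreal (2 * (\<Sum>j<n. norm (i (f (x + (Suc j / n) *\<^sub>R v)) - i (f (x + (j / n) *\<^sub>R v))))) \<and>
      induced_dist X i (f (x + v)) (f x) \<le> ennreal (2 * (\<Sum>j<n. norm (i (f (x + (Suc j / n) *\<^sub>R v)) - i (f (x + (j / n) *\<^sub>R v)))))"
proof -
  have "compactin (top_of_set S) K" using K by (simp add: compactin_subtopology)
  then have fK: "compactin X (f ` K)" by (rule image_compactin[OF _ f])
  obtain \<eta> where \<eta>: "\<eta> > 0" "\<And>q q'. q \<in> f ` K \<Longrightarrow> q' \<in> topspace X \<Longrightarrow> norm (i q - i q') < \<eta> \<Longrightarrow>
      induced_dist X i q q' \<le> ennreal (2 * norm (i q - i q'))"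
    using induced_dist_compact[OF fK] by metis
  have fX: "f x \<in> topspace X" if "x \<in> K" for x
    using compactin_subset_topspace[OF fK] that by blast
  have "continuous_on S (i \<circ> f)" using continuous_map_compose[OF f embedding_continuous] by simp
  then have "uniformly_continuous_on K (i \<circ> f)"
    using K by (intro compact_uniformly_continuous) (auto intro: continuous_on_subset)
  then obtain \<delta> where \<delta>: "\<delta> > 0" "\<And>x y. x \<in> K \<Longrightarrow> y \<in> K \<Longrightarrow> norm (y - x) < \<delta> \<Longrightarrow> norm (i (f y) - i (f x)) < \<eta>"
    using \<eta>(1) unfolding uniformly_continuous_on_def dist_norm comp_def by metis
  \<comment> \<open>With more than \<rho>/\<delta> steps, each step is shorter than
    \<delta>.\<close>
  obtain N0 :: nat where N0: "\<rho> / \<delta> < real N0" using reals_Archimedean2 by blast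
  define N where "N = Suc N0"
  have *: "induced_dist X i (f x) (f (x + v)) \<le> ennreal (\<Sum>j<n. 2 * norm (i (f (x + (Suc j / n) *\<^sub>R v)) - i (f (x + (j / n) *\<^sub>R v)))) \<and>
     induced_dist X i (f (x + v)) (f x) \<le> ennreal (\<Sum>j<n. 2 * norm (i (f (x + (Suc j / n) *\<^sub>R v)) - i (f (x + (j / n) *\<^sub>R v))))"
    if n: "n \<ge> N" and v: "norm v \<le> \<rho>" and x: "\<And>t. t \<in> {0..1} \<Longrightarrow> x + t *\<^sub>R v \<in> K" for n x v
  proof -
    have n0: "real n > 0" "\<rho> / \<delta> < real n" using n N0 by (auto simp: N_def)
    then have small: "norm v / n < \<delta>" using v \<delta>(1) by (simp add: field_simps)
    define y where "y j = x + (real j / n) *\<^sub>R v" for j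
    have yK: "y j \<in> K" if "j \<le> n" for j unfolding y_def using that n0 by (intro x) (auto simp: divide_le_eq)
    have step: "norm (i (f (y (Suc j))) - i (f (y j))) < \<eta>" if j: "j < n" for j
    proof (rule \<delta>(2)[OF yK yK])
      have "y (Suc j) - y j = (1 / n) *\<^sub>R v"
        by (simp add: y_def scaleR_diff_left[symmetric] add_divide_distrib)
      then show "norm (y (Suc j) - y j) < \<delta>" using small by simp
    qed (use j in auto)
    have d1: "induced_dist X i (f (y j)) (f (y (Suc j))) \<le> ennreal (2 * norm (i (f (y (Suc j))) - i (f (y j))))" if j: "j < n" for j
      using \<eta>(2)[of "f (y j)" "f (y (Suc j))"] step[OF j] yK[of j] fX[OF yK, of "Suc j"] j by (simp add: norm_minus_commute)
    have d2: "induced_dist X i (f (y (Suc j))) (f (y j)) \<le> ennreal (2 * norm (i (f (y (Suc j))) - i (f (y j))))" if j: "j < n" for j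
      using \<eta>(2)[of "f (y (Suc j))" "f (y j)"] step[OF j] yK[of "Suc j"] fX[OF yK, of j] j by simp
    have y0: "f (y 0) \<in> topspace X" by (rule fX[OF yK]) simp
    have ends: "y 0 = x" "y n = x + v" using n0 by (simp_all add: y_def)
    show ?thesis
      using induced_dist_chain[of n "\<lambda>j. f (y j)", OF d1 _ y0] induced_dist_chain_reverse[of n "\<lambda>j. f (y j)", OF d2 _ y0]
      unfolding ends by (simp add: y_def)
  qed
  show ?thesis
    unfolding sum_distrib_left using * by (intro exI[of _ N] conjI allI impI) (simp_all add: N_def)
qed

text \<open>Allows a given point to be replaced by a neighbour found through averaging, at
  arbitrarily small cost.\<close>

lemma induced_dist_continuous:
  fixes f :: "complex \<Rightarrow> 'm"
  assumes S: "open S" and f: "continuous_map (top_of_set S) X f" and z: "z \<in> S" and e: "e > 0"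
  obtains r where "r > 0" "\<And>x. x \<in> ball z r \<Longrightarrow> x \<in> S \<and> induced_dist X i (f z) (f x) \<le> ennreal e \<and> induced_dist X i (f x) (f z) \<le> ennreal e"
proof -
  have fX: "f x \<in> topspace X" if "x \<in> S" for x
    using continuous_map_image_subset_topspace[OF f] that by auto
  obtain \<eta> where \<eta>: "\<eta> > 0" "\<And>q'. q' \<in> topspace X \<Longrightarrow> norm (i (f z) - i q') < \<eta> \<Longrightarrow>
      induced_dist X i (f z) q' \<le> ennreal (2 * norm (i (f z) - i q')) \<and> induced_dist X i q' (f z) \<le> ennreal (2 * norm (i (f z) - i q'))"
    using induced_dist_compact[of "{f z}"] fX[OF z] by (metis finite.emptyI finite.insertI finite_imp_compactin insert_subset empty_subsetI singletonI)
  have "continuous_on S (i \<circ> f)" using continuous_map_compose[OF f embedding_continuous] by simp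
  then have "isCont (i \<circ> f) z" by (rule continuous_on_interior) (simp add: interior_open S z)
  then obtain r1 where r1: "r1 > 0" "\<And>x. dist x z < r1 \<Longrightarrow> dist (i (f x)) (i (f z)) < min \<eta> (e / 2)"
    using \<eta>(1) e unfolding continuous_at_eps_delta comp_def by (metis half_gt_zero min_less_iff_conj)
  obtain r2 where r2: "r2 > 0" "ball z r2 \<subseteq> S" using S z open_contains_ball by blast
  show ?thesis
  proof (rule that[of "min r1 r2"])
    fix x assume "x \<in> ball z (min r1 r2)"
    then have x: "x \<in> S" "norm (i (f z) - i (f x)) < \<eta>" "2 * norm (i (f z) - i (f x)) \<le> e"
      using r2(2) r1(2)[of x] by (auto simp: dist_commute dist_norm norm_minus_commute)
    then show "x \<in> S \<and> induced_dist X i (f z) (f x) \<le> ennreal e \<and> induced_dist X i (f x) (f z) \<le> ennreal e"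
      using \<eta>(2)[OF fX[OF x(1)] x(2)] by (meson ennreal_leI order_trans)
  qed (use r1 r2 in auto)
qed

lemma powr_small_at_right:
  fixes s B e :: real
  assumes "s > 0" "e > 0" "\<rho> > 0"
  obtains R where "0 < R" "R < \<rho>" "B * R powr s < e"
proof -
  have "((\<lambda>R. B * R powr s) \<longlongrightarrow> B * 0) (at_right 0)"
    using assms(1) by (intro tendsto_mult tendsto_const tendsto_zero_powrI[OF _ tendsto_const])
      (auto intro: eventually_at_right_less eventually_mono[OF eventually_at_right_less] tendsto_ident_at)
  then have "\<forall>\<^sub>F R in at_right 0. B * R powr s < e" using assms(2) by (intro order_tendstoD(2)) auto
  moreover have "\<forall>\<^sub>F R in at_right 0. R < \<rho>" using assms(3) by (simp add: eventually_at_right_field) (use assms(3) in blast)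
  moreover have "\<forall>\<^sub>F R in at_right 0. (0::real) < R" by (rule eventually_at_right_less)
  ultimately have "\<forall>\<^sub>F R in at_right 0. 0 < R \<and> R < \<rho> \<and> B * R powr s < e" by eventually_elim simp
  then obtain R where "0 < R \<and> R < \<rho> \<and> B * R powr s < e"
    using eventually_happens'[OF trivial_limit_at_right_real] by blast
  then show ?thesis using that by blast
qed

text \<open>The image of \<open>i\<close> need not be closed, so near the boundary of \<open>S\<close> the maps may leave every compact part of \<open>M\<close>
  and uniform closeness in Euclidean space does not suffice. Instead one walks along \<open>g\<close> into a compact part
  of \<open>S\<close>, passes to \<open>f k\<close> there, and walks back along \<open>f k\<close>; Morrey's argument bounds the lengths.\<close>

lemma induced_dist_locally_uniform:
  fixes f :: "nat \<Rightarrow> complex \<Rightarrow> 'm"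
  assumes S: "open S" "C1_boundary S" and p: "p > 2"
    and f: "\<And>k. f k \<in> W1p_maps p S X i" and g: "g \<in> W1p_maps p S X i"
    and conv: "(\<lambda>k. W1p_dist p S i (f k) g) \<longlonglongrightarrow> 0" and z0: "z0 \<in> closure S" and \<epsilon>: "\<epsilon> > 0"
  obtains \<rho> where "\<rho> > 0" "\<forall>\<^sub>F k in sequentially. \<forall>\<zeta>\<in>S \<inter> ball z0 \<rho>. induced_dist X i (g \<zeta>) (f k \<zeta>) \<le> ennreal \<epsilon>"
proof -
  have p1: "p \<ge> 1" using p by simp
  note F = W1p_mapsD[OF f] and G = W1p_mapsD[OF g]
  define u where "u = i \<circ> g"
  define uk where "uk k = i \<circ> f k" for k
  have uW: "u \<in> W1p p S" "uk k \<in> W1p p S" for k using F(3) G(3) by (simp_all add: u_def uk_def)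
  have uc: "continuous_on S u" "continuous_on S (uk k)" for k
    unfolding u_def uk_def
    using continuous_map_compose[OF G(2) embedding_continuous] continuous_map_compose[OF F(2)[of k] embedding_continuous]
    by simp_all
  define D where "D k = W1p_norm p S (\<lambda>x. uk k x - u x)" for k
  have diff: "(\<lambda>x. uk k x - u x) \<in> W1p p S" for k
    using W1p_linear(1)[OF S(1) p1 uW(2) uW(1), of 1 k "-1"] by simp
  have D0: "D \<longlonglongrightarrow> 0" using conv by (simp add: W1p_dist_def D_def[abs_def] u_def uk_def)
  \<comment> \<open>The summand 1 covers every \<open>uk k\<close> with \<open>D k < 1\<close>, so
    one constant serves all large k.\<close>
  define M where "M = 2 powr p * (W1p_norm p S u + 1) powr p"
  have evM: "\<forall>\<^sub>F k in sequentially. 2 powr p * W1p_norm p S (uk k) powr p \<le> M"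
  proof -
    have "\<forall>\<^sub>F k in sequentially. D k < 1" using D0 by (intro order_tendstoD(2)) auto
    then show ?thesis
    proof eventually_elim
      case (elim k)
      have "W1p_norm p S (uk k) \<le> W1p_norm p S u + D k"
        using W1p_norm_add_le[OF S(1) p1 uW(1) diff[of k]] by (simp add: D_def)
      then show ?case
        unfolding M_def using elim p W1p_norm_nonneg[of p S "uk k"] by (intro mult_left_mono powr_mono2) auto
    qed
  qed
  have uM: "2 powr p * W1p_norm p S u powr p \<le> M"
    unfolding M_def using p W1p_norm_nonneg[of p S u] by (intro mult_left_mono powr_mono2) auto
  obtain \<nu> c \<rho> where cone: "norm \<nu> = 1" "c > 0" "c \<le> 1" "\<rho> > 0"
    "\<And>R. 0 < R \<Longrightarrow> R < \<rho> \<Longrightarrow> \<exists>K. compact K \<and> K \<subseteq> S \<and>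
      (\<forall>\<zeta>\<in>S \<inter> ball z0 \<rho>. \<forall>w\<in>ball (R *\<^sub>R \<nu>) (c * R). (\<forall>t\<in>{0..1}. \<zeta> + t *\<^sub>R w \<in> S) \<and> \<zeta> + w \<in> K)"
    using C1_boundary_cone[OF S z0] by metis
  \<comment> \<open>The final sum 2e + 2(a + b + d) stays below 4e.\<close>
  define e where "e = \<epsilon> / 6"
  have e: "e > 0" using \<epsilon> by (simp add: e_def)
  \<comment> \<open>The set of directions will have area \<kappa> R^2. The constant \<open>B\<close>
    collects the factors that do not depend on R, so that the mean cost of both walks is at most B
    R^(1-2/p).\<close>
  define \<kappa> where "\<kappa> = pi * (c / 2) ^ 2"
  have \<kappa>: "\<kappa> > 0" using cone(2) by (simp add: \<kappa>_def)
  define B where "B = 4 * (p / (p - 2)) * (1 + M / \<kappa>)"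
  have s: "1 - 2 / p > 0" using p by (simp add: field_simps)
  obtain R where R: "0 < R" "R < \<rho>" "B * R powr (1 - 2 / p) < e / 2"
    using powr_small_at_right[OF s _ cone(4), of "e / 2" B] e by auto
  obtain K where K: "compact K" "K \<subseteq> S"
    "\<And>\<zeta> w t. \<zeta> \<in> S \<inter> ball z0 \<rho> \<Longrightarrow> w \<in> ball (R *\<^sub>R \<nu>) (c * R) \<Longrightarrow> t \<in> {0..1} \<Longrightarrow> \<zeta> + t *\<^sub>R w \<in> S"
    "\<And>\<zeta> w. \<zeta> \<in> S \<inter> ball z0 \<rho> \<Longrightarrow> w \<in> ball (R *\<^sub>R \<nu>) (c * R) \<Longrightarrow> \<zeta> + w \<in> K"
    using cone(5)[OF R(1,2)] by metis
  have "compactin (top_of_set S) K" using K by (simp add: compactin_subtopology)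
  then have gK: "compactin X (g ` K)" by (rule image_compactin[OF _ G(2)])
  obtain \<eta> where \<eta>: "\<eta> > 0" "\<And>q q'. q \<in> g ` K \<Longrightarrow> q' \<in> topspace X \<Longrightarrow> norm (i q - i q') < \<eta> \<Longrightarrow>
      induced_dist X i q q' \<le> ennreal (2 * norm (i q - i q'))"
    using induced_dist_compact[OF gK] by metis
  define \<Lambda> where "\<Lambda> = 1 + e / \<eta>"
  have \<Lambda>: "\<Lambda> \<ge> 1" "e \<le> \<Lambda> * \<eta>" using e \<eta>(1) by (simp_all add: \<Lambda>_def field_simps)
  \<comment> \<open>The budget e is divided into e/2 for the walks and e/4 for each of the two parts
    of the end point term.\<close>
  define l where "l = e / (4 * \<Lambda>)"
  have l: "l > 0" "\<Lambda> * l = e / 4" using e \<Lambda>(1) by (simp_all add: l_def)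
  \<comment> \<open>Half the admissible radius is taken so that the closed disc still lies in the
    cone and the segments sweep out a compact set.\<close>
  define V where "V = ball (R *\<^sub>R \<nu>) (c * R / 2)"
  define m where "m = \<kappa> * R ^ 2"
  have m: "m > 0" using \<kappa> R(1) by (simp add: m_def)
  have Vm: "emeasure lborel V = ennreal m"
    unfolding V_def using cone(2) R(1) by (simp add: emeasure_ball unit_ball_vol_2 m_def \<kappa>_def power_mult_distrib power_divide mult_ac)
  have V_sub: "cball (R *\<^sub>R \<nu>) (c * R / 2) \<subseteq> ball (R *\<^sub>R \<nu>) (c * R)" "V \<subseteq> cball (R *\<^sub>R \<nu>) (c * R / 2)"
  proof -
    have "c * R > 0" using cone(2) R(1) by simp
    then show "cball (R *\<^sub>R \<nu>) (c * R / 2) \<subseteq> ball (R *\<^sub>R \<nu>) (c * R)"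
      by (intro cball_subset_ball_iff[THEN iffD2]) (auto simp: mult.commute)
    show "V \<subseteq> cball (R *\<^sub>R \<nu>) (c * R / 2)" unfolding V_def by (rule ball_subset_cball)
  qed
  have V_norm: "norm v \<le> 2 * R" if "v \<in> V" for v
  proof -
    have "norm v \<le> norm (R *\<^sub>R \<nu>) + norm (v - R *\<^sub>R \<nu>)" using norm_triangle_sub[of v "R *\<^sub>R \<nu>"] by simp
    also have "norm (v - R *\<^sub>R \<nu>) \<le> R"
    proof -
      have "norm (v - R *\<^sub>R \<nu>) < c * R / 2" using that by (simp add: V_def dist_norm norm_minus_commute)
      moreover have "c * R \<le> 1 * R" using cone(3) R(1) by (intro mult_right_mono) auto
      ultimately show ?thesis using R(1) by linarith
    qed
    finally show ?thesis using cone(1) R(1) by simp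
  qed
  \<comment> \<open>This choice makes lam and lam^(1-p) / R^2 the same power of R.\<close>
  define lam where "lam = R powr (- 2 / p)"
  have lam: "lam > 0" using R(1) by (simp add: lam_def)
  have cost: "2 * ((2 * R) * (p / (p - 2)) * (lam + lam powr (1 - p) * M / m)) = B * R powr (1 - 2 / p)"
  proof -
    have 1: "R * lam = R powr (1 - 2 / p)"
      using R(1) by (simp add: lam_def powr_add[symmetric] powr_mult_base)
    have "- 2 / p * (1 - p) = 2 - 2 / p" using p by (simp add: field_simps)
    then have "lam powr (1 - p) = R powr (2 - 2 / p)"
      by (simp only: lam_def powr_powr)
    also have "\<dots> = R powr (- 2 / p) * R ^ 2"
      using R(1) by (simp add: powr_add[symmetric] flip: powr_numeral)
    finally have 2: "lam powr (1 - p) / m = lam / \<kappa>"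
      using R(1) by (simp add: m_def lam_def)
    have "lam + lam powr (1 - p) * M / m = lam * (1 + M / \<kappa>)"
      using arg_cong[OF 2, of "\<lambda>t. t * M"] by (simp add: distrib_left)
    then have "2 * ((2 * R) * (p / (p - 2)) * (lam + lam powr (1 - p) * M / m)) = B * (R * lam)"
      by (simp add: B_def)
    then show ?thesis by (simp only: 1)
  qed
  have evD: "\<forall>\<^sub>F k in sequentially. \<Lambda> * (l powr (1 - p) * D k powr p / m) < e / 4"
  proof -
    have "(\<lambda>k. D k powr p) \<longlonglongrightarrow> 0"
      using p by (intro tendsto_zero_powrI[OF D0 tendsto_const]) (auto simp: D_def W1p_norm_nonneg)
    then have "(\<lambda>k. \<Lambda> * (l powr (1 - p) * D k powr p / m)) \<longlonglongrightarrow> \<Lambda> * (l powr (1 - p) * 0 / m)"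
      using m by (intro tendsto_intros) auto
    then show ?thesis using e by (intro order_tendstoD(2)) auto
  qed
  have "\<forall>\<^sub>F k in sequentially. \<forall>\<zeta>\<in>S \<inter> ball z0 \<rho>. induced_dist X i (g \<zeta>) (f k \<zeta>) \<le> ennreal \<epsilon>"
    using evM evD
  proof eventually_elim
    case (elim k)
    show ?case
    proof
      \<comment> \<open>Here k is already fixed. The radii, the compact set and the mesh below may
        depend on \<zeta> and k, because the bound obtained depends on neither.\<close>
      fix \<zeta> assume \<zeta>: "\<zeta> \<in> S \<inter> ball z0 \<rho>"
      obtain r1 where r1: "r1 > 0" "\<And>x. x \<in> ball \<zeta> r1 \<Longrightarrow> x \<in> S \<and> induced_dist X i (g \<zeta>) (g x) \<le> ennreal e"
        using induced_dist_continuous[OF S(1) G(2) _ e, of \<zeta>] \<zeta> by (metis IntD1)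
      obtain r2 where r2: "r2 > 0" "\<And>x. x \<in> ball \<zeta> r2 \<Longrightarrow> x \<in> S \<and> induced_dist X i (f k x) (f k \<zeta>) \<le> ennreal e"
        using induced_dist_continuous[OF S(1) F(2)[of k] _ e, of \<zeta>] \<zeta> by (metis IntD1)
      obtain r3 where r3: "r3 > 0" "ball \<zeta> r3 \<subseteq> S \<inter> ball z0 \<rho>"
        using \<zeta> S(1) open_contains_ball[of "S \<inter> ball z0 \<rho>"] by (meson open_Int open_ball)
      define r where "r = min r1 (min r2 r3) / 2"
      have r: "r > 0" "cball \<zeta> r \<subseteq> ball \<zeta> r1" "cball \<zeta> r \<subseteq> ball \<zeta> r2" "cball \<zeta> r \<subseteq> ball \<zeta> r3"
        using r1(1) r2(1) r3(1) by (auto simp: r_def)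
      define U where "U = ball \<zeta> r"
      \<comment> \<open>The union of all segments considered. It may come close to the boundary
        together with \<zeta>, but it influences only the mesh; the end points lie in the fixed set
        \<open>K\<close>.\<close>
      define K0 where "K0 = (\<lambda>(x, v, t). x + t *\<^sub>R v) ` (cball \<zeta> r \<times> cball (R *\<^sub>R \<nu>) (c * R / 2) \<times> {0..1::real})"
      have "compact K0"
        unfolding K0_def by (intro compact_continuous_image compact_Times compact_cball compact_Icc)
          (auto simp: case_prod_beta intro!: continuous_intros)
      moreover have K0S: "K0 \<subseteq> S"
        unfolding K0_def using K(3) r(4) r3(2) V_sub(1) by (auto simp: subset_iff)
      ultimately have K0: "compact K0" "K0 \<subseteq> S" .
      have in_K0: "x + t *\<^sub>R v \<in> K0" if "x \<in> U" "v \<in> V" "t \<in> {0..1}" for x v t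
        unfolding K0_def using that V_sub(2) by (intro image_eqI[of _ _ "(x, v, t)"]) (auto simp: U_def)
      have R2: "2 * R \<ge> 0" using R(1) by simp
      obtain N1 where N1: "N1 > 0" "\<forall>n\<ge>N1. \<forall>x v. norm v \<le> 2 * R \<longrightarrow> (\<forall>t\<in>{0..1}. x + t *\<^sub>R v \<in> K0) \<longrightarrow>
        induced_dist X i (g x) (g (x + v)) \<le> ennreal (2 * (\<Sum>j<n. norm (i (g (x + (Suc j / n) *\<^sub>R v)) - i (g (x + (j / n) *\<^sub>R v)))))"
        using induced_dist_segment[OF G(2) K0 R2] by blast
      obtain N2 where N2: "N2 > 0" "\<forall>n\<ge>N2. \<forall>x v. norm v \<le> 2 * R \<longrightarrow> (\<forall>t\<in>{0..1}. x + t *\<^sub>R v \<in> K0) \<longrightarrow>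
        induced_dist X i (f k (x + v)) (f k x) \<le> ennreal (2 * (\<Sum>j<n. norm (i (f k (x + (Suc j / n) *\<^sub>R v)) - i (f k (x + (j / n) *\<^sub>R v)))))"
        using induced_dist_segment[OF F(2)[of k] K0 R2] by blast
      define n where "n = max N1 N2"
      have n: "n > 0" using N1(1) by (simp add: n_def)
      define mU where "mU = pi * r ^ 2"
      have Um: "emeasure lborel U = ennreal mU" "mU > 0"
        unfolding U_def using r(1) by (simp_all add: emeasure_ball unit_ball_vol_2 mU_def mult.commute)
      have total: "2 * ((2 * R) * (p / (p - 2)) * (lam + lam powr (1 - p) * M / m)) +
          \<Lambda> * (l + l powr (1 - p) * W1p_norm p S (\<lambda>x. uk k x - u x) powr p / m) < e"
        unfolding cost distrib_left[of \<Lambda>] l(2) D_def[symmetric] using R(3) elim(2) by linarith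
      have \<Lambda>0: "\<Lambda> \<ge> 0" using \<Lambda>(1) by simp
      have Vb: "V \<in> sets borel" by (simp add: V_def)
      have Uo: "open U" by (simp add: U_def)
      obtain x v where xv: "x \<in> U" "v \<in> V"
        "(\<Sum>j<n. norm (u (x + (Suc j / n) *\<^sub>R v) - u (x + (j / n) *\<^sub>R v))) +
         (\<Sum>j<n. norm (uk k (x + (Suc j / n) *\<^sub>R v) - uk k (x + (j / n) *\<^sub>R v))) +
         \<Lambda> * norm (uk k (x + v) - u (x + v)) < e"
        by (rule segment_selection[OF S(1) p uW(1) uc(1) uW(2) uc(2) Uo Vb Um Vm m K0 in_K0 n V_norm R2 lam l(1) \<Lambda>0 uM elim(1) total])
      define a where "a = (\<Sum>j<n. norm (i (g (x + (Suc j / n) *\<^sub>R v)) - i (g (x + (j / n) *\<^sub>R v))))"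
      define b where "b = (\<Sum>j<n. norm (i (f k (x + (Suc j / n) *\<^sub>R v)) - i (f k (x + (j / n) *\<^sub>R v))))"
      define d where "d = norm (i (g (x + v)) - i (f k (x + v)))"
      have nn: "a \<ge> 0" "b \<ge> 0" "d \<ge> 0" by (simp_all add: a_def b_def d_def sum_nonneg)
      have abd: "a + b + \<Lambda> * d < e"
        using xv(3) by (simp add: a_def b_def d_def u_def uk_def norm_minus_commute)
      have d_le: "d \<le> \<Lambda> * d" using \<Lambda>(1) nn(3) mult_right_mono[of 1 \<Lambda> d] by simp
      \<comment> \<open>The weight pays off here: the crossing between the two maps takes place
        where the compact comparison is valid.\<close>
      have "\<Lambda> * d < \<Lambda> * \<eta>" using abd nn \<Lambda>(2) by linarith
      then have d_\<eta>: "d < \<eta>" using \<Lambda>(1) by simp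
      have x1: "x \<in> cball \<zeta> r" using xv(1) by (simp add: U_def)
      have xs: "x \<in> S \<inter> ball z0 \<rho>" using x1 r(4) r3(2) by blast
      have vb: "v \<in> ball (R *\<^sub>R \<nu>) (c * R)" using xv(2) V_sub by blast
      have yK: "x + v \<in> K" by (rule K(4)[OF xs vb])
      have seg: "x + t *\<^sub>R v \<in> K0" if "t \<in> {0..1}" for t by (rule in_K0[OF xv(1,2) that])
      have "induced_dist X i (g \<zeta>) (g x) \<le> ennreal e" using r1(2) r(2) x1 by blast
      moreover have "induced_dist X i (g x) (g (x + v)) \<le> ennreal (2 * a)"
        unfolding a_def by (rule N1(2)[rule_format, OF _ V_norm[OF xv(2)] seg]) (simp_all add: n_def)
      moreover have "induced_dist X i (g (x + v)) (f k (x + v)) \<le> ennreal (2 * d)"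
        unfolding d_def using yK K(2) F(4)[of "x + v"] d_\<eta> by (intro \<eta>(2)) (auto simp: d_def)
      moreover have "induced_dist X i (f k (x + v)) (f k x) \<le> ennreal (2 * b)"
        unfolding b_def by (rule N2(2)[rule_format, OF _ V_norm[OF xv(2)] seg]) (simp_all add: n_def)
      moreover have "induced_dist X i (f k x) (f k \<zeta>) \<le> ennreal e" using r2(2) r(3) x1 by blast
      ultimately have sum: "induced_dist X i (g \<zeta>) (g x) + (induced_dist X i (g x) (g (x + v)) +
          (induced_dist X i (g (x + v)) (f k (x + v)) + (induced_dist X i (f k (x + v)) (f k x) + induced_dist X i (f k x) (f k \<zeta>)))) \<le>
        ennreal e + (ennreal (2 * a) + (ennreal (2 * d) + (ennreal (2 * b) + ennreal e)))"
        by (intro add_mono)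
      have "induced_dist X i (g \<zeta>) (f k \<zeta>) \<le> induced_dist X i (g \<zeta>) (g x) + (induced_dist X i (g x) (g (x + v)) +
          (induced_dist X i (g (x + v)) (f k (x + v)) + (induced_dist X i (f k (x + v)) (f k x) + induced_dist X i (f k x) (f k \<zeta>))))"
        by (rule order_trans[OF induced_dist_triangle add_left_mono], rule order_trans[OF induced_dist_triangle add_left_mono],
          rule order_trans[OF induced_dist_triangle add_left_mono], rule induced_dist_triangle)
      also note sum
      also have "ennreal e + (ennreal (2 * a) + (ennreal (2 * d) + (ennreal (2 * b) + ennreal e))) =
          ennreal (e + (2 * a + (2 * d + (2 * b + e))))"
        using e nn by (simp add: ennreal_plus[symmetric] del: ennreal_plus)
      also have "\<dots> \<le> ennreal \<epsilon>"
        using abd d_le nn unfolding e_def by (intro ennreal_leI) linarith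
      finally show "induced_dist X i (g \<zeta>) (f k \<zeta>) \<le> ennreal \<epsilon>" .
    qed
  qed
  then show ?thesis using that cone(4) by blast
qed

text \<open>The local estimates hold around boundary points too, so compactness of the closure
  leaves finitely many of them.\<close>

lemma uniform_dist_tendsto:
  fixes f :: "nat \<Rightarrow> complex \<Rightarrow> 'm"
  assumes S: "open S" "C1_boundary S" "bounded S" and p: "p > 2"
    and f: "\<And>k. f k \<in> W1p_maps p S X i" and g: "g \<in> W1p_maps p S X i"
    and conv: "(\<lambda>k. W1p_dist p S i (f k) g) \<longlonglongrightarrow> 0" and \<epsilon>: "\<epsilon> > 0"
  shows "\<forall>\<^sub>F k in sequentially. uniform_dist X i S g (f k) \<le> ennreal \<epsilon>"
proof -
  have "\<forall>z0\<in>closure S. \<exists>\<rho>>0. \<forall>\<^sub>F k in sequentially. \<forall>\<zeta>\<in>S \<inter> ball z0 \<rho>. induced_dist X i (g \<zeta>) (f k \<zeta>) \<le> ennreal \<epsilon>"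
  proof
    fix z0 assume "z0 \<in> closure S"
    from induced_dist_locally_uniform[OF S(1,2) p f g conv this \<epsilon>]
    obtain \<rho> where "\<rho> > 0" "\<forall>\<^sub>F k in sequentially. \<forall>\<zeta>\<in>S \<inter> ball z0 \<rho>. induced_dist X i (g \<zeta>) (f k \<zeta>) \<le> ennreal \<epsilon>" .
    then show "\<exists>\<rho>>0. \<forall>\<^sub>F k in sequentially. \<forall>\<zeta>\<in>S \<inter> ball z0 \<rho>. induced_dist X i (g \<zeta>) (f k \<zeta>) \<le> ennreal \<epsilon>"
      by (intro exI[of _ \<rho>] conjI)
  qed
  from bchoice[OF this] obtain \<rho> where \<rho>': "\<forall>z0\<in>closure S. \<rho> z0 > 0 \<and>
      (\<forall>\<^sub>F k in sequentially. \<forall>\<zeta>\<in>S \<inter> ball z0 (\<rho> z0). induced_dist X i (g \<zeta>) (f k \<zeta>) \<le> ennreal \<epsilon>)" ..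
  have \<rho>: "\<rho> z0 > 0"
    "\<forall>\<^sub>F k in sequentially. \<forall>\<zeta>\<in>S \<inter> ball z0 (\<rho> z0). induced_dist X i (g \<zeta>) (f k \<zeta>) \<le> ennreal \<epsilon>"
    if "z0 \<in> closure S" for z0
    using \<rho>'[rule_format, OF that] by simp_all
  have "compact (closure S)" using S(3) by simp
  moreover have "closure S \<subseteq> (\<Union>z\<in>closure S. ball z (\<rho> z))" using \<rho>(1) by fastforce
  ultimately obtain Z where Z: "Z \<subseteq> closure S" "finite Z" "closure S \<subseteq> (\<Union>z\<in>Z. ball z (\<rho> z))"
    using compactE_image[of "closure S" "closure S" "\<lambda>z. ball z (\<rho> z)"] by auto
  have "\<forall>\<^sub>F k in sequentially. \<forall>z\<in>Z. \<forall>\<zeta>\<in>S \<inter> ball z (\<rho> z). induced_dist X i (g \<zeta>) (f k \<zeta>) \<le> ennreal \<epsilon>"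
    using \<rho>(2) Z(1) by (intro eventually_ball_finite[OF Z(2)]) blast
  then show ?thesis
  proof eventually_elim
    case (elim k)
    show ?case
      unfolding uniform_dist_def
    proof (rule SUP_least)
      fix \<zeta> assume "\<zeta> \<in> S"
      moreover from this obtain z where "z \<in> Z" "\<zeta> \<in> ball z (\<rho> z)" using Z(3) closure_subset[of S] by blast
      ultimately show "induced_dist X i (g \<zeta>) (f k \<zeta>) \<le> ennreal \<epsilon>" using elim by blast
    qed
  qed
qed

end

theorem theorem3:
  fixes p :: real
    and \<Omega>1 \<Omega>2 :: "complex set"
    and X :: "'m topology"
    and A :: "('m, 'e::euclidean_space) chart set"
    and J :: "'m \<Rightarrow> (('m, 'e) chart \<Rightarrow> 'e) \<Rightarrow> (('m, 'e) chart \<Rightarrow> 'e)"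
    and i :: "'m \<Rightarrow> real ^ 'N"
    and f1 :: "complex \<Rightarrow> 'm"
    and W2 :: "(complex \<Rightarrow> 'm) set"
  assumes "p > 2"
    and "good_pair \<Omega>1 \<Omega>2"
    and "almost_complex_manifold X A J"
    and "smooth_embedding X A i"
    and "f1 \<in> J_holomorphic_maps p \<Omega>1 X A J i"
    and "W2 \<subseteq> J_holomorphic_maps p \<Omega>2 X A J i"
    and "precompact_in (W1p_topology p \<Omega>2 X i) W2"
  shows "\<forall>\<epsilon>>0. \<exists>\<delta>>0. \<forall>f2\<in>W2. W1p_dist p (\<Omega>1 \<inter> \<Omega>2) i f1 f2 < \<delta> \<longrightarrow>
           (\<exists>fh\<in>J_holomorphic_maps p (\<Omega>1 \<union> \<Omega>2) X A J i.
              uniform_dist X i \<Omega>1 fh f1 < ennreal \<epsilon> \<and> uniform_dist X i \<Omega>2 fh f2 < ennreal \<epsilon>)"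
proof (intro allI impI)
  fix \<epsilon> :: real assume \<epsilon>: "\<epsilon> > 0"
  have O1: "open \<Omega>1" and O2: "open \<Omega>2" "bounded \<Omega>2" "C1_boundary \<Omega>2"
    using assms(2) by (auto simp: good_pair_def)
  have I: "open (\<Omega>1 \<inter> \<Omega>2)" "\<Omega>1 \<inter> \<Omega>2 \<subseteq> \<Omega>1" "\<Omega>1 \<inter> \<Omega>2 \<subseteq> \<Omega>2" using O1 O2 by auto
  have p1: "p \<ge> 1" using assms(1) by simp
  have J: "almost_complex_structure X A J" using assms(3) by (simp add: almost_complex_manifold_def)
  interpret embedded_manifold X A i
    using assms(3,4) by unfold_locales (simp_all add: almost_complex_manifold_def)
  interpret M: Metric_space "W1p_maps p \<Omega>2 X i" "W1p_dist p \<Omega>2 i"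
    by (rule W1p_metric_space[OF O2(1) p1 embedding_continuous embedding_inj])
  let ?good = "\<lambda>f2. \<exists>fh\<in>J_holomorphic_maps p (\<Omega>1 \<union> \<Omega>2) X A J i.
      uniform_dist X i \<Omega>1 fh f1 < ennreal \<epsilon> \<and> uniform_dist X i \<Omega>2 fh f2 < ennreal \<epsilon>"
  show "\<exists>\<delta>>0. \<forall>f2\<in>W2. W1p_dist p (\<Omega>1 \<inter> \<Omega>2) i f1 f2 < \<delta> \<longrightarrow> ?good f2"
  proof (rule ccontr)
    assume neg: "\<not> (\<exists>\<delta>>0. \<forall>f2\<in>W2. W1p_dist p (\<Omega>1 \<inter> \<Omega>2) i f1 f2 < \<delta> \<longrightarrow> ?good f2)"
    have "\<forall>k. \<exists>f2. f2 \<in> W2 \<and> W1p_dist p (\<Omega>1 \<inter> \<Omega>2) i f1 f2 < inverse (real (Suc k)) \<and> \<not> ?good f2"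
    proof
      fix k
      have "inverse (real (Suc k)) > 0" by simp
      with neg show "\<exists>f2. f2 \<in> W2 \<and> W1p_dist p (\<Omega>1 \<inter> \<Omega>2) i f1 f2 < inverse (real (Suc k)) \<and> \<not> ?good f2"
        by blast
    qed
    from choice[OF this] obtain F where F: "\<forall>k. F k \<in> W2 \<and> W1p_dist p (\<Omega>1 \<inter> \<Omega>2) i f1 (F k) < inverse (real (Suc k)) \<and> \<not> ?good (F k)" ..
    have cpt: "compactin M.mtopology (M.mtopology closure_of W2)" and "W2 \<subseteq> topspace M.mtopology"
      using assms(7) by (simp_all only: precompact_in_def W1p_topology_def)
    then have "W2 \<subseteq> M.mtopology closure_of W2" by (intro closure_of_subset)
    then have "range F \<subseteq> M.mtopology closure_of W2" using F by blast
    then obtain g r where gr: "strict_mono r" "limitin M.mtopology (F \<circ> r) g sequentially"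
      using cpt unfolding M.compactin_sequentially by blast
    define f where "f n = F (r n)" for n
    have fJ: "f n \<in> J_holomorphic_maps p \<Omega>2 X A J i" for n using F assms(6) by (auto simp: f_def)
    then have fW: "f n \<in> W1p_maps p \<Omega>2 X i" for n by (simp add: J_holomorphic_maps_def)
    have gW: "g \<in> W1p_maps p \<Omega>2 X i" and conv: "(\<lambda>n. W1p_dist p \<Omega>2 i (f n) g) \<longlonglongrightarrow> 0"
      using gr(2) unfolding M.limitin_metric_dist_null by (simp_all add: f_def comp_def)
    have gJ: "g \<in> J_holomorphic_maps p \<Omega>2 X A J i"
      by (rule J_holomorphic_limit[OF J O2(1) p1 fJ gW conv])
    have f1W: "f1 \<in> W1p_maps p \<Omega>1 X i" using assms(5) by (simp add: J_holomorphic_maps_def)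
    note F1 = W1p_mapsD[OF f1W] and G = W1p_mapsD[OF gW] and Fn = W1p_mapsD[OF fW]
    \<comment> \<open>The Sobolev norm of the difference on the overlap is 0, and continuity of both
      maps turns this into equality at every point.\<close>
    have eq: "f1 z = g z" if z: "z \<in> \<Omega>1" "z \<in> \<Omega>2" for z
    proof -
      have W: "i \<circ> f1 \<in> W1p p (\<Omega>1 \<inter> \<Omega>2)" "i \<circ> g \<in> W1p p (\<Omega>1 \<inter> \<Omega>2)" "i \<circ> f n \<in> W1p p (\<Omega>1 \<inter> \<Omega>2)" for n
        using W1p_subset(1)[OF O1 I(1,2) F1(3)] W1p_subset(1)[OF O2(1) I(1,3) G(3)] W1p_subset(1)[OF O2(1) I(1,3) Fn(3)] by auto
      let ?N = "W1p_norm p (\<Omega>1 \<inter> \<Omega>2)"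
      have "?N (\<lambda>z. i (f1 z) - i (g z)) \<le> inverse (real (Suc n)) + W1p_dist p \<Omega>2 i (f n) g" for n
      proof -
        have "?N (\<lambda>z. i (f1 z) - i (g z)) \<le> ?N (\<lambda>z. i (f1 z) - i (f n z)) + ?N (\<lambda>z. i (f n z) - i (g z))"
          using W1p_norm_add_le[OF I(1) p1 W1p_maps_diff(1)[OF I(1) p1 W(1) W(3)[of n]] W1p_maps_diff(1)[OF I(1) p1 W(3)[of n] W(2)]] by simp
        also have "?N (\<lambda>z. i (f n z) - i (g z)) \<le> W1p_dist p \<Omega>2 i (f n) g"
          unfolding W1p_dist_def by (rule W1p_norm_mono[OF O2(1) I(1,3) p1 W1p_maps_diff(1)[OF O2(1) p1 Fn(3) G(3)]])
        also have "?N (\<lambda>z. i (f1 z) - i (f n z)) \<le> inverse (real (Suc (r n)))"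
          using F unfolding W1p_dist_def f_def by (simp add: less_imp_le)
        also have "\<dots> \<le> inverse (real (Suc n))"
          \<comment> \<open>A strictly increasing \<open>r\<close> satisfies r n \<ge> n.\<close>
          using seq_suble[OF gr(1), of n] by (intro le_imp_inverse_le) auto
        finally show ?thesis by simp
      qed
      moreover have "(\<lambda>n. inverse (real (Suc n)) + W1p_dist p \<Omega>2 i (f n) g) \<longlonglongrightarrow> 0 + 0"
        by (intro tendsto_add LIMSEQ_inverse_real_of_nat conv)
      ultimately have "?N (\<lambda>z. i (f1 z) - i (g z)) \<le> 0"
        by (intro LIMSEQ_le_const[of _ 0]) auto
      then have 0: "?N (\<lambda>z. i (f1 z) - i (g z)) = 0" using W1p_norm_nonneg by (rule antisym)
      have "continuous_on \<Omega>1 (i \<circ> f1)" "continuous_on \<Omega>2 (i \<circ> g)"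
        using continuous_map_compose[OF F1(2) embedding_continuous] continuous_map_compose[OF G(2) embedding_continuous] by simp_all
      then have "continuous_on (\<Omega>1 \<inter> \<Omega>2) (\<lambda>z. (i \<circ> f1) z - (i \<circ> g) z)"
        using I by (intro continuous_on_diff) (auto intro: continuous_on_subset)
      then have "continuous_on (\<Omega>1 \<inter> \<Omega>2) (\<lambda>z. i (f1 z) - i (g z))" by simp
      then have "i (f1 z) - i (g z) = 0"
        using W1p_norm_eq_0_imp[OF I(1) p1 W1p_maps_diff(1)[OF I(1) p1 W(1,2)] 0] z by blast
      then show ?thesis using embedding_inj F1(4)[OF z(1)] G(4)[OF z(2)] by (auto dest: inj_onD)
    qed
    define fh where "fh z = (if z \<in> \<Omega>1 then f1 z else g z)" for z
    have fh: "fh z = f1 z" if "z \<in> \<Omega>1" for z using that by (simp add: fh_def)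
    have fh2: "fh z = g z" if "z \<in> \<Omega>2" for z using that eq by (simp add: fh_def)
    \<comment> \<open>Off the union the glued map takes the value of \<open>g\<close>, which is
      \<open>undefined\<close> there.\<close>
    have "fh \<in> extensional (\<Omega>1 \<union> \<Omega>2)" using G(1) by (auto simp: fh_def extensional_def)
    then have fhJ: "fh \<in> J_holomorphic_maps p (\<Omega>1 \<union> \<Omega>2) X A J i"
      by (rule J_holomorphic_glue[OF O1 O2(1) p1 assms(5) gJ _ fh fh2])
    have "uniform_dist X i \<Omega>1 fh f1 \<le> 0"
      unfolding uniform_dist_def by (rule SUP_least) (simp add: fh induced_dist_refl F1(4))
    then have d1: "uniform_dist X i \<Omega>1 fh f1 < ennreal \<epsilon>" using \<epsilon> by (simp add: order_le_less_trans)
    \<comment> \<open>Half of \<epsilon> turns the weak inequality for the supremum into a strict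
      one.\<close>
    have "\<forall>\<^sub>F n in sequentially. uniform_dist X i \<Omega>2 g (f n) \<le> ennreal (\<epsilon> / 2)"
      by (rule uniform_dist_tendsto[OF O2(1,3,2) assms(1) fW gW conv]) (use \<epsilon> in simp)
    then obtain n where "uniform_dist X i \<Omega>2 g (f n) \<le> ennreal (\<epsilon> / 2)"
      using eventually_happens'[OF sequentially_bot] by blast
    also have "ennreal (\<epsilon> / 2) < ennreal \<epsilon>" using \<epsilon> by (simp add: ennreal_less_iff)
    finally have "uniform_dist X i \<Omega>2 fh (f n) < ennreal \<epsilon>" by (simp add: uniform_dist_def fh2)
    with fhJ d1 have "?good (f n)" by blast
    then show False using F by (simp add: f_def)
  qed
qed

end
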